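(* Let $\mu>0$ be fixed. For each $1<q<p$ let $v_{\mu,q}$ be the unique positive solution of $$-\Delta_p v=\mu|v|^{q-2}v\ \text{ in }\Omega,\qquad v=0\ \text{ on }\partial\Omega,$$ and set $$\mu_q:=\frac{\mu}{\|v_{\mu,q}\|_\infty^{p-q}},\qquad \Lambda_q:=\mu\,\frac{\|v_{\mu,q}\|_q^q}{\|v_{\mu,q}\|_p^p}.$$ There holds: (i) $\lambda_p\leqslant\Lambda_q$. (ii) $\Lambda_q\to\lambda_p$ as $q\to p^-$. (iii) There exists a positive constant $K$ which does not depend on $q$ such that $$0\leqslant\max\{(\lambda_p-\mu_q),(\Lambda_q-\lambda_p)\}\leqslant K(p-q)$$ for all $q$ sufficiently close to $p$, $q<p$.
   Context: Here $\Omega\subset\mathbb{R}^N$, $N\geqslant 2$, is a smooth bounded domain, $p>1$, and $\Delta_p u:=\operatorname{div}(|\nabla u|^{p-2}\nabla u)$ is the $p$-Laplacian. Solutions of Dirichlet problems are understood as weak solutions in $W_0^{1,p}(\Omega)$. $\|\cdot\|_\infty$ is the $L^\infty(\Omega)$ norm and $\|w\|_r=\left(\int_\Omega|w|^r dx\right)^{1/r}$ is the $L^r(\Omega)$ norm. The number $\lambda_p$ is the first eigenvalue of $-\Delta_p$ with homogeneous Dirichlet boundary condition: $\lambda_p=\min_{u\in W_0^{1,p}(\Omega)\setminus\{0\}}\int_\Omega|\nabla u|^p dx/\int_\Omega|u|^p dx>0$. It is known that for $1<q<p$ and $\mu>0$ the problem $-\Delta_p v=\mu|v|^{q-2}v$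 in $\Omega$, $v=0$ on $\partial\Omega$, has exactly one positive solution, denoted $v_{\mu,q}$; it belongs to $C^{1,\alpha}(\overline\Omega)$ for some $0<\alpha<1$. *)

theory Defs
  imports "HOL-Analysis.Analysis" "HOL-Probability.Essential_Supremum"
begin

section \<open>Smooth functions and smooth domains\<close>

text \<open>Meaningful for open sets \<open>S\<close>, where the derivative at a point depends only on values in \<open>S\<close>.\<close>

primrec Ck_on :: "nat \<Rightarrow> 'a::euclidean_space set \<Rightarrow> ('a \<Rightarrow> real) \<Rightarrow> bool" where
  "Ck_on 0 S f \<longleftrightarrow> continuous_on S f"
| "Ck_on (Suc k) S f \<longleftrightarrow>
     (\<forall>x\<in>S. f differentiable (at x)) \<and>
     (\<forall>b\<in>Basis. Ck_on k S (\<lambda>x. frechet_derivative f (at x) b))"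

definition smooth_on :: "'a::euclidean_space set \<Rightarrow> ('a \<Rightarrow> real) \<Rightarrow> bool" where
  "smooth_on S f \<longleftrightarrow> (\<forall>k. Ck_on k S f)"

definition gradient :: "('a::euclidean_space \<Rightarrow> real) \<Rightarrow> 'a \<Rightarrow> 'a" where
  "gradient f x = (\<Sum>b\<in>Basis. frechet_derivative f (at x) b *\<^sub>R b)"

text \<open>Smoothness of the boundary is expressed by local defining functions: near each boundary
  point the domain is the sublevel set of a smooth function with nonvanishing gradient.\<close>

definition smooth_bounded_domain :: "'a::euclidean_space set \<Rightarrow> bool" where
  "smooth_bounded_domain \<Omega> \<longleftrightarrow>
     open \<Omega> \<and> connected \<Omega> \<and> \<Omega> \<noteq> {} \<and> bounded \<Omega> \<and>
     (\<forall>x0\<in>frontier \<Omega>. \<exists>U \<rho>. open U \<and> x0 \<in> U \<and> smooth_on U \<rho> \<and>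
        (\<forall>x\<in>U. gradient \<rho> x \<noteq> 0) \<and> \<Omega> \<inter> U = {x\<in>U. \<rho> x < 0})"


section \<open>Lebesgue spaces\<close>

definition in_Lp :: "'a::euclidean_space set \<Rightarrow> real \<Rightarrow> ('a \<Rightarrow> 'b::euclidean_space) \<Rightarrow> bool" where
  "in_Lp \<Omega> r w \<longleftrightarrow> w \<in> borel_measurable (lebesgue_on \<Omega>) \<and>
     integrable (lebesgue_on \<Omega>) (\<lambda>x. norm (w x) powr r)"

definition Lp_norm :: "'a::euclidean_space set \<Rightarrow> real \<Rightarrow> ('a \<Rightarrow> 'b::euclidean_space) \<Rightarrow> real" where
  "Lp_norm \<Omega> r w = (LINT x|lebesgue_on \<Omega>. norm (w x) powr r) powr (1 / r)"

text \<open>The conversion \<^const>\<open>real_of_ereal\<close> sends \<open>\<infinity>\<close> to \<open>0\<close>; the value is the \<open>L\<^sup>\<infinity>\<close> norm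
  for essentially bounded functions.\<close>

definition Linf_norm :: "'a::euclidean_space set \<Rightarrow> ('a \<Rightarrow> real) \<Rightarrow> real" where
  "Linf_norm \<Omega> w = real_of_ereal (esssup (lebesgue_on \<Omega>) (\<lambda>x. ereal \<bar>w x\<bar>))"


section \<open>Sobolev spaces\<close>

definition test_function :: "'a::euclidean_space set \<Rightarrow> ('a \<Rightarrow> real) \<Rightarrow> bool" where
  "test_function \<Omega> \<phi> \<longleftrightarrow> smooth_on UNIV \<phi> \<and>
     (\<exists>C. compact C \<and> C \<subseteq> \<Omega> \<and> (\<forall>x. x \<notin> C \<longrightarrow> \<phi> x = 0))"

definition locally_integrable :: "'a::euclidean_space set \<Rightarrow> ('a \<Rightarrow> 'b::euclidean_space) \<Rightarrow> bool" where
  "locally_integrable \<Omega> w \<longleftrightarrow> (\<forall>C. compact C \<and> C \<subseteq> \<Omega> \<longrightarrow> integrable (lebesgue_on C) w)"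

text \<open>Integration by parts is stated as one vector-valued identity; its components are the
  usual conditions on the partial derivatives.\<close>

definition has_weak_gradient ::
  "'a::euclidean_space set \<Rightarrow> ('a \<Rightarrow> real) \<Rightarrow> ('a \<Rightarrow> 'a) \<Rightarrow> bool" where
  "has_weak_gradient \<Omega> u Du \<longleftrightarrow> locally_integrable \<Omega> u \<and> locally_integrable \<Omega> Du \<and>
     (\<forall>\<phi>. test_function \<Omega> \<phi> \<longrightarrow>
        (LINT x|lebesgue_on \<Omega>. u x *\<^sub>R gradient \<phi> x) =
        - (LINT x|lebesgue_on \<Omega>. \<phi> x *\<^sub>R Du x))"

text \<open>Weak gradients are unique only up to null sets, so Sobolev functions are handled together
  with a representative \<open>Du\<close> of their weak gradient.\<close>

definition W1p :: "'a::euclidean_space set \<Rightarrow> real \<Rightarrow> ('a \<Rightarrow> real) \<Rightarrow> ('a \<Rightarrow> 'a) \<Rightarrow> bool" where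
  "W1p \<Omega> p u Du \<longleftrightarrow> in_Lp \<Omega> p u \<and> in_Lp \<Omega> p Du \<and> has_weak_gradient \<Omega> u Du"

text \<open>The closure of the test functions in the norm of \<open>W\<^sup>1\<^sup>,\<^sup>p\<close>.\<close>

definition W1p0 :: "'a::euclidean_space set \<Rightarrow> real \<Rightarrow> ('a \<Rightarrow> real) \<Rightarrow> ('a \<Rightarrow> 'a) \<Rightarrow> bool" where
  "W1p0 \<Omega> p u Du \<longleftrightarrow> W1p \<Omega> p u Du \<and>
     (\<forall>\<epsilon>>0. \<exists>\<phi>. test_function \<Omega> \<phi> \<and>
        Lp_norm \<Omega> p (\<lambda>x. u x - \<phi> x) + Lp_norm \<Omega> p (\<lambda>x. Du x - gradient \<phi> x) < \<epsilon>)"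


section \<open>The p-Laplacian\<close>

text \<open>The infimum is attained, so it is the minimum of the Rayleigh quotient.\<close>

definition first_eigenvalue :: "'a::euclidean_space set \<Rightarrow> real \<Rightarrow> real" where
  "first_eigenvalue \<Omega> p =
     Inf {(LINT x|lebesgue_on \<Omega>. norm (Du x) powr p) / (LINT x|lebesgue_on \<Omega>. \<bar>u x\<bar> powr p)
          | u Du. W1p0 \<Omega> p u Du \<and> \<not> (AE x in lebesgue_on \<Omega>. u x = 0)}"

text \<open>Since \<open>0 powr a = 0\<close> and the factors \<open>Dv x\<close>, \<open>v x\<close> vanish with their norms, the two
  integrands have the intended value \<open>0\<close> at zeros of \<open>Dv\<close> and \<open>v\<close> also for exponents below \<open>2\<close>.\<close>

definition weak_solution ::
  "'a::euclidean_space set \<Rightarrow> real \<Rightarrow> real \<Rightarrow> real \<Rightarrow> ('a \<Rightarrow> real) \<Rightarrow> bool" where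
  "weak_solution \<Omega> p \<mu> q v \<longleftrightarrow> (\<exists>Dv. W1p0 \<Omega> p v Dv \<and>
     (\<forall>\<phi> D\<phi>. W1p0 \<Omega> p \<phi> D\<phi> \<longrightarrow>
        (LINT x|lebesgue_on \<Omega>. norm (Dv x) powr (p - 2) * (Dv x \<bullet> D\<phi> x)) =
        \<mu> * (LINT x|lebesgue_on \<Omega>. \<bar>v x\<bar> powr (q - 2) * v x * \<phi> x)))"

definition positive_solution ::
  "'a::euclidean_space set \<Rightarrow> real \<Rightarrow> real \<Rightarrow> real \<Rightarrow> ('a \<Rightarrow> real) \<Rightarrow> bool" where
  "positive_solution \<Omega> p \<mu> q v \<longleftrightarrow>
     weak_solution \<Omega> p \<mu> q v \<and> (AE x in lebesgue_on \<Omega>. 0 < v x)"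

definition mu_q :: "'a::euclidean_space set \<Rightarrow> real \<Rightarrow> real \<Rightarrow> real \<Rightarrow> ('a \<Rightarrow> real) \<Rightarrow> real" where
  "mu_q \<Omega> p \<mu> q v = \<mu> / Linf_norm \<Omega> v powr (p - q)"

definition Lambda_q :: "'a::euclidean_space set \<Rightarrow> real \<Rightarrow> real \<Rightarrow> real \<Rightarrow> ('a \<Rightarrow> real) \<Rightarrow> real" where
  "Lambda_q \<Omega> p \<mu> q v = \<mu> * (Lp_norm \<Omega> q v powr q / Lp_norm \<Omega> p v powr p)"

end

theory Submission
  imports Defs
begin

text \<open>The Picone inequality for the solution \<open>v\<close> with supremum \<open>L\<close>, tested with functions in
  \<open>W\<^sub>0\<^sup>1\<^sup>,\<^sup>p\<close>, gives \<open>\<mu>\<^sub>q \<le> \<lambda>\<^sub>p\<close>, because \<open>v powr (q - p) \<ge> L powr (q - p)\<close>; testing the equation with \<open>v\<close>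
  itself shows that \<open>\<Lambda>\<^sub>q\<close> is a Rayleigh quotient, so \<open>\<mu>\<^sub>q \<le> \<lambda>\<^sub>p \<le> \<Lambda>\<^sub>q\<close>. With \<open>u = v / L\<close> the ratio \<open>\<Lambda>\<^sub>q / \<mu>\<^sub>q\<close>
  is the quotient of the integrals of \<open>u powr q\<close> and \<open>u powr p\<close>, and \<open>u powr q - u powr p \<le> p - q\<close> since
  \<open>0 < u \<le> 1\<close>. Hence \<open>\<Lambda>\<^sub>q - \<mu>\<^sub>q = O(p - q)\<close> as soon as the integral of \<open>u powr p\<close> is bounded below uniformly
  in \<open>q\<close>, which is a De Giorgi type estimate of the supremum by the \<open>L\<^sup>p\<close> norm. The gain of
  integrability it needs comes from a Poincare inequality on small sets, proved by translations.\<close>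

section \<open>Smooth functions and their gradients\<close>

text \<open>The equation is known only in weak form and \<open>v\<close> only as a member of
  \<open>W1p0\<close>. So boundedness of \<open>v\<close> has to be proved before
  \<open>Linf_norm\<close> carries information, and the natural Picone test function |phi|^p /
  v^(p-1) is out of reach because \<open>v\<close> may come arbitrarily close to 0. Since
  \<open>W1p0\<close> is a closure of smooth compactly supported functions, every nonlinear test
  function is built from smooth nonlinearities based on sqrt(t^2 + s^2), applied to approximating
  test functions and followed by a limit. For the level set iteration some positive power of the
  measure of a small support suffices in the Poincare inequality; translations give the power p/N,
  uniformly in the relation between p and N. Uniformity in q rests on the order of the estimates:
  the Picone bound for \<open>mu_q\<close> keeps the coefficient of the iteration bounded as q tends
  to p, so it has to precede the lower bound for the mass. Both differences in (iii) are below
  \<open>Lambda_q - mu_q\<close>, and (ii) follows from the same gap estimate.\<close>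

lemma Ck_on_SucD:
  fixes f :: "'a::euclidean_space \<Rightarrow> real"
  shows "Ck_on (Suc k) UNIV f \<Longrightarrow> Ck_on k UNIV f"
proof (induction k arbitrary: f)
  case 0
  then show ?case
    by (auto simp: continuous_on_eq_continuous_at intro: differentiable_imp_continuous_within)
next
  case (Suc k)
  from Suc.prems have "\<forall>x. f differentiable (at x)"
    and "\<forall>b\<in>Basis. Ck_on (Suc k) UNIV (\<lambda>x. frechet_derivative f (at x) b)"
    by (auto simp del: Ck_on.simps(2) simp add: Ck_on.simps(2)[of "Suc k"])
  with Suc.IH show ?case by auto
qed

lemma frechet_derivative_apply:
  assumes "(f has_derivative f') (at x)"
  shows "frechet_derivative f (at x) b = f' b"
  using frechet_derivative_at[OF assms] by simp

text \<open>Lets closure proofs supply the derivative in explicit form;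
  \<open>frechet_derivative\<close> is identified with it by uniqueness.\<close>

lemma Ck_on_SucI:
  fixes f :: "'a::euclidean_space \<Rightarrow> real"
  assumes "\<And>x. (f has_derivative f' x) (at x)"
    and "\<And>b. b \<in> Basis \<Longrightarrow> Ck_on k UNIV (\<lambda>x. f' x b)"
  shows "Ck_on (Suc k) UNIV f"
  using assms by (auto simp: frechet_derivative_apply[OF assms(1)] differentiable_def)

lemma Ck_on_Suc_derivative:
  fixes f :: "'a::euclidean_space \<Rightarrow> real"
  assumes "Ck_on (Suc k) UNIV f"
  shows "(f has_derivative frechet_derivative f (at x)) (at x)"
    and "b \<in> Basis \<Longrightarrow> Ck_on k UNIV (\<lambda>x. frechet_derivative f (at x) b)"
  using assms by (simp_all add: frechet_derivative_works)

lemma Ck_on_const: "Ck_on k UNIV (\<lambda>x::'a::euclidean_space. c)"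
proof (induction k arbitrary: c)
  case (Suc k)
  show ?case by (rule Ck_on_SucI[where f' = "\<lambda>_ _. 0"]) (auto intro: Suc)
qed auto

lemma Ck_on_add:
  fixes f g :: "'a::euclidean_space \<Rightarrow> real"
  shows "Ck_on k UNIV f \<Longrightarrow> Ck_on k UNIV g \<Longrightarrow> Ck_on k UNIV (\<lambda>x. f x + g x)"
proof (induction k arbitrary: f g)
  case 0
  then show ?case by (auto intro: continuous_intros)
next
  case (Suc k)
  note f' = Ck_on_Suc_derivative[OF Suc.prems(1)]
  note g' = Ck_on_Suc_derivative[OF Suc.prems(2)]
  show ?case
    by (rule Ck_on_SucI[OF has_derivative_add[OF f'(1) g'(1)]]) (intro Suc.IH f' g')
qed

text \<open>The product rule mixes derivatives of one factor with the other factor itself, so the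
  induction also uses both factors at one order lower, which \<open>Ck_on_SucD\<close>
  provides.\<close>

lemma Ck_on_mult:
  fixes f g :: "'a::euclidean_space \<Rightarrow> real"
  shows "Ck_on k UNIV f \<Longrightarrow> Ck_on k UNIV g \<Longrightarrow> Ck_on k UNIV (\<lambda>x. f x * g x)"
proof (induction k arbitrary: f g)
  case 0
  then show ?case by (auto intro: continuous_intros)
next
  case (Suc k)
  note f' = Ck_on_Suc_derivative[OF Suc.prems(1)]
  note g' = Ck_on_Suc_derivative[OF Suc.prems(2)]
  show ?case
    by (rule Ck_on_SucI[OF has_derivative_mult[OF f'(1) g'(1)]])
      (intro Ck_on_add Suc.IH f' g' Suc.prems[THEN Ck_on_SucD])
qed

text \<open>Differentiation turns the exponent into \<open>a - 1\<close>, hence the induction runs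
  over all exponents at once.\<close>

lemma Ck_on_powr:
  fixes f :: "'a::euclidean_space \<Rightarrow> real"
  assumes "\<And>x. 0 < f x"
  shows "Ck_on k UNIV f \<Longrightarrow> Ck_on k UNIV (\<lambda>x. f x powr a)"
proof (induction k arbitrary: a)
  case 0
  then show ?case using assms by (auto intro!: continuous_intros simp: less_imp_neq[symmetric])
next
  case (Suc k)
  note f' = Ck_on_Suc_derivative[OF Suc.prems]
  have d: "((\<lambda>x. f x powr a) has_derivative (\<lambda>h. a * f x powr (a - 1) * frechet_derivative f (at x) h)) (at x)" for x
  proof -
    have "((\<lambda>y. y powr a) has_derivative (\<lambda>h. a * f x powr (a - 1) * h)) (at (f x))"
      using has_real_derivative_powr[OF assms[of x], of a]
      by (simp add: has_field_derivative_def)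
    from has_derivative_compose[OF f'(1) this] show ?thesis .
  qed
  show ?case
    by (rule Ck_on_SucI[OF d])
      (intro Ck_on_mult Ck_on_const f' Suc.IH Suc.prems[THEN Ck_on_SucD])
qed

lemma smooth_on_const: "smooth_on UNIV (\<lambda>x::'a::euclidean_space. c)"
  by (simp add: smooth_on_def Ck_on_const)

lemma smooth_on_add:
  fixes f g :: "'a::euclidean_space \<Rightarrow> real"
  shows "smooth_on UNIV f \<Longrightarrow> smooth_on UNIV g \<Longrightarrow> smooth_on UNIV (\<lambda>x. f x + g x)"
  by (simp add: smooth_on_def Ck_on_add)

lemma smooth_on_mult:
  fixes f g :: "'a::euclidean_space \<Rightarrow> real"
  shows "smooth_on UNIV f \<Longrightarrow> smooth_on UNIV g \<Longrightarrow> smooth_on UNIV (\<lambda>x. f x * g x)"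
  by (simp add: smooth_on_def Ck_on_mult)

lemma smooth_on_diff:
  fixes f g :: "'a::euclidean_space \<Rightarrow> real"
  assumes "smooth_on UNIV f" "smooth_on UNIV g"
  shows "smooth_on UNIV (\<lambda>x. f x - g x)"
  using smooth_on_add[OF assms(1) smooth_on_mult[OF smooth_on_const[of "-1"] assms(2)]] by simp

lemma smooth_on_powr:
  fixes f :: "'a::euclidean_space \<Rightarrow> real"
  shows "smooth_on UNIV f \<Longrightarrow> (\<And>x. 0 < f x) \<Longrightarrow> smooth_on UNIV (\<lambda>x. f x powr a)"
  by (simp add: smooth_on_def Ck_on_powr)

text \<open>For s > 0 a smooth stand-in for |t|, lying between |t| and |t| + s, with derivative in
  [-1, 1]. It serves for the truncations, for |phi|, and for the identity on positive reals.\<close>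

definition smooth_abs :: "real \<Rightarrow> real \<Rightarrow> real" where
  "smooth_abs s t = sqrt (t\<^sup>2 + s\<^sup>2)"

lemma smooth_abs_bounds:
  assumes "0 < s"
  shows "0 < smooth_abs s t" "\<bar>t\<bar> \<le> smooth_abs s t" "s \<le> smooth_abs s t" "smooth_abs s t \<le> \<bar>t\<bar> + s"
proof -
  show "0 < smooth_abs s t" using assms by (simp add: smooth_abs_def add_nonneg_pos)
  show "\<bar>t\<bar> \<le> smooth_abs s t" by (simp add: smooth_abs_def)
  show "s \<le> smooth_abs s t" by (simp add: smooth_abs_def)
  show "smooth_abs s t \<le> \<bar>t\<bar> + s"
    using real_sqrt_sum_squares_triangle_ineq[of t 0 0 s] assms by (simp add: smooth_abs_def)
qed

lemma continuous_on_smooth_abs [continuous_intros]: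
  "continuous_on S f \<Longrightarrow> continuous_on S (\<lambda>x. smooth_abs s (f x))"
  unfolding smooth_abs_def by (intro continuous_intros)

lemma DERIV_smooth_abs:
  assumes "0 < s"
  shows "((\<lambda>t. smooth_abs s (t + a)) has_real_derivative (t + a) / smooth_abs s (t + a)) (at t)"
proof -
  have "0 < (t + a)\<^sup>2 + s\<^sup>2" using assms by (simp add: add_nonneg_pos)
  then show ?thesis
    unfolding smooth_abs_def by (auto intro!: derivative_eq_intros simp: divide_simps)
qed

text \<open>The square root is read as \<open>powr (1 / 2)\<close> of a positive function, so that
  closure under \<open>powr\<close> applies.\<close>

lemma smooth_on_smooth_abs:
  fixes f :: "'a::euclidean_space \<Rightarrow> real"
  assumes "smooth_on UNIV f" "0 < s"
  shows "smooth_on UNIV (\<lambda>x. smooth_abs s (f x))"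
proof -
  have pos: "0 < f x * f x + s * s" for x using assms(2) by (simp add: add_nonneg_pos)
  have "smooth_on UNIV (\<lambda>x. (f x * f x + s * s) powr (1 / 2))"
    by (intro smooth_on_powr smooth_on_add smooth_on_mult smooth_on_const assms(1) pos)
  moreover have "(f x * f x + s * s) powr (1 / 2) = smooth_abs s (f x)" for x
    using pos[of x] by (simp add: smooth_abs_def powr_half_sqrt power2_eq_square)
  ultimately show ?thesis by simp
qed

lemmas smooth_intros = smooth_on_smooth_abs smooth_on_const smooth_on_add smooth_on_mult smooth_on_diff smooth_on_powr

section \<open>Gradients, and test functions with their supports and bounds\<close>

lemma gradient_eqI:
  fixes f :: "'a::euclidean_space \<Rightarrow> real"
  assumes "(f has_derivative (\<lambda>h. d \<bullet> h)) (at x)"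
  shows "gradient f x = d"
  unfolding gradient_def frechet_derivative_apply[OF assms] by (rule euclidean_representation)

lemma has_derivative_gradient:
  fixes f :: "'a::euclidean_space \<Rightarrow> real"
  assumes "smooth_on UNIV f"
  shows "(f has_derivative (\<lambda>h. gradient f x \<bullet> h)) (at x)"
proof -
  have "Ck_on (Suc 0) UNIV f" using assms unfolding smooth_on_def by blast
  then have d: "(f has_derivative frechet_derivative f (at x)) (at x)"
    by (simp add: frechet_derivative_works)
  then interpret bounded_linear "frechet_derivative f (at x)" by (rule has_derivative_bounded_linear)
  have "frechet_derivative f (at x) h = gradient f x \<bullet> h" for h
  proof -
    have "frechet_derivative f (at x) h = frechet_derivative f (at x) (\<Sum>b\<in>Basis. (h \<bullet> b) *\<^sub>R b)"
      by (simp add: euclidean_representation)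
    also have "\<dots> = gradient f x \<bullet> h"
      unfolding sum gradient_def inner_sum_left
      by (intro sum.cong) (auto simp: scaleR inner_commute)
    finally show ?thesis .
  qed
  then show ?thesis using d by presburger
qed

lemma continuous_on_gradient:
  fixes f :: "'a::euclidean_space \<Rightarrow> real"
  assumes "smooth_on UNIV f"
  shows "continuous_on UNIV (gradient f)"
proof -
  have "Ck_on (Suc 0) UNIV f" using assms unfolding smooth_on_def by blast
  then show ?thesis unfolding gradient_def[abs_def] by (auto intro!: continuous_intros)
qed

lemma smooth_on_continuous:
  fixes f :: "'a::euclidean_space \<Rightarrow> real"
  shows "smooth_on UNIV f \<Longrightarrow> continuous_on UNIV f"
  unfolding smooth_on_def by (metis Ck_on.simps(1))

lemma gradient_compose:
  fixes f :: "'a::euclidean_space \<Rightarrow> real"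
  assumes "smooth_on UNIV f" "(F has_real_derivative F') (at (f x))"
  shows "gradient (\<lambda>x. F (f x)) x = F' *\<^sub>R gradient f x"
  by (rule gradient_eqI)
    (use has_derivative_compose[OF has_derivative_gradient[OF assms(1)], of F "\<lambda>h. F' * h"] assms(2)
      in \<open>simp add: has_field_derivative_def\<close>)

lemma gradient_mult:
  fixes f g :: "'a::euclidean_space \<Rightarrow> real"
  assumes "smooth_on UNIV f" "smooth_on UNIV g"
  shows "gradient (\<lambda>x. f x * g x) x = f x *\<^sub>R gradient g x + g x *\<^sub>R gradient f x"
  by (rule gradient_eqI)
    (use has_derivative_mult[OF assms[THEN has_derivative_gradient]] in
      \<open>simp add: inner_add_left mult.commute\<close>)

lemma test_function_smooth: "test_function \<Omega> f \<Longrightarrow> smooth_on UNIV f"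
  by (simp add: test_function_def)

text \<open>The complement of the compact set is open, so \<open>f\<close> vanishes near each of its
  points and the gradient is 0 there as well.\<close>

lemma test_functionE:
  fixes f :: "'a::euclidean_space \<Rightarrow> real"
  assumes "test_function \<Omega> f"
  obtains C where "compact C" "C \<subseteq> \<Omega>" "\<And>x. x \<notin> C \<Longrightarrow> f x = 0" "\<And>x. x \<notin> C \<Longrightarrow> gradient f x = 0"
proof -
  obtain C where C: "compact C" "C \<subseteq> \<Omega>" "\<And>x. x \<notin> C \<Longrightarrow> f x = 0"
    using assms by (auto simp: test_function_def)
  have "gradient f x = 0" if "x \<notin> C" for x
  proof (rule gradient_eqI)
    have "((\<lambda>_. 0) has_derivative (\<lambda>h. 0 \<bullet> h)) (at x)" by simp
    moreover have "open (- C)" using C(1) by (simp add: compact_imp_closed open_Compl)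
    ultimately show "(f has_derivative (\<lambda>h. 0 \<bullet> h)) (at x)"
      by (rule has_derivative_transform_within_open) (use C(3) that in auto)
  qed
  with C that show ?thesis by blast
qed

lemma test_function_mult:
  assumes "test_function \<Omega> f" "smooth_on UNIV g"
  shows "test_function \<Omega> (\<lambda>x. g x * f x)"
proof -
  obtain C where "compact C" "C \<subseteq> \<Omega>" "\<forall>x. x \<notin> C \<longrightarrow> f x = 0"
    using assms by (auto simp: test_function_def)
  then show ?thesis
    using assms smooth_on_mult[of g f] by (auto simp: test_function_def intro!: exI[of _ C])
qed

lemma test_function_compose:
  assumes "test_function \<Omega> f" "smooth_on UNIV (\<lambda>x. G (f x))" "G 0 = 0"
  shows "test_function \<Omega> (\<lambda>x. G (f x))"
proof -
  obtain C where "compact C" "C \<subseteq> \<Omega>" "\<forall>x. x \<notin> C \<longrightarrow> f x = 0"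
    using assms by (auto simp: test_function_def)
  then show ?thesis
    using assms(2,3) by (auto simp: test_function_def intro!: exI[of _ C])
qed

lemma compact_support_bounded:
  fixes f :: "'a::euclidean_space \<Rightarrow> 'b::real_normed_vector"
  assumes "continuous_on UNIV f" "compact C" "\<And>x. x \<notin> C \<Longrightarrow> f x = 0"
  obtains B where "0 < B" "\<And>x. norm (f x) \<le> B"
proof -
  have "bounded (f ` C)"
    using assms by (intro compact_imp_bounded compact_continuous_image) (auto intro: continuous_on_subset)
  then obtain B where "0 < B" "\<And>x. x \<in> C \<Longrightarrow> norm (f x) \<le> B" by (auto simp: bounded_pos)
  then show ?thesis using that[of B] assms(3) by (metis less_imp_le norm_zero)
qed

lemma test_function_bounded:
  assumes "test_function \<Omega> f"
  obtains B where "0 < B" "\<And>x. \<bar>f x\<bar> \<le> B" "\<And>x. norm (gradient f x) \<le> B"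
proof -
  obtain C where C: "compact C" "\<And>x. x \<notin> C \<Longrightarrow> f x = 0" "\<And>x. x \<notin> C \<Longrightarrow> gradient f x = 0"
    using assms by (metis test_functionE)
  have sm: "smooth_on UNIV f" using assms by (rule test_function_smooth)
  obtain B1 where "0 < B1" "\<And>x. norm (f x) \<le> B1"
    using compact_support_bounded[OF smooth_on_continuous[OF sm] C(1,2)] by blast
  moreover obtain B2 where "0 < B2" "\<And>x. norm (gradient f x) \<le> B2"
    using compact_support_bounded[OF continuous_on_gradient[OF sm] C(1,3)] by blast
  ultimately show ?thesis
    using that[of "max B1 B2"] by (auto simp: le_max_iff_disj)
qed

section \<open>Lebesgue spaces on a bounded domain\<close>

text \<open>The factor \<open>2 powr p\<close> comes from a + b <= 2 max a b. This bound stands in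
  for the triangle inequality on p-th powers throughout, and its factor reappears in
  \<open>Poincare_const\<close>.\<close>

lemma powr_add_le:
  fixes a b p :: real
  assumes "0 \<le> a" "0 \<le> b" "0 \<le> p"
  shows "(a + b) powr p \<le> 2 powr p * (a powr p + b powr p)"
proof -
  have "(a + b) powr p \<le> (2 * max a b) powr p"
    using assms by (intro powr_mono2) auto
  also have "\<dots> = 2 powr p * max a b powr p"
    using assms by (simp add: powr_mult)
  also have "\<dots> \<le> 2 powr p * (a powr p + b powr p)"
    by (intro mult_left_mono) (auto simp: max_def)
  finally show ?thesis .
qed

lemma norm_add_powr_le:
  fixes x y :: "'b::real_normed_vector"
  assumes "0 \<le> p"
  shows "norm (x + y) powr p \<le> 2 powr p * (norm x powr p + norm y powr p)"
  using powr_mono2[OF assms norm_ge_zero norm_triangle_ineq[of x y]] powr_add_le[of "norm x" "norm y" p] assms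
  by simp

lemma norm_diff_powr_le:
  fixes x y :: "'b::real_normed_vector"
  assumes "0 \<le> p"
  shows "norm (x - y) powr p \<le> 2 powr p * (norm x powr p + norm y powr p)"
  using norm_add_powr_le[OF assms, of x "- y"] by simp

lemma continuous_borel_lebesgue_on:
  fixes f :: "'a::euclidean_space \<Rightarrow> 'b::euclidean_space"
  assumes "continuous_on UNIV f" "S \<in> sets lebesgue"
  shows "f \<in> borel_measurable (lebesgue_on S)"
  using assms by (intro continuous_imp_measurable_on_sets_lebesgue) (auto intro: continuous_on_subset)

lemma LIMSEQ_0_upper:
  fixes f g :: "nat \<Rightarrow> real"
  assumes "\<And>n. 0 \<le> f n" "\<And>n. f n \<le> g n" "g \<longlonglongrightarrow> 0"
  shows "f \<longlonglongrightarrow> 0"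
  by (rule tendsto_sandwich[OF _ _ tendsto_const assms(3)]) (auto simp: assms)

locale bounded_domain =
  fixes \<Omega> :: "'a::euclidean_space set" and p :: real
  assumes open_\<Omega>: "open \<Omega>" and bounded_\<Omega>: "bounded \<Omega>" and p_gt_1: "1 < p"
begin

abbreviation "M \<equiv> lebesgue_on \<Omega>"

lemma \<Omega>_sets: "\<Omega> \<in> sets lebesgue"
  using open_\<Omega> by (simp add: borel_open)

sublocale finite_measure M
  using open_\<Omega> bounded_\<Omega> by (intro finite_measure_lebesgue_on lmeasurable_open)

lemmas cont_meas = continuous_borel_lebesgue_on[OF _ \<Omega>_sets]

lemma in_Lp_measurable: "in_Lp \<Omega> p f \<Longrightarrow> f \<in> borel_measurable M"
  by (simp add: in_Lp_def)

lemma in_Lp_integrable: "in_Lp \<Omega> p f \<Longrightarrow> integrable M (\<lambda>x. norm (f x) powr p)"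
  by (simp add: in_Lp_def)

lemma in_Lp_dominated:
  fixes g :: "'a \<Rightarrow> 'b::euclidean_space"
  assumes "g \<in> borel_measurable M" "integrable M w"
    and "AE x in M. norm (g x) powr p \<le> w x"
  shows "in_Lp \<Omega> p g"
  unfolding in_Lp_def
proof
  show "integrable M (\<lambda>x. norm (g x) powr p)"
    by (rule Bochner_Integration.integrable_bound[OF assms(2)]) (use assms in auto)
qed fact

lemma in_Lp_add:
  fixes f g :: "'a \<Rightarrow> 'b::euclidean_space"
  assumes "in_Lp \<Omega> p f" "in_Lp \<Omega> p g"
  shows "in_Lp \<Omega> p (\<lambda>x. f x + g x)"
proof (rule in_Lp_dominated)
  show "integrable M (\<lambda>x. 2 powr p * (norm (f x) powr p + norm (g x) powr p))"
    using assms by (auto simp: in_Lp_def)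
  show "AE x in M. norm (f x + g x) powr p \<le> 2 powr p * (norm (f x) powr p + norm (g x) powr p)"
    using norm_add_powr_le[of p] p_gt_1 by (intro AE_I2) auto
qed (use assms in \<open>auto simp: in_Lp_def\<close>)

lemma in_Lp_uminus: "in_Lp \<Omega> p f \<Longrightarrow> in_Lp \<Omega> p (\<lambda>x. - f x)"
  for f :: "'a \<Rightarrow> 'b::euclidean_space"
  by (simp add: in_Lp_def)

lemma in_Lp_diff:
  fixes f g :: "'a \<Rightarrow> 'b::euclidean_space"
  assumes "in_Lp \<Omega> p f" "in_Lp \<Omega> p g"
  shows "in_Lp \<Omega> p (\<lambda>x. f x - g x)"
  using in_Lp_add[OF assms(1) in_Lp_uminus[OF assms(2)]] by simp

lemma in_Lp_bound_by:
  fixes f :: "'a \<Rightarrow> 'b::euclidean_space" and g :: "'a \<Rightarrow> 'c::euclidean_space"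
  assumes "in_Lp \<Omega> p f" "g \<in> borel_measurable M" "0 \<le> C"
    and "AE x in M. norm (g x) \<le> C * norm (f x)"
  shows "in_Lp \<Omega> p g"
proof (rule in_Lp_dominated)
  show "integrable M (\<lambda>x. C powr p * norm (f x) powr p)"
    using assms by (auto simp: in_Lp_def)
  show "AE x in M. norm (g x) powr p \<le> C powr p * norm (f x) powr p"
    using assms(4)
  proof eventually_elim
    case (elim x)
    then have "norm (g x) powr p \<le> (C * norm (f x)) powr p"
      using p_gt_1 by (intro powr_mono2) auto
    then show ?case using assms(3) by (simp add: powr_mult)
  qed
qed fact

lemma in_Lp_const: "in_Lp \<Omega> p (\<lambda>_. c::'b::euclidean_space)"
  by (simp add: in_Lp_def)

lemma in_Lp_bounded:
  fixes g :: "'a \<Rightarrow> 'c::euclidean_space"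
  assumes "g \<in> borel_measurable M" "AE x in M. norm (g x) \<le> C"
  shows "in_Lp \<Omega> p g"
  by (rule in_Lp_bound_by[OF in_Lp_const[of "\<bar>C\<bar>"], of g 1]) (use assms in auto)

lemma in_Lp_test:
  assumes "test_function \<Omega> \<phi>"
  shows "in_Lp \<Omega> p \<phi>" "in_Lp \<Omega> p (gradient \<phi>)"
proof -
  obtain B where B: "\<And>x. \<bar>\<phi> x\<bar> \<le> B" "\<And>x. norm (gradient \<phi> x) \<le> B"
    using test_function_bounded[OF assms] by metis
  note sm = test_function_smooth[OF assms]
  show "in_Lp \<Omega> p \<phi>"
    using B by (intro in_Lp_bounded[of _ B] cont_meas smooth_on_continuous[OF sm]) auto
  show "in_Lp \<Omega> p (gradient \<phi>)"
    using B by (intro in_Lp_bounded[of _ B] cont_meas continuous_on_gradient[OF sm]) auto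
qed

text \<open>Above the level \<tau> one has t = t^(1-p) t^p with t^(1-p) <= \<tau>^(1-p). The free
  level is what turns smallness in L^p into smallness in L^1.\<close>

lemma le_powr_trade:
  fixes t \<tau> :: real
  assumes "0 \<le> t" "0 < \<tau>"
  shows "t \<le> \<tau> + \<tau> powr (1 - p) * t powr p"
proof (cases "t \<le> \<tau>")
  case False
  then have "t = t powr (1 - p) * t powr p"
    using assms by (simp flip: powr_add)
  also have "\<dots> \<le> \<tau> powr (1 - p) * t powr p"
    using False assms p_gt_1 by (intro mult_right_mono powr_mono2') auto
  finally show ?thesis using assms by linarith
qed (use assms in \<open>simp add: add_increasing2\<close>)

lemma in_Lp_imp_integrable:
  fixes f :: "'a \<Rightarrow> 'b::euclidean_space"
  assumes "in_Lp \<Omega> p f"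
  shows "integrable M f"
proof (rule Bochner_Integration.integrable_bound)
  show "integrable M (\<lambda>x. 1 + norm (f x) powr p)" using assms by (auto simp: in_Lp_def)
  show "AE x in M. norm (f x) \<le> norm (1 + norm (f x) powr p)"
    using le_powr_trade[of "norm (f _)" 1] by (intro AE_I2) simp
qed (use assms in \<open>simp add: in_Lp_def\<close>)

lemma Lp_tendsto_imp_L1:
  fixes f :: "nat \<Rightarrow> 'a \<Rightarrow> 'b::euclidean_space"
  assumes "\<And>n. in_Lp \<Omega> p (f n)" "(\<lambda>n. LINT x|M. norm (f n x) powr p) \<longlonglongrightarrow> 0"
  shows "(\<lambda>n. LINT x|M. norm (f n x)) \<longlonglongrightarrow> 0"
proof (rule LIMSEQ_I)
  fix e :: real assume "0 < e"
  \<comment> \<open>This level makes the constant part contribute at most e/2; the summand 1 keeps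
    the denominator positive even if the measure of \<Omega> is 0.\<close>
  define \<tau> where "\<tau> = e / (2 * (measure M \<Omega> + 1))"
  have \<tau>: "0 < \<tau>" using \<open>0 < e\<close> by (simp add: \<tau>_def add_nonneg_pos)
  have "\<tau> * measure M \<Omega> \<le> e / 2"
  proof -
    have "measure M \<Omega> / (measure M \<Omega> + 1) \<le> 1"
      using measure_nonneg[of M \<Omega>] by (subst divide_le_eq_1) linarith
    then have "e / 2 * (measure M \<Omega> / (measure M \<Omega> + 1)) \<le> e / 2 * 1"
      using \<open>0 < e\<close> by (intro mult_left_mono) auto
    then show ?thesis by (simp add: \<tau>_def)
  qed
  have "(\<lambda>n. \<tau> powr (1 - p) * (LINT x|M. norm (f n x) powr p)) \<longlonglongrightarrow> 0"
    using tendsto_mult_right_zero[OF assms(2)] by simp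
  from LIMSEQ_D[OF this, of "e / 2"] \<open>0 < e\<close> obtain N where
    N: "\<And>n. n \<ge> N \<Longrightarrow> \<tau> powr (1 - p) * (LINT x|M. norm (f n x) powr p) < e / 2"
    by fastforce
  have "norm ((LINT x|M. norm (f n x)) - 0) < e" if "n \<ge> N" for n
  proof -
    have "(LINT x|M. norm (f n x)) \<le> (LINT x|M. \<tau> + \<tau> powr (1 - p) * norm (f n x) powr p)"
      by (intro integral_mono integrable_norm in_Lp_imp_integrable Bochner_Integration.integrable_add
          integrable_mult_right integrable_const in_Lp_integrable assms(1) le_powr_trade norm_ge_zero \<tau>)
    also have "\<dots> = \<tau> * measure M \<Omega> + \<tau> powr (1 - p) * (LINT x|M. norm (f n x) powr p)"
      using assms(1)[of n] by (simp add: in_Lp_def)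
    also have "\<dots> < e" using N[OF that] \<open>\<tau> * measure M \<Omega> \<le> e / 2\<close> by simp
    finally show ?thesis by simp
  qed
  then show "\<exists>N. \<forall>n\<ge>N. norm ((LINT x|M. norm (f n x)) - 0) < e" by blast
qed

text \<open>Passes from the completed measure on \<Omega> to the Borel measure on the whole space,
  where translation invariance and Tonelli are at hand. It is applied to a test function, to its
  gradient and to the p-th powers of their norms, hence the formulation for continuous functions
  with compact support.\<close>

lemma test_function_lborel:
  fixes f :: "'a \<Rightarrow> 'b::euclidean_space"
  assumes "continuous_on UNIV f" "compact C" "C \<subseteq> \<Omega>" "\<And>x. x \<notin> C \<Longrightarrow> f x = 0"
  shows "integrable lborel f" "(LINT x|M. f x) = (LINT x|lborel. f x)"
proof -
  have m: "f \<in> borel_measurable lborel"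
    using assms(1) by (simp add: borel_measurable_continuous_onI)
  obtain B where B: "\<And>x. norm (f x) \<le> B"
    using compact_support_bounded[OF assms(1,2,4)] by metis
  have i: "(\<lambda>x. indicator C x *\<^sub>R f x) = f"
    using assms(4) by (auto simp: indicator_def)
  have "integrable lborel (\<lambda>x. indicator C x *\<^sub>R B)"
    using assms(2) by (intro integrable_scaleR_left integrable_real_indicator)
      (use emeasure_compact_finite[OF assms(2)] in \<open>auto simp: borel_compact\<close>)
  then show "integrable lborel f"
    by (rule Bochner_Integration.integrable_bound[OF _ m]) (use assms(4) in \<open>auto simp: indicator_def intro!: AE_I2 order_trans[OF B abs_ge_self]\<close>)
  have "(\<lambda>x. indicator \<Omega> x *\<^sub>R f x) = f"
    using assms(3,4) by (fastforce simp: indicator_def)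
  then show "(LINT x|M. f x) = (LINT x|lborel. f x)"
    using m \<Omega>_sets by (simp add: integral_restrict_space integral_completion)
qed

text \<open>By translation invariance every difference quotient of \<open>f\<close> has integral 0,
  and the quotients converge to the directional derivative under an integrable bound.\<close>

lemma integral_gradient_test:
  assumes "test_function \<Omega> f"
  shows "(LINT x|M. gradient f x) = 0"
proof -
  obtain C where C: "compact C" "C \<subseteq> \<Omega>" "\<And>x. x \<notin> C \<Longrightarrow> f x = 0" "\<And>x. x \<notin> C \<Longrightarrow> gradient f x = 0"
    using test_functionE[OF assms] by blast
  note sm = test_function_smooth[OF assms]
  obtain L where L: "0 < L" "\<And>x. norm (gradient f x) \<le> L"
    using test_function_bounded[OF assms] by metis
  obtain R where R: "0 < R" "\<And>x. x \<in> C \<Longrightarrow> norm x \<le> R"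
    using compact_imp_bounded[OF C(1)] by (auto simp: bounded_pos)
  note cont = smooth_on_continuous[OF sm] and cont' = continuous_on_gradient[OF sm]
  note ig = test_function_lborel[OF cont' C(1,2,4)] and if' = test_function_lborel[OF cont C(1,2,3)]
  have m: "f \<in> borel_measurable borel" "gradient f \<in> borel_measurable borel"
    using cont cont' by (auto intro: borel_measurable_continuous_onI)
  have "(LINT x|lborel. gradient f x) \<bullet> b = 0" if b: "b \<in> Basis" for b
  proof -
    \<comment> \<open>Steps of length at most 1 keep all quotients supported in the ball of radius
      \<open>R + 1\<close>, where the Lipschitz constant \<open>L\<close> bounds them.\<close>
    define g where "g n x = real (Suc n) * (f (b /\<^sub>R real (Suc n) + x) - f x)" for n x
    have tr: "integrable lborel (\<lambda>x. f (a + x))" "(LINT x|lborel. f (a + x)) = (LINT x|lborel. f x)" for a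
    proof -
      have "integrable (distr lborel borel ((+) a)) f" using if'(1) by (simp add: lborel_distr_plus)
      then show "integrable lborel (\<lambda>x. f (a + x))" by (subst (asm) integrable_distr_eq) (use m in auto)
      have "(LINT x|distr lborel borel ((+) a). f x) = (LINT x|lborel. f (a + x))"
        by (rule integral_distr) (use m in auto)
      then show "(LINT x|lborel. f (a + x)) = (LINT x|lborel. f x)" by (simp add: lborel_distr_plus)
    qed
    have "(\<lambda>n. LINT x|lborel. g n x) \<longlonglongrightarrow> (LINT x|lborel. gradient f x \<bullet> b)"
    proof (rule integral_dominated_convergence)
      show "(\<lambda>x. gradient f x \<bullet> b) \<in> borel_measurable lborel" using m by simp
      show "g n \<in> borel_measurable lborel" for n unfolding g_def[abs_def] using m by measurable
      show "integrable lborel (\<lambda>x::'a. indicator (cball 0 (R + 1)) x * L)"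
        by (intro integrable_mult_left integrable_real_indicator)
          (use emeasure_lborel_cball_finite[of "0::'a" "R + 1"] in auto)
      show "AE x in lborel. (\<lambda>n. g n x) \<longlonglongrightarrow> gradient f x \<bullet> b"
      proof (rule AE_I2)
        fix x
        have "((\<lambda>t. f (x + t *\<^sub>R b)) has_derivative (\<lambda>t. gradient f (x + 0 *\<^sub>R b) \<bullet> (t *\<^sub>R b))) (at 0)"
          by (rule has_derivative_compose[OF _ has_derivative_gradient[OF sm], of "\<lambda>t. x + t *\<^sub>R b"])
            (auto intro!: derivative_eq_intros)
        then have "((\<lambda>t. f (x + t *\<^sub>R b)) has_real_derivative (gradient f x \<bullet> b)) (at 0)"
          by (simp add: has_field_derivative_def mult_commute_abs)
        then have "(\<lambda>h. (f (x + h *\<^sub>R b) - f x) / h) \<midarrow>0\<rightarrow> gradient f x \<bullet> b"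
          by (simp add: DERIV_def)
        moreover have "filterlim (\<lambda>n. 1 / real (Suc n)) (at 0) sequentially"
          by (intro filterlim_atI LIMSEQ_Suc[OF lim_1_over_n]) auto
        ultimately have "(\<lambda>n. (f (x + (1 / real (Suc n)) *\<^sub>R b) - f x) / (1 / real (Suc n))) \<longlonglongrightarrow> gradient f x \<bullet> b"
          by (rule filterlim_compose)
        then show "(\<lambda>n. g n x) \<longlonglongrightarrow> gradient f x \<bullet> b"
          by (simp add: g_def add.commute mult.commute inverse_eq_divide)
      qed
      show "AE x in lborel. norm (g n x) \<le> indicator (cball 0 (R + 1)) x * L" for n
      proof (rule AE_I2)
        fix x
        have lip: "norm (f y - f x) \<le> L * norm (y - x)" for y
          by (rule differentiable_bound[OF convex_UNIV has_derivative_at_withinI[OF has_derivative_gradient[OF sm]]])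
            (use L(2) in \<open>auto simp: onorm_inner_left intro!: onorm_le order_trans[OF Cauchy_Schwarz_ineq2] mult_right_mono\<close>)
        have nb: "norm (b /\<^sub>R real (Suc n)) = 1 / real (Suc n)" using b by (simp add: inverse_eq_divide)
        show "norm (g n x) \<le> indicator (cball 0 (R + 1)) x * L"
        proof (cases "norm x \<le> R + 1")
          case True
          have "norm (g n x) \<le> real (Suc n) * (L * norm (b /\<^sub>R real (Suc n)))"
            unfolding g_def using lip[of "b /\<^sub>R real (Suc n) + x"]
            by (simp add: abs_mult mult_left_mono del: of_nat_Suc)
          also have "\<dots> = L" unfolding nb by simp
          finally show ?thesis using True by simp
        next
          case False
          have "norm (b /\<^sub>R real (Suc n)) \<le> 1" unfolding nb by simp
          then have "R < norm (b /\<^sub>R real (Suc n) + x)"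
            using False norm_triangle_ineq4[of "b /\<^sub>R real (Suc n) + x" "b /\<^sub>R real (Suc n)"]
            by simp
          then have "f (b /\<^sub>R real (Suc n) + x) = 0" "f x = 0"
            using R C(3) False by (force, force)
          then show ?thesis using False L(1) by (simp add: g_def)
        qed
      qed
    qed
    moreover have "(LINT x|lborel. g n x) = 0" for n
      unfolding g_def using tr if'(1) by simp
    ultimately have "(LINT x|lborel. gradient f x \<bullet> b) = 0"
      by (simp add: LIMSEQ_const_iff)
    then show ?thesis using ig(1) by simp
  qed
  then have "(LINT x|lborel. gradient f x) = 0" by (metis euclidean_eqI inner_zero_left)
  then show ?thesis using ig(2) by simp
qed

text \<open>The product of the two functions is a test function, so its gradient integrates to
  0.\<close>

lemma test_function_parts:
  assumes "test_function \<Omega> f" "test_function \<Omega> g"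
  shows "(LINT x|M. f x *\<^sub>R gradient g x) = - (LINT x|M. g x *\<^sub>R gradient f x)"
proof -
  note sm = assms[THEN test_function_smooth]
  have i: "integrable M (\<lambda>x. f x *\<^sub>R gradient g x)"
    if fg: "test_function \<Omega> f" "test_function \<Omega> g" for f g
  proof -
    note sm = fg[THEN test_function_smooth]
    obtain B where "\<And>x. \<bar>f x\<bar> \<le> B" using test_function_bounded[OF fg(1)] by metis
    moreover obtain B' where "\<And>x. norm (gradient g x) \<le> B'" using test_function_bounded[OF fg(2)] by metis
    ultimately have "norm (f x *\<^sub>R gradient g x) \<le> B * B'" for x
      by (simp add: mult_mono')
    moreover have "(\<lambda>x. f x *\<^sub>R gradient g x) \<in> borel_measurable M"
      by (intro cont_meas continuous_intros smooth_on_continuous[OF sm(1)] continuous_on_gradient[OF sm(2)])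
    ultimately show ?thesis by (intro integrable_const_bound[where B = "B * B'"]) auto
  qed
  have "0 = (LINT x|M. gradient (\<lambda>x. f x * g x) x)"
    using integral_gradient_test[OF test_function_mult[OF assms(2) sm(1)]] by simp
  also have "\<dots> = (LINT x|M. f x *\<^sub>R gradient g x + g x *\<^sub>R gradient f x)"
    by (simp add: gradient_mult[OF sm])
  also have "\<dots> = (LINT x|M. f x *\<^sub>R gradient g x) + (LINT x|M. g x *\<^sub>R gradient f x)"
    using assms by (intro Bochner_Integration.integral_add i)
  finally show ?thesis by (simp add: eq_neg_iff_add_eq_0)
qed

section \<open>Sobolev functions with zero boundary values\<close>

text \<open>\<open>W1p0\<close> is defined with norms, while the estimates below are made with
  integrals of p-th powers; this moves smallness between the two.\<close>

lemma Lp_norm_less_iff: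
  fixes f :: "'a \<Rightarrow> 'b::euclidean_space"
  assumes "0 < e"
  shows "Lp_norm \<Omega> p f < e powr (1 / p) \<longleftrightarrow> (LINT x|M. norm (f x) powr p) < e"
proof -
  have I: "0 \<le> (LINT x|M. norm (f x) powr p)" by (rule Bochner_Integration.integral_nonneg) simp
  show ?thesis
    unfolding Lp_norm_def
    using powr_less_mono2[OF _ I, of "1 / p" e] powr_mono2[of "1 / p" e] assms p_gt_1
    by (smt (verit) divide_pos_pos)
qed

lemma W1p0_in_Lp:
  assumes "W1p0 \<Omega> p u Du"
  shows "in_Lp \<Omega> p u" "in_Lp \<Omega> p Du"
  using assms by (auto simp: W1p0_def W1p_def)

lemma W1p0_approx:
  assumes "W1p0 \<Omega> p u Du" "0 < e"
  obtains \<phi> where "test_function \<Omega> \<phi>"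
    and "(LINT x|M. norm (u x - \<phi> x) powr p) < e"
    and "(LINT x|M. norm (Du x - gradient \<phi> x) powr p) < e"
proof -
  have "0 < e powr (1 / p)" using assms by simp
  then obtain \<phi> where \<phi>: "test_function \<Omega> \<phi>"
    and l: "Lp_norm \<Omega> p (\<lambda>x. u x - \<phi> x) + Lp_norm \<Omega> p (\<lambda>x. Du x - gradient \<phi> x) < e powr (1 / p)"
    using assms(1) unfolding W1p0_def by blast
  have "0 \<le> Lp_norm \<Omega> p (\<lambda>x. u x - \<phi> x)" "0 \<le> Lp_norm \<Omega> p (\<lambda>x. Du x - gradient \<phi> x)"
    by (simp_all add: Lp_norm_def)
  with l have "Lp_norm \<Omega> p (\<lambda>x. u x - \<phi> x) < e powr (1 / p)"
    "Lp_norm \<Omega> p (\<lambda>x. Du x - gradient \<phi> x) < e powr (1 / p)" by linarith+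
  with \<phi> that show ?thesis by (simp add: Lp_norm_less_iff[OF assms(2)])
qed

lemma integral_Lp_nonneg: "0 \<le> (LINT x|M. norm (f x) powr p)"
  by (rule Bochner_Integration.integral_nonneg) simp

text \<open>Convergence in L^p implies convergence in L^1 and hence, along a subsequence, almost
  everywhere. The pointwise limit is what allows passing to the limit inside nonlinear functions of
  \<open>u\<close>.\<close>

lemma W1p0_approx_seq:
  assumes "W1p0 \<Omega> p u Du"
  obtains \<phi> where "\<And>n. test_function \<Omega> (\<phi> n)"
    and "(\<lambda>n. LINT x|M. norm (u x - \<phi> n x) powr p) \<longlonglongrightarrow> 0"
    and "(\<lambda>n. LINT x|M. norm (Du x - gradient (\<phi> n) x) powr p) \<longlonglongrightarrow> 0"
    and "AE x in M. (\<lambda>n. \<phi> n x) \<longlonglongrightarrow> u x"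
proof -
  have "\<exists>\<phi>. test_function \<Omega> \<phi> \<and> (LINT x|M. norm (u x - \<phi> x) powr p) < 1 / real (Suc n) \<and>
    (LINT x|M. norm (Du x - gradient \<phi> x) powr p) < 1 / real (Suc n)" for n
    by (rule W1p0_approx[OF assms, of "1 / real (Suc n)"]) (simp, blast)
  from choice[OF allI[OF this]] obtain \<psi> where *: "\<forall>n. test_function \<Omega> (\<psi> n) \<and> (LINT x|M. norm (u x - \<psi> n x) powr p) < 1 / real (Suc n) \<and>
    (LINT x|M. norm (Du x - gradient (\<psi> n) x) powr p) < 1 / real (Suc n)"
    ..
  then have \<psi>: "\<And>n. test_function \<Omega> (\<psi> n)"
    "\<And>n. (LINT x|M. norm (u x - \<psi> n x) powr p) < 1 / real (Suc n)"
    "\<And>n. (LINT x|M. norm (Du x - gradient (\<psi> n) x) powr p) < 1 / real (Suc n)"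
    by blast+
  note u = W1p0_in_Lp[OF assms]
  have lim: "(\<lambda>n. 1 / real (Suc n)) \<longlonglongrightarrow> 0" by (rule LIMSEQ_Suc[OF lim_1_over_n])
  have 1: "(\<lambda>n. LINT x|M. norm (u x - \<psi> n x) powr p) \<longlonglongrightarrow> 0"
    by (rule LIMSEQ_0_upper[OF integral_Lp_nonneg less_imp_le[OF \<psi>(2)] lim])
  have 2: "(\<lambda>n. LINT x|M. norm (Du x - gradient (\<psi> n) x) powr p) \<longlonglongrightarrow> 0"
    by (rule LIMSEQ_0_upper[OF integral_Lp_nonneg less_imp_le[OF \<psi>(3)] lim])
  have d: "in_Lp \<Omega> p (\<lambda>x. u x - \<psi> n x)" for n
    using u in_Lp_test \<psi>(1) by (blast intro: in_Lp_diff)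
  obtain r :: "nat \<Rightarrow> nat" where r: "strict_mono r" "AE x in M. (\<lambda>n. u x - \<psi> (r n) x) \<longlonglongrightarrow> 0"
    using tendsto_L1_AE_subseq[OF in_Lp_imp_integrable[OF d] Lp_tendsto_imp_L1[OF d 1]] by blast
  show ?thesis
  proof (rule that[of "\<lambda>n. \<psi> (r n)"])
    show "AE x in M. (\<lambda>n. \<psi> (r n) x) \<longlonglongrightarrow> u x"
      using r(2)
    proof eventually_elim
      case (elim x)
      from tendsto_diff[OF tendsto_const[of "u x"] this] show ?case by simp
    qed
  qed (use \<psi>(1) LIMSEQ_subseq_LIMSEQ[OF 1 r(1)] LIMSEQ_subseq_LIMSEQ[OF 2 r(1)] in \<open>auto simp: o_def\<close>)
qed

lemma in_Lp_locally_integrable: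
  fixes f :: "'a \<Rightarrow> 'b::euclidean_space"
  assumes "in_Lp \<Omega> p f"
  shows "locally_integrable \<Omega> f"
  unfolding locally_integrable_def
proof (intro allI impI)
  fix C assume C: "compact C \<and> C \<subseteq> \<Omega>"
  then have Cs: "C \<in> sets lebesgue" by (simp add: borel_compact)
  have "integrable lebesgue (\<lambda>x. indicator \<Omega> x *\<^sub>R f x)"
    using in_Lp_imp_integrable[OF assms] \<Omega>_sets by (simp add: integrable_restrict_space)
  from integrable_mult_indicator[OF Cs this] have "integrable lebesgue (\<lambda>x. indicator C x *\<^sub>R (indicator \<Omega> x *\<^sub>R f x))" .
  also have "(\<lambda>x. indicator C x *\<^sub>R (indicator \<Omega> x *\<^sub>R f x)) = (\<lambda>x. indicator C x *\<^sub>R f x)"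
    using C by (auto simp: fun_eq_iff split: split_indicator)
  finally show "integrable (lebesgue_on C) f" using Cs by (simp add: integrable_restrict_space)
qed

text \<open>Integration by parts holds exactly for the approximating test functions, and against a
  fixed \<eta> both sides are continuous under L^1 convergence because \<eta> and its gradient are
  bounded.\<close>

lemma has_weak_gradient_limit:
  assumes u: "in_Lp \<Omega> p u" "in_Lp \<Omega> p Du"
    and \<phi>: "\<And>n. test_function \<Omega> (\<phi> n)"
    and l1: "(\<lambda>n. LINT x|M. norm (u x - \<phi> n x) powr p) \<longlonglongrightarrow> 0"
    and l2: "(\<lambda>n. LINT x|M. norm (Du x - gradient (\<phi> n) x) powr p) \<longlonglongrightarrow> 0"
  shows "has_weak_gradient \<Omega> u Du"
  unfolding has_weak_gradient_def
proof (intro conjI allI impI)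
  fix \<eta> :: "'a \<Rightarrow> real" assume \<eta>: "test_function \<Omega> \<eta>"
  obtain B where B: "0 < B" "\<And>x. \<bar>\<eta> x\<bar> \<le> B" "\<And>x. norm (gradient \<eta> x) \<le> B"
    using test_function_bounded[OF \<eta>] by metis
  have \<eta>m: "\<eta> \<in> borel_measurable M" "gradient \<eta> \<in> borel_measurable M"
    using in_Lp_test[OF \<eta>] by (simp_all add: in_Lp_def)
  have iw: "integrable M (\<lambda>x. w x *\<^sub>R gradient \<eta> x)" "norm (LINT x|M. w x *\<^sub>R gradient \<eta> x) \<le> B * (LINT x|M. norm (w x))"
    if w: "in_Lp \<Omega> p w" for w :: "'a \<Rightarrow> real"
  proof -
    note i = in_Lp_imp_integrable[OF w]
    have b: "norm (w x *\<^sub>R gradient \<eta> x) \<le> B * norm (w x)" for x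
      using mult_left_mono[OF B(3)[of x], of "\<bar>w x\<bar>"] by (simp add: mult.commute)
    show j: "integrable M (\<lambda>x. w x *\<^sub>R gradient \<eta> x)"
      by (rule Bochner_Integration.integrable_bound[of _ "\<lambda>x. B * norm (w x)"])
        (use i \<eta>m b in \<open>auto simp del: norm_scaleR intro!: AE_I2 order_trans[OF b]\<close>)
    have "norm (LINT x|M. w x *\<^sub>R gradient \<eta> x) \<le> (LINT x|M. B * norm (w x))"
      by (rule order_trans[OF integral_norm_bound])
        (intro integral_mono integrable_norm j integrable_mult_right i b)
    then show "norm (LINT x|M. w x *\<^sub>R gradient \<eta> x) \<le> B * (LINT x|M. norm (w x))" by simp
  qed
  have iW: "integrable M (\<lambda>x. \<eta> x *\<^sub>R W x)" "norm (LINT x|M. \<eta> x *\<^sub>R W x) \<le> B * (LINT x|M. norm (W x))"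
    if W: "in_Lp \<Omega> p W" for W :: "'a \<Rightarrow> 'a"
  proof -
    note i = in_Lp_imp_integrable[OF W]
    have b: "norm (\<eta> x *\<^sub>R W x) \<le> B * norm (W x)" for x
      using B(2)[of x] by (simp add: mult_right_mono)
    show j: "integrable M (\<lambda>x. \<eta> x *\<^sub>R W x)"
      by (rule Bochner_Integration.integrable_bound[of _ "\<lambda>x. B * norm (W x)"])
        (use i \<eta>m b in \<open>auto simp del: norm_scaleR intro!: AE_I2 order_trans[OF b]\<close>)
    have "norm (LINT x|M. \<eta> x *\<^sub>R W x) \<le> (LINT x|M. B * norm (W x))"
      by (rule order_trans[OF integral_norm_bound])
        (intro integral_mono integrable_norm j integrable_mult_right i b)
    then show "norm (LINT x|M. \<eta> x *\<^sub>R W x) \<le> B * (LINT x|M. norm (W x))" by simp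
  qed
  \<comment> \<open>The defect in the identity. The same expression vanishes for each
    \<open>\<phi> n\<close>, so it is bounded by the L^1 errors times \<open>B\<close>.\<close>
  let ?S = "(LINT x|M. u x *\<^sub>R gradient \<eta> x) + (LINT x|M. \<eta> x *\<^sub>R Du x)"
  have d: "in_Lp \<Omega> p (\<lambda>x. u x - \<phi> n x)" "in_Lp \<Omega> p (\<lambda>x. Du x - gradient (\<phi> n) x)" for n
    using u in_Lp_test[OF \<phi>[of n]] by (auto intro: in_Lp_diff)
  have "norm ?S \<le> B * (LINT x|M. norm (u x - \<phi> n x)) + B * (LINT x|M. norm (Du x - gradient (\<phi> n) x))" for n
  proof -
    have "?S = (LINT x|M. u x *\<^sub>R gradient \<eta> x) - (LINT x|M. \<phi> n x *\<^sub>R gradient \<eta> x)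
        + ((LINT x|M. \<eta> x *\<^sub>R Du x) - (LINT x|M. \<eta> x *\<^sub>R gradient (\<phi> n) x))"
      using test_function_parts[OF \<phi>[of n] \<eta>] by simp
    also have "\<dots> = (LINT x|M. (u x - \<phi> n x) *\<^sub>R gradient \<eta> x) + (LINT x|M. \<eta> x *\<^sub>R (Du x - gradient (\<phi> n) x))"
      using iw(1)[OF u(1)] iw(1)[OF in_Lp_test(1)[OF \<phi>]] iW(1)[OF u(2)] iW(1)[OF in_Lp_test(2)[OF \<phi>]]
      by (simp add: scaleR_diff_left scaleR_diff_right)
    also have "norm \<dots> \<le> B * (LINT x|M. norm (u x - \<phi> n x)) + B * (LINT x|M. norm (Du x - gradient (\<phi> n) x))"
      by (intro norm_triangle_mono iw(2) iW(2) d)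
    finally show ?thesis .
  qed
  moreover have "(\<lambda>n. B * (LINT x|M. norm (u x - \<phi> n x)) + B * (LINT x|M. norm (Du x - gradient (\<phi> n) x))) \<longlonglongrightarrow> B * 0 + B * 0"
    by (intro tendsto_intros Lp_tendsto_imp_L1 d l1 l2)
  ultimately have "norm ?S \<le> B * 0 + B * 0"
    by (intro LIMSEQ_le_const) auto
  then show "(LINT x|M. u x *\<^sub>R gradient \<eta> x) = - (LINT x|M. \<eta> x *\<^sub>R Du x)"
    by (simp add: eq_neg_iff_add_eq_0)
qed (use u in_Lp_locally_integrable in auto)

text \<open>The weak gradient is inherited in the limit, so later constructions only have to show
  integrability and exhibit approximating test functions.\<close>

lemma W1p0I_test_limit:
  assumes u: "in_Lp \<Omega> p u" "in_Lp \<Omega> p Du"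
    and \<phi>: "\<And>n. test_function \<Omega> (\<phi> n)"
    and l1: "(\<lambda>n. LINT x|M. norm (u x - \<phi> n x) powr p) \<longlonglongrightarrow> 0"
    and l2: "(\<lambda>n. LINT x|M. norm (Du x - gradient (\<phi> n) x) powr p) \<longlonglongrightarrow> 0"
  shows "W1p0 \<Omega> p u Du"
  unfolding W1p0_def W1p_def
proof (intro conjI allI impI u has_weak_gradient_limit[OF assms])
  fix e :: real assume "0 < e"
  define d where "d = (e / 2) powr p"
  have d: "0 < d" "d powr (1 / p) = e / 2"
    using \<open>0 < e\<close> p_gt_1 by (simp_all add: d_def powr_powr)
  have "\<forall>\<^sub>F n in sequentially. (LINT x|M. norm (u x - \<phi> n x) powr p) < d \<and>
      (LINT x|M. norm (Du x - gradient (\<phi> n) x) powr p) < d"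
    using order_tendstoD(2)[OF l1 d(1)] order_tendstoD(2)[OF l2 d(1)] by eventually_elim simp
  then obtain n where "(LINT x|M. norm (u x - \<phi> n x) powr p) < d"
      "(LINT x|M. norm (Du x - gradient (\<phi> n) x) powr p) < d"
    by (auto dest: eventually_happens)
  then have "Lp_norm \<Omega> p (\<lambda>x. u x - \<phi> n x) < e / 2" "Lp_norm \<Omega> p (\<lambda>x. Du x - gradient (\<phi> n) x) < e / 2"
    using d(2) Lp_norm_less_iff[OF d(1), of "\<lambda>x. u x - \<phi> n x"]
      Lp_norm_less_iff[OF d(1), of "\<lambda>x. Du x - gradient (\<phi> n) x"] by simp_all
  then show "\<exists>\<phi>. test_function \<Omega> \<phi> \<and>
      Lp_norm \<Omega> p (\<lambda>x. u x - \<phi> x) + Lp_norm \<Omega> p (\<lambda>x. Du x - gradient \<phi> x) < e"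
    using \<phi>[of n] by (intro exI[of _ "\<phi> n"]) simp
qed

lemma Lp_diff_triangle:
  fixes f g h :: "'a \<Rightarrow> 'b::euclidean_space"
  assumes "in_Lp \<Omega> p f" "in_Lp \<Omega> p g" "in_Lp \<Omega> p h"
  shows "(LINT x|M. norm (f x - h x) powr p) \<le>
    2 powr p * ((LINT x|M. norm (f x - g x) powr p) + (LINT x|M. norm (g x - h x) powr p))"
proof -
  note d = in_Lp_integrable[OF in_Lp_diff[OF assms(1,2)]] in_Lp_integrable[OF in_Lp_diff[OF assms(2,3)]]
  have "(LINT x|M. norm (f x - h x) powr p) \<le>
      (LINT x|M. 2 powr p * (norm (f x - g x) powr p + norm (g x - h x) powr p))"
    using norm_add_powr_le[of p "f x - g x" "g x - h x" for x] p_gt_1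
    by (intro integral_mono in_Lp_integrable[OF in_Lp_diff[OF assms(1,3)]]
        integrable_mult_right Bochner_Integration.integrable_add d) simp
  then show ?thesis using d by simp
qed

text \<open>A diagonal choice: \<open>w n\<close> is replaced by a test function whose errors are
  below 1/(n+1).\<close>

lemma W1p0_limit:
  assumes u: "in_Lp \<Omega> p u" "in_Lp \<Omega> p Du"
    and w: "\<And>n. W1p0 \<Omega> p (w n) (Dw n)"
    and l1: "(\<lambda>n. LINT x|M. norm (u x - w n x) powr p) \<longlonglongrightarrow> 0"
    and l2: "(\<lambda>n. LINT x|M. norm (Du x - Dw n x) powr p) \<longlonglongrightarrow> 0"
  shows "W1p0 \<Omega> p u Du"
proof -
  have lim: "(\<lambda>n. 1 / real (Suc n)) \<longlonglongrightarrow> 0" by (rule LIMSEQ_Suc[OF lim_1_over_n])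
  have "\<exists>\<phi>. test_function \<Omega> \<phi> \<and> (LINT x|M. norm (w n x - \<phi> x) powr p) < 1 / real (Suc n) \<and>
    (LINT x|M. norm (Dw n x - gradient \<phi> x) powr p) < 1 / real (Suc n)" for n
    by (rule W1p0_approx[OF w, of "1 / real (Suc n)"]) (simp, blast)
  from choice[OF allI[OF this]] obtain \<phi> where *: "\<forall>n. test_function \<Omega> (\<phi> n) \<and> (LINT x|M. norm (w n x - \<phi> n x) powr p) < 1 / real (Suc n) \<and>
    (LINT x|M. norm (Dw n x - gradient (\<phi> n) x) powr p) < 1 / real (Suc n)"
    ..
  then have \<phi>: "\<And>n. test_function \<Omega> (\<phi> n)"
    "\<And>n. (LINT x|M. norm (w n x - \<phi> n x) powr p) < 1 / real (Suc n)"
    "\<And>n. (LINT x|M. norm (Dw n x - gradient (\<phi> n) x) powr p) < 1 / real (Suc n)"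
    by blast+
  note Lp = u W1p0_in_Lp[OF w] in_Lp_test[OF \<phi>(1)]
  show ?thesis
  proof (rule W1p0I_test_limit[OF u \<phi>(1)])
    have "(\<lambda>n. 2 powr p * ((LINT x|M. norm (u x - w n x) powr p) + 1 / real (Suc n))) \<longlonglongrightarrow> 2 powr p * (0 + 0)"
      by (intro tendsto_intros l1 lim)
    then show "(\<lambda>n. LINT x|M. norm (u x - \<phi> n x) powr p) \<longlonglongrightarrow> 0"
      by (intro LIMSEQ_0_upper[OF integral_Lp_nonneg order_trans[OF Lp_diff_triangle[OF Lp(1,3,5)]
            mult_left_mono[OF add_left_mono[OF less_imp_le[OF \<phi>(2)]]]]]) simp_all
    have "(\<lambda>n. 2 powr p * ((LINT x|M. norm (Du x - Dw n x) powr p) + 1 / real (Suc n))) \<longlonglongrightarrow> 2 powr p * (0 + 0)"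
      by (intro tendsto_intros l2 lim)
    then show "(\<lambda>n. LINT x|M. norm (Du x - gradient (\<phi> n) x) powr p) \<longlonglongrightarrow> 0"
      by (intro LIMSEQ_0_upper[OF integral_Lp_nonneg order_trans[OF Lp_diff_triangle[OF Lp(2,4,6)]
            mult_left_mono[OF add_left_mono[OF less_imp_le[OF \<phi>(3)]]]]]) simp_all
  qed
qed

text \<open>Membership belongs to the notion because the integral of a non-integrable function is 0
  by convention, so convergence of the integrals alone would carry no information.\<close>

definition Lp_null :: "(nat \<Rightarrow> 'a \<Rightarrow> 'b::euclidean_space) \<Rightarrow> bool" where
  "Lp_null f \<longleftrightarrow> (\<forall>n. in_Lp \<Omega> p (f n)) \<and> (\<lambda>n. LINT x|M. norm (f n x) powr p) \<longlonglongrightarrow> 0"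

lemma Lp_null_bound:
  fixes f :: "nat \<Rightarrow> 'a \<Rightarrow> 'b::euclidean_space" and g :: "nat \<Rightarrow> 'a \<Rightarrow> 'c::euclidean_space"
  assumes "Lp_null f" "\<And>n. g n \<in> borel_measurable M" "0 \<le> C"
    and b: "\<And>n x. norm (g n x) \<le> C * norm (f n x)"
  shows "Lp_null g"
proof -
  have f: "in_Lp \<Omega> p (f n)" for n using assms(1) by (simp add: Lp_null_def)
  have g: "in_Lp \<Omega> p (g n)" for n
    by (rule in_Lp_bound_by[OF f[of n] assms(2,3)]) (simp add: b)
  have "(\<lambda>n. C powr p * (LINT x|M. norm (f n x) powr p)) \<longlonglongrightarrow> 0"
    using assms(1) unfolding Lp_null_def by (intro tendsto_mult_right_zero) simp
  moreover have "(LINT x|M. norm (g n x) powr p) \<le> C powr p * (LINT x|M. norm (f n x) powr p)" for n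
  proof -
    have "norm (g n x) powr p \<le> C powr p * norm (f n x) powr p" for x
      using powr_mono2[of p, OF _ norm_ge_zero b[of n x]] p_gt_1 assms(3) by (simp add: powr_mult)
    then have "(LINT x|M. norm (g n x) powr p) \<le> (LINT x|M. C powr p * norm (f n x) powr p)"
      by (intro integral_mono integrable_mult_right in_Lp_integrable f g)
    then show ?thesis by simp
  qed
  ultimately have "(\<lambda>n. LINT x|M. norm (g n x) powr p) \<longlonglongrightarrow> 0"
    by (intro LIMSEQ_0_upper[OF integral_Lp_nonneg])
  then show ?thesis
    unfolding Lp_null_def using g by simp
qed

lemma Lp_null_add:
  fixes f g :: "nat \<Rightarrow> 'a \<Rightarrow> 'b::euclidean_space"
  assumes "Lp_null f" "Lp_null g"
  shows "Lp_null (\<lambda>n x. f n x + g n x)"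
proof -
  have Lp: "in_Lp \<Omega> p (f n)" "in_Lp \<Omega> p (g n)" for n using assms by (simp_all add: Lp_null_def)
  have "(\<lambda>n. 2 powr p * ((LINT x|M. norm (f n x) powr p) + (LINT x|M. norm (g n x) powr p))) \<longlonglongrightarrow> 2 powr p * (0 + 0)"
    using assms unfolding Lp_null_def by (intro tendsto_intros) auto
  then have lim: "(\<lambda>n. 2 powr p * ((LINT x|M. norm (f n x) powr p) + (LINT x|M. norm (g n x) powr p))) \<longlonglongrightarrow> 0"
    by simp
  have "(LINT x|M. norm (f n x + g n x) powr p)
      \<le> 2 powr p * ((LINT x|M. norm (f n x) powr p) + (LINT x|M. norm (g n x) powr p))" for n
    using Lp_diff_triangle[OF Lp(1) in_Lp_const[of 0] in_Lp_uminus[OF Lp(2)], of n n] by simp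
  from LIMSEQ_0_upper[OF integral_Lp_nonneg this lim] show ?thesis
    unfolding Lp_null_def using Lp by (blast intro: in_Lp_add)
qed

lemma Lp_null_dominated:
  fixes g :: "nat \<Rightarrow> 'a \<Rightarrow> 'b::euclidean_space" and h :: "'a \<Rightarrow> 'c::euclidean_space"
  assumes "in_Lp \<Omega> p h" "\<And>n. g n \<in> borel_measurable M"
    and b: "\<And>n x. norm (g n x) \<le> norm (h x)"
    and l: "AE x in M. (\<lambda>n. g n x) \<longlonglongrightarrow> 0"
  shows "Lp_null g"
  unfolding Lp_null_def
proof (intro conjI allI)
  show "in_Lp \<Omega> p (g n)" for n
    by (rule in_Lp_bound_by[OF assms(1,2), of 1]) (simp_all add: b)
  have "(\<lambda>n. LINT x|M. norm (g n x) powr p) \<longlonglongrightarrow> (LINT x|M. 0)"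
  proof (rule integral_dominated_convergence)
    show "integrable M (\<lambda>x. norm (h x) powr p)" using assms(1) by (rule in_Lp_integrable)
    show "AE x in M. (\<lambda>n. norm (g n x) powr p) \<longlonglongrightarrow> 0"
      using l
    proof eventually_elim
      case (elim x)
      then have "(\<lambda>n. norm (g n x) powr p) \<longlonglongrightarrow> 0 powr p"
        using p_gt_1 by (intro tendsto_powr2 tendsto_norm_zero) auto
      then show ?case using p_gt_1 by simp
    qed
    show "AE x in M. norm (norm (g n x) powr p) \<le> norm (h x) powr p" for n
      using b p_gt_1 by (auto intro!: AE_I2 powr_mono2)
  qed (use assms(2) in auto)
  then show "(\<lambda>n. LINT x|M. norm (g n x) powr p) \<longlonglongrightarrow> 0" by simp
qed

text \<open>Product and chain rule in one, obtained by applying the same operation to test functions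
  approximating \<open>u\<close>. The hypothesis \<open>T\<close> says that this stays among test
  functions: in the truncation \<psi> is 1 and F vanishes at 0, in the Picone argument \<psi> itself
  has compact support.\<close>

lemma W1p0_compose:
  assumes W: "W1p0 \<Omega> p u Du"
    and \<psi>: "smooth_on UNIV \<psi>" "\<And>x. \<bar>\<psi> x\<bar> \<le> B" "\<And>x. norm (gradient \<psi> x) \<le> B"
    and F: "\<And>t. (F has_real_derivative F' t) (at t)" "continuous_on UNIV F'" "\<And>t. \<bar>F' t\<bar> \<le> C"
    and T: "\<And>\<phi>. test_function \<Omega> \<phi> \<Longrightarrow> test_function \<Omega> (\<lambda>x. \<psi> x * F (\<phi> x))"
  shows "W1p0 \<Omega> p (\<lambda>x. \<psi> x * F (u x)) (\<lambda>x. F (u x) *\<^sub>R gradient \<psi> x + (\<psi> x * F' (u x)) *\<^sub>R Du x)"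
proof -
  have B: "0 \<le> B" using \<psi>(2)[of undefined] by linarith
  have C: "0 \<le> C" using F(3)[of 0] by linarith
  have lip: "\<bar>F s - F t\<bar> \<le> C * \<bar>s - t\<bar>" for s t
    using field_differentiable_bound[of UNIV F F' C s t] F by (auto intro: has_field_derivative_at_within)
  note u = W1p0_in_Lp[OF W]
  have Fc: "continuous_on UNIV F"
    using F(1) by (auto simp: continuous_on_eq_continuous_at intro: DERIV_isCont)
  have [measurable]: "u \<in> borel_measurable M" "Du \<in> borel_measurable M"
    using u by (simp_all add: in_Lp_def)
  have [measurable]: "\<psi> \<in> borel_measurable M" "gradient \<psi> \<in> borel_measurable M"
    using \<psi>(1) by (auto intro!: cont_meas smooth_on_continuous continuous_on_gradient)
  have [measurable]: "F \<in> borel_measurable borel" "F' \<in> borel_measurable borel"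
    using F(2) Fc by (auto intro: borel_measurable_continuous_onI)
  obtain \<phi> where \<phi>: "\<And>n. test_function \<Omega> (\<phi> n)"
    and l1: "(\<lambda>n. LINT x|M. norm (u x - \<phi> n x) powr p) \<longlonglongrightarrow> 0"
    and l2: "(\<lambda>n. LINT x|M. norm (Du x - gradient (\<phi> n) x) powr p) \<longlonglongrightarrow> 0"
    and ae: "AE x in M. (\<lambda>n. \<phi> n x) \<longlonglongrightarrow> u x"
    using W1p0_approx_seq[OF W] by blast
  have [measurable]: "\<phi> n \<in> borel_measurable M" "gradient (\<phi> n) \<in> borel_measurable M" for n
    using in_Lp_test[OF \<phi>[of n]] by (simp_all add: in_Lp_def)
  have n1: "Lp_null (\<lambda>n x. u x - \<phi> n x)" and n2: "Lp_null (\<lambda>n x. Du x - gradient (\<phi> n) x)"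
    using l1 l2 u in_Lp_test[OF \<phi>] by (auto simp: Lp_null_def intro: in_Lp_diff)
  have grad: "gradient (\<lambda>x. \<psi> x * F (\<phi> n x)) x
      = F (\<phi> n x) *\<^sub>R gradient \<psi> x + (\<psi> x * F' (\<phi> n x)) *\<^sub>R gradient (\<phi> n) x" for n x
  proof (rule gradient_eqI)
    have "((\<lambda>x. F (\<phi> n x)) has_derivative (\<lambda>h. F' (\<phi> n x) * (gradient (\<phi> n) x \<bullet> h))) (at x)"
      using has_derivative_compose[OF has_derivative_gradient[OF test_function_smooth[OF \<phi>]], of F "\<lambda>h. F' (\<phi> n x) * h"]
        F(1) by (simp add: has_field_derivative_def)
    from has_derivative_mult[OF has_derivative_gradient[OF \<psi>(1)] this]
    show "((\<lambda>x. \<psi> x * F (\<phi> n x)) has_derivative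
        (\<lambda>h. (F (\<phi> n x) *\<^sub>R gradient \<psi> x + (\<psi> x * F' (\<phi> n x)) *\<^sub>R gradient (\<phi> n) x) \<bullet> h)) (at x)"
      by (simp add: inner_add_left algebra_simps)
  qed
  have Fu: "in_Lp \<Omega> p (\<lambda>x. F (u x))"
  proof -
    have *: "in_Lp \<Omega> p (\<lambda>x. \<bar>F 0\<bar> + C * \<bar>u x\<bar>)"
      by (intro in_Lp_add in_Lp_const in_Lp_bound_by[OF u(1), of _ C]) (use C in auto)
    have "norm (F (u x)) \<le> 1 * norm (\<bar>F 0\<bar> + C * \<bar>u x\<bar>)" for x
      using lip[of "u x" 0] C by simp
    from in_Lp_bound_by[OF * _ zero_le_one AE_I2[OF this]] show ?thesis by measurable
  qed
  show ?thesis
  proof (rule W1p0I_test_limit[OF _ _ T[OF \<phi>]])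
    show "in_Lp \<Omega> p (\<lambda>x. \<psi> x * F (u x))"
      by (rule in_Lp_bound_by[OF Fu _ B]) (auto simp: abs_mult intro!: AE_I2 mult_right_mono \<psi>)
    show "in_Lp \<Omega> p (\<lambda>x. F (u x) *\<^sub>R gradient \<psi> x + (\<psi> x * F' (u x)) *\<^sub>R Du x)"
    proof (rule in_Lp_add)
      show "in_Lp \<Omega> p (\<lambda>x. F (u x) *\<^sub>R gradient \<psi> x)"
        by (rule in_Lp_bound_by[OF Fu _ B]) (auto simp: mult.commute[of B] intro!: AE_I2 mult_left_mono \<psi>)
      show "in_Lp \<Omega> p (\<lambda>x. (\<psi> x * F' (u x)) *\<^sub>R Du x)"
        by (rule in_Lp_bound_by[OF u(2), of _ "B * C"])
          (use B C in \<open>auto simp: abs_mult intro!: AE_I2 mult_right_mono mult_mono' \<psi> F(3)\<close>)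
    qed
    have "Lp_null (\<lambda>n x. \<psi> x * F (u x) - \<psi> x * F (\<phi> n x))"
    proof (rule Lp_null_bound[OF n1])
      show "norm (\<psi> x * F (u x) - \<psi> x * F (\<phi> n x)) \<le> (B * C) * norm (u x - \<phi> n x)" for n x
        using mult_mono'[OF \<psi>(2)[of x] lip[of "u x" "\<phi> n x"]] by (simp add: abs_mult mult.assoc flip: right_diff_distrib)
    qed (use B C in \<open>simp_all\<close>)
    then show "(\<lambda>n. LINT x|M. norm (\<psi> x * F (u x) - \<psi> x * F (\<phi> n x)) powr p) \<longlonglongrightarrow> 0"
      by (simp add: Lp_null_def)
    \<comment> \<open>The gradient error splits into three parts: the Lipschitz bound of
      \<open>F\<close> controls the first, the bound of \<open>F'\<close> the second. In the third
      \<open>F'\<close> is merely continuous, so there is no rate, but the almost everywhere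
      convergence and a multiple of |Du| as dominating function suffice.\<close>
    have "Lp_null (\<lambda>n x. (F (u x) - F (\<phi> n x)) *\<^sub>R gradient \<psi> x
        + ((\<psi> x * F' (\<phi> n x)) *\<^sub>R (Du x - gradient (\<phi> n) x)
        + (\<psi> x * (F' (u x) - F' (\<phi> n x))) *\<^sub>R Du x))"
    proof (intro Lp_null_add)
      show "Lp_null (\<lambda>n x. (F (u x) - F (\<phi> n x)) *\<^sub>R gradient \<psi> x)"
      proof (rule Lp_null_bound[OF n1])
        show "norm ((F (u x) - F (\<phi> n x)) *\<^sub>R gradient \<psi> x) \<le> (C * B) * norm (u x - \<phi> n x)" for n x
          using mult_mono'[OF lip[of "u x" "\<phi> n x"] \<psi>(3)[of x]] by (simp add: mult_ac)
      qed (use B C in \<open>simp_all\<close>)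
      show "Lp_null (\<lambda>n x. (\<psi> x * F' (\<phi> n x)) *\<^sub>R (Du x - gradient (\<phi> n) x))"
      proof (rule Lp_null_bound[OF n2])
        show "norm ((\<psi> x * F' (\<phi> n x)) *\<^sub>R (Du x - gradient (\<phi> n) x)) \<le> (B * C) * norm (Du x - gradient (\<phi> n) x)" for n x
          by (auto simp: abs_mult intro!: mult_right_mono mult_mono' \<psi> F(3))
      qed (use B C in \<open>simp_all\<close>)
      show "Lp_null (\<lambda>n x. (\<psi> x * (F' (u x) - F' (\<phi> n x))) *\<^sub>R Du x)"
      proof (rule Lp_null_dominated)
        show "in_Lp \<Omega> p (\<lambda>x. (B * (2 * C)) *\<^sub>R Du x)"
          by (rule in_Lp_bound_by[OF u(2), of _ "B * (2 * C)"]) (use B C in \<open>auto simp: abs_mult\<close>)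
        show "norm ((\<psi> x * (F' (u x) - F' (\<phi> n x))) *\<^sub>R Du x) \<le> norm ((B * (2 * C)) *\<^sub>R Du x)" for n x
        proof -
          have "\<bar>F' (u x) - F' (\<phi> n x)\<bar> \<le> 2 * C" using F(3)[of "u x"] F(3)[of "\<phi> n x"] by linarith
          with \<psi>(2)[of x] have "\<bar>\<psi> x\<bar> * \<bar>F' (u x) - F' (\<phi> n x)\<bar> \<le> B * (2 * C)"
            by (intro mult_mono') auto
          then show ?thesis using B C by (simp add: abs_mult mult_right_mono)
        qed
        show "AE x in M. (\<lambda>n. (\<psi> x * (F' (u x) - F' (\<phi> n x))) *\<^sub>R Du x) \<longlonglongrightarrow> 0"
          using ae
        proof eventually_elim
          case (elim x)
          have "(\<lambda>n. F' (\<phi> n x)) \<longlonglongrightarrow> F' (u x)"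
            using F(2) elim by (intro isCont_tendsto_compose[of _ F']) (auto simp: continuous_on_eq_continuous_at)
          then have "(\<lambda>n. (\<psi> x * (F' (u x) - F' (\<phi> n x))) *\<^sub>R Du x) \<longlonglongrightarrow> (\<psi> x * (F' (u x) - F' (u x))) *\<^sub>R Du x"
            by (intro tendsto_intros)
          then show ?case by simp
        qed
      qed measurable
    qed
    then have "(\<lambda>n. LINT x|M. norm ((F (u x) - F (\<phi> n x)) *\<^sub>R gradient \<psi> x
        + ((\<psi> x * F' (\<phi> n x)) *\<^sub>R (Du x - gradient (\<phi> n) x)
        + (\<psi> x * (F' (u x) - F' (\<phi> n x))) *\<^sub>R Du x)) powr p) \<longlonglongrightarrow> 0"
      by (simp add: Lp_null_def)
    then show "(\<lambda>n. LINT x|M. norm (F (u x) *\<^sub>R gradient \<psi> x + (\<psi> x * F' (u x)) *\<^sub>R Du x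
        - gradient (\<lambda>x. \<psi> x * F (\<phi> n x)) x) powr p) \<longlonglongrightarrow> 0"
      unfolding grad by (simp add: algebra_simps)
  qed
qed

text \<open>On the level set \<open>u = k\<close> the regularised truncations give the weight \<open>1/2\<close>; this spares
  the fact that \<open>Du\<close> vanishes there almost everywhere.\<close>

definition above :: "real \<Rightarrow> real \<Rightarrow> real" where
  "above k t = (1 + sgn (t - k)) / 2"

lemma above_bounds: "0 \<le> above k t" "above k t \<le> 1" "t < k \<Longrightarrow> above k t = 0"
  by (auto simp: above_def sgn_if)

text \<open>The corner at \<open>k\<close> is smoothed: the functions \<open>G n\<close> have
  derivatives in [0, 1] converging pointwise to \<open>above k\<close>, so the chain rule applies to
  each of them and the space is closed under the limit. For k >= 0 the truncation maps 0 to 0 and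
  thus respects zero boundary values.\<close>

lemma W1p0_truncate:
  assumes W: "W1p0 \<Omega> p u Du" and k: "0 \<le> k"
  shows "W1p0 \<Omega> p (\<lambda>x. max 0 (u x - k)) (\<lambda>x. above k (u x) *\<^sub>R Du x)"
proof -
  define s where "s n = 1 / real (Suc n)" for n
  define R where "R n t = smooth_abs (s n) (t + - k)" for n t
  \<comment> \<open>The subtracted constant makes \<open>G n 0 = 0\<close>, which keeps compact
    supports; it tends to 0 because k >= 0 gives k <= \<open>R n 0\<close> <= k +
    \<open>s n\<close>.\<close>
  define G where "G n t = 1/2 * ((t - k) + R n t) - 1/2 * (R n 0 - k)" for n t
  define G' where "G' n t = (1 + (t - k) / R n t) / 2" for n t
  have s: "0 < s n" "s n \<le> 1" for n by (simp_all add: s_def)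
  have R_pos: "0 < R n t" and R_ge: "\<bar>t - k\<bar> \<le> R n t" and R_le: "R n t \<le> \<bar>t - k\<bar> + s n" for n t
    using smooth_abs_bounds[OF s(1)[of n], of "t - k"] by (simp_all add: R_def)
  have dG: "(G n has_real_derivative G' n t) (at t)" for n t
  proof -
    have "(R n has_real_derivative ((t - k) / R n t)) (at t)"
      unfolding R_def using DERIV_smooth_abs[OF s(1), of n "- k" t] by simp
    then show ?thesis unfolding G_def[abs_def] G'_def
      by (auto intro!: derivative_eq_intros)
  qed
  have sgn1: "\<bar>(t - k) / R n t\<bar> \<le> 1" for n t
    using R_ge[of t n] R_pos[of n t] by simp
  have G'b: "0 \<le> G' n t" "G' n t \<le> 1" for n t
    using abs_le_D1[OF sgn1[of t n]] abs_le_D2[OF sgn1[of t n]] unfolding G'_def by simp_all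
  have G'c: "continuous_on UNIV (G' n)" for n
  proof -
    have "continuous_on UNIV (R n)" unfolding R_def by (intro continuous_intros)
    moreover have "R n t \<noteq> 0" for t using R_pos[of n t] by simp
    ultimately show ?thesis unfolding G'_def[abs_def] by (intro continuous_intros) auto
  qed
  have [measurable]: "G' n \<in> borel_measurable borel" for n by (rule borel_measurable_continuous_onI[OF G'c])
  have [measurable]: "G n \<in> borel_measurable borel" for n
    using dG by (intro borel_measurable_continuous_onI) (auto simp: continuous_on_eq_continuous_at intro: DERIV_isCont)
  note u = W1p0_in_Lp[OF W]
  have [measurable]: "u \<in> borel_measurable M" "Du \<in> borel_measurable M"
    using u by (simp_all add: in_Lp_def)
  have [measurable]: "above k \<in> borel_measurable borel" unfolding above_def[abs_def] sgn_if by measurable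
  have wn: "W1p0 \<Omega> p (\<lambda>x. G n (u x)) (\<lambda>x. G' n (u x) *\<^sub>R Du x)" for n
  proof -
    have g1: "gradient (\<lambda>_::'a. 1) x = 0" for x by (rule gradient_eqI) simp
    have "test_function \<Omega> (\<lambda>x. 1 * G n (\<phi> x))" if "test_function \<Omega> \<phi>" for \<phi>
    proof -
      note sm = test_function_smooth[OF that]
      have "G n 0 = 0" by (simp add: G_def)
      moreover have "smooth_on UNIV (\<lambda>x. G n (\<phi> x))"
        unfolding G_def R_def by (intro smooth_intros sm s)
      ultimately show ?thesis using test_function_compose[OF that] by simp
    qed
    moreover have "\<bar>G' n t\<bar> \<le> 1" for t using G'b[of n t] by simp
    ultimately show ?thesis
      using W1p0_compose[OF W smooth_on_const[of 1] _ _ dG G'c, of 1 n 1] by (simp add: g1)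
  qed
  show ?thesis
  proof (rule W1p0_limit[OF _ _ wn])
    show "in_Lp \<Omega> p (\<lambda>x. max 0 (u x - k))"
      by (rule in_Lp_bound_by[OF u(1) _ zero_le_one]) (use k in \<open>auto intro!: AE_I2\<close>)
    show "in_Lp \<Omega> p (\<lambda>x. above k (u x) *\<^sub>R Du x)"
      by (rule in_Lp_bound_by[OF u(2), of _ 1])
        (auto simp: above_bounds abs_of_nonneg intro!: AE_I2 mult_left_le_one_le)
    have slim: "s \<longlonglongrightarrow> 0" unfolding s_def by (rule LIMSEQ_Suc[OF lim_1_over_n])
    have diff: "\<bar>max 0 (t - k) - G n t\<bar> \<le> s n" for n t
    proof -
      have m: "max 0 (t - k) = ((t - k) + \<bar>t - k\<bar>) / 2" by (simp add: max_def)
      have "k \<le> R n 0" "R n 0 \<le> k + s n" using R_ge[of 0 n] R_le[of n 0] k by simp_all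
      then show ?thesis using R_ge[of t n] R_le[of n t] unfolding m G_def by (intro abs_leI) (simp_all add: field_simps)
    qed
    have "Lp_null (\<lambda>n x. max 0 (u x - k) - G n (u x))"
    proof (rule Lp_null_dominated[OF in_Lp_const[of "1::real"]])
      show "norm (max 0 (u x - k) - G n (u x)) \<le> norm (1::real)" for n x
        using diff[of "u x" n] s(2)[of n] by simp
      show "AE x in M. (\<lambda>n. max 0 (u x - k) - G n (u x)) \<longlonglongrightarrow> 0"
        using diff by (intro AE_I2 tendsto_rabs_zero_cancel[OF LIMSEQ_0_upper[OF _ _ slim]]) auto
    qed measurable
    then show "(\<lambda>n. LINT x|M. norm (max 0 (u x - k) - G n (u x)) powr p) \<longlonglongrightarrow> 0"
      by (simp add: Lp_null_def)
    have "Lp_null (\<lambda>n x. (above k (u x) - G' n (u x)) *\<^sub>R Du x)"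
    proof (rule Lp_null_dominated[OF u(2)])
      show "norm ((above k (u x) - G' n (u x)) *\<^sub>R Du x) \<le> norm (Du x)" for n x
      proof -
        have "\<bar>above k (u x) - G' n (u x)\<bar> \<le> 1"
          using above_bounds(1,2)[of k "u x"] G'b[of n "u x"] by linarith
        then show ?thesis by (simp add: mult_left_le_one_le)
      qed
      have "(\<lambda>n. above k t - G' n t) \<longlonglongrightarrow> 0" for t
      proof -
        have "(\<lambda>n. (t - k) / R n t) \<longlonglongrightarrow> sgn (t - k)"
        proof (cases "t = k")
          case False
          then have "(\<lambda>n. (t - k) / R n t) \<longlonglongrightarrow> (t - k) / sqrt ((t + - k)\<^sup>2 + 0\<^sup>2)"
            unfolding R_def smooth_abs_def by (intro tendsto_intros slim) auto
          moreover have "(t - k) / sqrt ((t + - k)\<^sup>2 + 0\<^sup>2) = sgn (t - k)"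
            using False by (simp add: real_sgn_eq)
          ultimately show ?thesis by simp
        qed simp
        then have "(\<lambda>n. above k t - G' n t) \<longlonglongrightarrow> above k t - (1 + sgn (t - k)) / 2"
          unfolding G'_def by (intro tendsto_intros) auto
        then show ?thesis by (simp add: above_def)
      qed
      from tendsto_scaleR[OF this tendsto_const]
      show "AE x in M. (\<lambda>n. (above k (u x) - G' n (u x)) *\<^sub>R Du x) \<longlonglongrightarrow> 0" by (intro AE_I2) force
    qed measurable
    then show "(\<lambda>n. LINT x|M. norm (above k (u x) *\<^sub>R Du x - G' n (u x) *\<^sub>R Du x) powr p) \<longlonglongrightarrow> 0"
      by (simp add: Lp_null_def scaleR_diff_left)
  qed
qed

end

section \<open>Poincare inequality on small sets\<close>

text \<open>Young's inequality with exponents p/(p-1) and p, cleared of denominators. In this form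
  it is the tangent line inequality for the p-th power, with equality at a = b; the sharp constants
  in the Jensen and Picone estimates come from there.\<close>

lemma Young_powr:
  fixes a b p :: real
  assumes "1 < p" "0 \<le> a" "0 \<le> b"
  shows "p * a powr (p - 1) * b \<le> (p - 1) * a powr p + b powr p"
proof -
  have e: "1 / (p / (p - 1)) + 1 / p = 1" "1 < p / (p - 1)"
    using assms by (simp_all add: field_simps)
  have "(a powr (p - 1)) powr (p / (p - 1)) = a powr p"
    using assms by (simp add: powr_powr)
  then have "a powr (p - 1) * b \<le> a powr p / (p / (p - 1)) + b powr p / p"
    using Youngs_inequality[OF e(2) assms(1) e(1), of "a powr (p - 1)" b] assms by simp
  then have "p * (a powr (p - 1) * b) \<le> p * (a powr p / (p / (p - 1)) + b powr p / p)"
    using assms(1) by (intro mult_left_mono) auto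
  also have "\<dots> = (p - 1) * a powr p + b powr p"
    using assms(1) by (simp add: field_simps)
  finally show ?thesis by (simp add: mult.assoc)
qed

lemma nn_integral_lborel_translate:
  fixes f :: "'a::euclidean_space \<Rightarrow> ennreal"
  assumes "f \<in> borel_measurable borel"
  shows "(\<integral>\<^sup>+x. f (x + h) \<partial>lborel) = (\<integral>\<^sup>+x. f x \<partial>lborel)"
proof -
  have "(\<integral>\<^sup>+x. f x \<partial>lborel) = (\<integral>\<^sup>+x. f x \<partial>distr lborel borel ((+) h))"
    by (simp add: lborel_distr_plus)
  also have "\<dots> = (\<integral>\<^sup>+x. f (h + x) \<partial>lborel)"
    using assms by (subst nn_integral_distr) auto
  finally show ?thesis by (simp add: add.commute)
qed

text \<open>Jensen's inequality for the derivative on the unit interval. Values in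
  \<open>ennreal\<close> prepare for Tonelli.\<close>

lemma increment_powr_le:
  fixes f f' :: "real \<Rightarrow> real"
  assumes p: "1 < p"
    and f: "\<And>t. (f has_real_derivative f' t) (at t)" "continuous_on UNIV f'"
  shows "ennreal (\<bar>f 1 - f 0\<bar> powr p) \<le> (\<integral>\<^sup>+t. ennreal (\<bar>f' t\<bar> powr p) * indicator {0..1} t \<partial>lborel)"
proof -
  let ?D = "\<bar>f 1 - f 0\<bar>"
  let ?I = "LINT t|lborel. indicator {0..1} t * \<bar>f' t\<bar> powr p"
  have int: "integrable lborel (\<lambda>t. indicator {0..1} t * g t)" if "continuous_on UNIV g" for g :: "real \<Rightarrow> real"
    using borel_integrable_compact[of "{0..1}" g] continuous_on_subset[OF that, of "{0..1}"] by simp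
  have c: "continuous_on UNIV (\<lambda>t. \<bar>f' t\<bar>)" "continuous_on UNIV (\<lambda>t. \<bar>f' t\<bar> powr p)"
    using f(2) p by (auto intro!: continuous_intros continuous_on_powr')
  have "?D = \<bar>LINT t|lborel. f' t * indicator {0..1} t\<bar>"
    using f by (subst integral_FTC_Icc_real[of 0 1 f f']) (auto simp: continuous_on_eq_continuous_at)
  also have "\<dots> \<le> (LINT t|lborel. \<bar>f' t * indicator {0..1} t\<bar>)"
    by (rule integral_abs_bound)
  also have "\<dots> = (LINT t|lborel. indicator {0..1} t * \<bar>f' t\<bar>)"
    by (intro Bochner_Integration.integral_cong) (auto simp: indicator_def)
  finally have D: "?D \<le> (LINT t|lborel. indicator {0..1} t * \<bar>f' t\<bar>)" .
  \<comment> \<open>Young under the integral with the first argument frozen at \<open>?D\<close>;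
    since the left side is \<open>p * ?D powr p\<close>, the terms with factor p - 1 leave exactly
    one \<open>?D powr p\<close>.\<close>
  have "p * ?D powr (p - 1) * ?D \<le> (LINT t|lborel. p * ?D powr (p - 1) * (indicator {0..1} t * \<bar>f' t\<bar>))"
    using D p by (simp add: mult_left_mono)
  also have "\<dots> \<le> (LINT t|lborel. (p - 1) * ?D powr p * (indicator {0..1} t) + indicator {0..1} t * \<bar>f' t\<bar> powr p)"
  proof (rule integral_mono)
    show "p * ?D powr (p - 1) * (indicator {0..1} t * \<bar>f' t\<bar>)
        \<le> (p - 1) * ?D powr p * (indicator {0..1} t) + indicator {0..1} t * \<bar>f' t\<bar> powr p" for t
      using Young_powr[OF p, of ?D "\<bar>f' t\<bar>"] by (auto simp: indicator_def)
  qed (use int[OF c(1)] int[OF c(2)] int[of "\<lambda>_. 1"] in auto)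
  also have "\<dots> = (p - 1) * ?D powr p + ?I"
    using int[OF c(2)] by (subst Bochner_Integration.integral_add) auto
  finally have "?D powr p \<le> ?I"
    using p powr_mult_base[of ?D "p - 1"] by (simp add: algebra_simps)
  also have "ennreal ?I = (\<integral>\<^sup>+t. ennreal (indicator {0..1} t * \<bar>f' t\<bar> powr p) \<partial>lborel)"
    by (rule nn_integral_eq_integral[symmetric, OF int[OF c(2)]]) simp
  also have "\<dots> = (\<integral>\<^sup>+t. ennreal (\<bar>f' t\<bar> powr p) * indicator {0..1} t \<partial>lborel)"
    by (intro nn_integral_cong) (auto simp: indicator_def)
  finally show ?thesis by (simp add: ennreal_leI)
qed

text \<open>The one-dimensional inequality on the segment from x to x + h is integrated over x;
  after exchanging the integrals, translation invariance removes the shift t h.\<close>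

lemma translate_diff_powr_le:
  fixes \<phi> :: "'a::euclidean_space \<Rightarrow> real"
  assumes p: "1 < p" and \<phi>: "smooth_on UNIV \<phi>"
  shows "(\<integral>\<^sup>+x. ennreal (\<bar>\<phi> (x + h) - \<phi> x\<bar> powr p) \<partial>lborel)
    \<le> ennreal (norm h powr p) * (\<integral>\<^sup>+x. ennreal (norm (gradient \<phi> x) powr p) \<partial>lborel)"
proof -
  note c = smooth_on_continuous[OF \<phi>] continuous_on_gradient[OF \<phi>]
  have [measurable]: "\<phi> \<in> borel_measurable borel" "gradient \<phi> \<in> borel_measurable borel"
    using c by (auto intro: borel_measurable_continuous_onI)
  have "ennreal (\<bar>\<phi> (x + h) - \<phi> x\<bar> powr p)
      \<le> (\<integral>\<^sup>+t. ennreal (norm h powr p * norm (gradient \<phi> (x + t *\<^sub>R h)) powr p) * indicator {0..1} t \<partial>lborel)" for x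
  proof -
    have "((\<lambda>t. \<phi> (x + t *\<^sub>R h)) has_derivative (\<lambda>s. gradient \<phi> (x + t *\<^sub>R h) \<bullet> (s *\<^sub>R h))) (at t)" for t
      by (rule has_derivative_compose[OF _ has_derivative_gradient[OF \<phi>], of "\<lambda>t. x + t *\<^sub>R h"])
        (auto intro!: derivative_eq_intros)
    then have d: "((\<lambda>t. \<phi> (x + t *\<^sub>R h)) has_real_derivative (gradient \<phi> (x + t *\<^sub>R h) \<bullet> h)) (at t)" for t
      by (simp add: has_field_derivative_def mult_commute_abs)
    have cont: "continuous_on UNIV (\<lambda>t. gradient \<phi> (x + t *\<^sub>R h) \<bullet> h)"
      by (intro continuous_intros continuous_on_compose2[OF c(2)]) auto
    have "ennreal (\<bar>\<phi> (x + h) - \<phi> x\<bar> powr p)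
      \<le> (\<integral>\<^sup>+t. ennreal (\<bar>gradient \<phi> (x + t *\<^sub>R h) \<bullet> h\<bar> powr p) * indicator {0..1} t \<partial>lborel)"
      using increment_powr_le[OF p d cont] by simp
    also have "\<dots> \<le> (\<integral>\<^sup>+t. ennreal (norm h powr p * norm (gradient \<phi> (x + t *\<^sub>R h)) powr p) * indicator {0..1} t \<partial>lborel)"
    proof (intro nn_integral_mono mult_right_mono ennreal_leI)
      show "\<bar>gradient \<phi> (x + t *\<^sub>R h) \<bullet> h\<bar> powr p \<le> norm h powr p * norm (gradient \<phi> (x + t *\<^sub>R h)) powr p" for t
        using powr_mono2[of p, OF _ abs_ge_zero Cauchy_Schwarz_ineq2[of "gradient \<phi> (x + t *\<^sub>R h)" h]] p
        by (simp add: powr_mult mult.commute)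
    qed auto
    finally show ?thesis .
  qed
  then have "(\<integral>\<^sup>+x. ennreal (\<bar>\<phi> (x + h) - \<phi> x\<bar> powr p) \<partial>lborel)
    \<le> (\<integral>\<^sup>+x. (\<integral>\<^sup>+t. ennreal (norm h powr p * norm (gradient \<phi> (x + t *\<^sub>R h)) powr p) * indicator {0..1} t \<partial>lborel) \<partial>lborel)"
    by (rule nn_integral_mono)
  also have "\<dots> = (\<integral>\<^sup>+t. (\<integral>\<^sup>+x. ennreal (norm h powr p * norm (gradient \<phi> (x + t *\<^sub>R h)) powr p) * indicator {0..1} t \<partial>lborel) \<partial>lborel)"
    by (rule lborel_pair.Fubini'[symmetric]) (simp add: borel_prod[symmetric])
  also have "\<dots> = (\<integral>\<^sup>+t. ennreal (norm h powr p) * (\<integral>\<^sup>+x. ennreal (norm (gradient \<phi> x) powr p) \<partial>lborel) * indicator {0..1::real} t \<partial>lborel)"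
  proof (rule nn_integral_cong)
    fix t :: real
    have "(\<integral>\<^sup>+x. ennreal (norm h powr p * norm (gradient \<phi> (x + t *\<^sub>R h)) powr p) * indicator {0..1} t \<partial>lborel)
        = ennreal (norm h powr p) * (\<integral>\<^sup>+x. ennreal (norm (gradient \<phi> (x + t *\<^sub>R h)) powr p) \<partial>lborel) * indicator {0..1} t"
      by (simp add: nn_integral_multc nn_integral_cmult ennreal_mult)
    also have "(\<integral>\<^sup>+x. ennreal (norm (gradient \<phi> (x + t *\<^sub>R h)) powr p) \<partial>lborel) = (\<integral>\<^sup>+x. ennreal (norm (gradient \<phi> x) powr p) \<partial>lborel)"
      by (rule nn_integral_lborel_translate) measurable
    finally show "(\<integral>\<^sup>+x. ennreal (norm h powr p * norm (gradient \<phi> (x + t *\<^sub>R h)) powr p) * indicator {0..1} t \<partial>lborel)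
        = ennreal (norm h powr p) * (\<integral>\<^sup>+x. ennreal (norm (gradient \<phi> x) powr p) \<partial>lborel) * indicator {0..1} t" .
  qed
  also have "\<dots> = ennreal (norm h powr p) * (\<integral>\<^sup>+x. ennreal (norm (gradient \<phi> x) powr p) \<partial>lborel)"
    by (subst nn_integral_cmult_indicator) auto
  finally show ?thesis .
qed

text \<open>On A each value of \<phi> is compared with its translate by h, and the result is
  integrated over h in a cube of side r. The differences cost the gradient term; the translates
  contribute at most |A| times the total mass. The side r stays free so that the two terms can be
  balanced later.\<close>

lemma small_set_estimate:
  fixes \<phi> :: "'a::euclidean_space \<Rightarrow> real"
  assumes p: "1 < p" and \<phi>: "smooth_on UNIV \<phi>" and A: "A \<in> sets borel" and r: "0 < r"
  shows "ennreal (r ^ DIM('a)) * (\<integral>\<^sup>+x. indicator A x * ennreal (\<bar>\<phi> x\<bar> powr p) \<partial>lborel)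
    \<le> ennreal (2 powr p) * (ennreal (r ^ DIM('a)) * (ennreal ((real DIM('a) * r) powr p) *
          (\<integral>\<^sup>+x. ennreal (norm (gradient \<phi> x) powr p) \<partial>lborel))
        + emeasure lborel A * (\<integral>\<^sup>+x. ennreal (\<bar>\<phi> x\<bar> powr p) \<partial>lborel))"
proof -
  have [measurable]: "\<phi> \<in> borel_measurable borel" "A \<in> sets borel"
    using smooth_on_continuous[OF \<phi>] A by (auto intro: borel_measurable_continuous_onI)
  define Q where "Q = cbox (0::'a) (r *\<^sub>R One)"
  have [measurable]: "Q \<in> sets borel" by (simp add: Q_def)
  have Q: "emeasure lborel Q = ennreal (r ^ DIM('a))"
    unfolding Q_def using r by (subst emeasure_lborel_cbox) (auto simp: prod_ennreal)
  have nQ: "norm h \<le> real DIM('a) * r" if "h \<in> Q" for h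
  proof -
    have "norm h \<le> (\<Sum>b\<in>Basis. \<bar>h \<bullet> b\<bar>)" by (rule norm_le_l1)
    also have "\<dots> \<le> (\<Sum>b\<in>(Basis::'a set). r)"
      using that by (intro sum_mono) (auto simp: Q_def mem_box)
    finally show ?thesis by simp
  qed
  define c where "c = ennreal ((real DIM('a) * r) powr p) * (\<integral>\<^sup>+x. ennreal (norm (gradient \<phi> x) powr p) \<partial>lborel)"
  define a where "a = (\<integral>\<^sup>+x. indicator A x * ennreal (\<bar>\<phi> x\<bar> powr p) \<partial>lborel)"
  have "a \<le> ennreal (2 powr p) * (c + (\<integral>\<^sup>+x. indicator A x * ennreal (\<bar>\<phi> (x + h)\<bar> powr p) \<partial>lborel))"
    if h: "h \<in> Q" for h
  proof -
    have "a \<le> (\<integral>\<^sup>+x. ennreal (2 powr p) * (ennreal (\<bar>\<phi> (x + h) - \<phi> x\<bar> powr p) + indicator A x * ennreal (\<bar>\<phi> (x + h)\<bar> powr p)) \<partial>lborel)"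
      unfolding a_def
    proof (rule nn_integral_mono)
      fix x
      have "\<bar>\<phi> x\<bar> powr p \<le> 2 powr p * (\<bar>\<phi> (x + h) - \<phi> x\<bar> powr p + \<bar>\<phi> (x + h)\<bar> powr p)"
        using norm_diff_powr_le[of p "\<phi> (x + h)" "\<phi> (x + h) - \<phi> x"] p by (simp add: add.commute)
      then show "indicator A x * ennreal (\<bar>\<phi> x\<bar> powr p) \<le> ennreal (2 powr p) *
          (ennreal (\<bar>\<phi> (x + h) - \<phi> x\<bar> powr p) + indicator A x * ennreal (\<bar>\<phi> (x + h)\<bar> powr p))"
        by (cases "x \<in> A") (auto simp flip: ennreal_mult' ennreal_plus intro!: ennreal_leI)
    qed
    also have "\<dots> = ennreal (2 powr p) * ((\<integral>\<^sup>+x. ennreal (\<bar>\<phi> (x + h) - \<phi> x\<bar> powr p) \<partial>lborel)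
        + (\<integral>\<^sup>+x. indicator A x * ennreal (\<bar>\<phi> (x + h)\<bar> powr p) \<partial>lborel))"
      by (subst nn_integral_cmult) (auto simp: nn_integral_add)
    also have "(\<integral>\<^sup>+x. ennreal (\<bar>\<phi> (x + h) - \<phi> x\<bar> powr p) \<partial>lborel) \<le> c"
      unfolding c_def using nQ[OF h] p
      by (intro order_trans[OF translate_diff_powr_le[OF p \<phi>]] mult_right_mono ennreal_leI powr_mono2) auto
    finally show ?thesis by (simp add: add_right_mono mult_left_mono)
  qed
  \<comment> \<open>The indicator of the cube is kept on \<open>c\<close> only. In the second term h
    may range over the whole space, so that for fixed x the inner integral becomes the full mass of
    \<phi>.\<close>
  then have "(\<integral>\<^sup>+h. a * indicator Q h \<partial>lborel) \<le>
      (\<integral>\<^sup>+h. ennreal (2 powr p) * (c * indicator Q h + (\<integral>\<^sup>+x. indicator A x * ennreal (\<bar>\<phi> (x + h)\<bar> powr p) \<partial>lborel)) \<partial>lborel)"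
    by (intro nn_integral_mono) (auto simp: indicator_def)
  also have "\<dots> = ennreal (2 powr p) * (c * emeasure lborel Q +
      (\<integral>\<^sup>+h. (\<integral>\<^sup>+x. indicator A x * ennreal (\<bar>\<phi> (x + h)\<bar> powr p) \<partial>lborel) \<partial>lborel))"
    by (simp add: nn_integral_cmult nn_integral_add nn_integral_cmult_indicator)
  also have "(\<integral>\<^sup>+h. (\<integral>\<^sup>+x. indicator A x * ennreal (\<bar>\<phi> (x + h)\<bar> powr p) \<partial>lborel) \<partial>lborel)
      = (\<integral>\<^sup>+x. (\<integral>\<^sup>+h. indicator A x * ennreal (\<bar>\<phi> (x + h)\<bar> powr p) \<partial>lborel) \<partial>lborel)"
    by (rule lborel_pair.Fubini') (simp add: borel_prod[symmetric])
  also have "\<dots> = (\<integral>\<^sup>+x. (\<integral>\<^sup>+y. ennreal (\<bar>\<phi> y\<bar> powr p) \<partial>lborel) * indicator A x \<partial>lborel)"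
  proof (rule nn_integral_cong)
    fix x
    have "(\<integral>\<^sup>+h. ennreal (\<bar>\<phi> (x + h)\<bar> powr p) \<partial>lborel) = (\<integral>\<^sup>+y. ennreal (\<bar>\<phi> y\<bar> powr p) \<partial>lborel)"
      using nn_integral_lborel_translate[of "\<lambda>y. ennreal (\<bar>\<phi> y\<bar> powr p)" x] by (simp add: add.commute)
    then show "(\<integral>\<^sup>+h. indicator A x * ennreal (\<bar>\<phi> (x + h)\<bar> powr p) \<partial>lborel)
        = (\<integral>\<^sup>+y. ennreal (\<bar>\<phi> y\<bar> powr p) \<partial>lborel) * indicator A x"
      by (simp add: nn_integral_cmult mult.commute)
  qed
  also have "\<dots> = (\<integral>\<^sup>+y. ennreal (\<bar>\<phi> y\<bar> powr p) \<partial>lborel) * emeasure lborel A"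
    by (subst nn_integral_cmult_indicator) auto
  also have "(\<integral>\<^sup>+h. a * indicator Q h \<partial>lborel) = a * emeasure lborel Q"
    by (subst nn_integral_cmult_indicator) auto
  finally show ?thesis unfolding Q a_def c_def by (simp add: mult.commute)
qed

section \<open>Convergence of p-th power integrals and the Poincare inequality for Sobolev
  functions\<close>

context bounded_domain
begin

text \<open>Young's inequality for |f| and |g| >= |f| - |f - g| gives |f|^p <= |g|^p + p |f|^(p-1)
  |f - g|, and a second use with weight \<tau> splits the cross term into a small multiple of |f|^p
  and a large multiple of |f - g|^p. Unlike the bound with factor \<open>2 powr p\<close>, the
  integral of |g|^p keeps the coefficient 1.\<close>

lemma Lp_compare:
  fixes f g :: "'a \<Rightarrow> 'b::euclidean_space"
  assumes "in_Lp \<Omega> p f" "in_Lp \<Omega> p g" "0 < \<tau>"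
  shows "(LINT x|M. norm (f x) powr p) \<le> (LINT x|M. norm (g x) powr p)
    + (p - 1) * \<tau> powr p * (LINT x|M. norm (f x) powr p)
    + \<tau> powr ((1 - p) * p) * (LINT x|M. norm (f x - g x) powr p)"
proof -
  note i = in_Lp_integrable[OF assms(1)] in_Lp_integrable[OF assms(2)] in_Lp_integrable[OF in_Lp_diff[OF assms(1,2)]]
  have "norm (f x) powr p \<le> norm (g x) powr p + (p - 1) * \<tau> powr p * norm (f x) powr p
      + \<tau> powr ((1 - p) * p) * norm (f x - g x) powr p" for x
  proof -
    have "p * norm (f x) powr (p - 1) * norm (g x) \<le> (p - 1) * norm (f x) powr p + norm (g x) powr p"
      by (rule Young_powr[OF p_gt_1]) auto
    moreover have "p * norm (f x) powr (p - 1) * (norm (f x) - norm (f x - g x))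
        \<le> p * norm (f x) powr (p - 1) * norm (g x)"
      using norm_triangle_ineq2[of "f x" "f x - g x"] p_gt_1 by (intro mult_left_mono) auto
    moreover have "norm (f x) powr (p - 1) * norm (f x) = norm (f x) powr p"
      using powr_mult_base[of "norm (f x)" "p - 1"] by (simp add: mult.commute)
    moreover have "p * (norm (f x) powr (p - 1) * norm (f x - g x))
        \<le> (p - 1) * (\<tau> powr p * norm (f x) powr p) + \<tau> powr ((1 - p) * p) * norm (f x - g x) powr p"
    proof -
      have "\<tau> powr (p - 1) * \<tau> powr (1 - p) = 1" using assms(3) by (simp flip: powr_add)
      then have eq: "(\<tau> * norm (f x)) powr (p - 1) * (\<tau> powr (1 - p) * norm (f x - g x))
          = norm (f x) powr (p - 1) * norm (f x - g x)"
        using assms(3) by (simp add: powr_mult mult_ac)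
      have "p * (\<tau> * norm (f x)) powr (p - 1) * (\<tau> powr (1 - p) * norm (f x - g x))
          \<le> (p - 1) * (\<tau> * norm (f x)) powr p + (\<tau> powr (1 - p) * norm (f x - g x)) powr p"
        using assms(3) by (intro Young_powr[OF p_gt_1]) auto
      then show ?thesis
        unfolding mult.assoc eq using assms(3) by (simp add: powr_mult powr_powr)
    qed
    ultimately show ?thesis by (simp add: algebra_simps)
  qed
  then have "(LINT x|M. norm (f x) powr p) \<le> (LINT x|M. norm (g x) powr p + (p - 1) * \<tau> powr p * norm (f x) powr p
      + \<tau> powr ((1 - p) * p) * norm (f x - g x) powr p)"
    by (intro integral_mono Bochner_Integration.integrable_add integrable_mult_right i)
  then show ?thesis using i by simp
qed

lemma Lp_tendsto:
  fixes f :: "'a \<Rightarrow> 'b::euclidean_space"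
  assumes f: "in_Lp \<Omega> p f" and g: "\<And>n. in_Lp \<Omega> p (g n)"
    and l: "(\<lambda>n. LINT x|M. norm (f x - g n x) powr p) \<longlonglongrightarrow> 0"
  shows "(\<lambda>n. LINT x|M. norm (g n x) powr p) \<longlonglongrightarrow> (LINT x|M. norm (f x) powr p)"
proof (rule LIMSEQ_I)
  fix e :: real assume e: "0 < e"
  let ?I = "\<lambda>f::'a \<Rightarrow> 'b. LINT x|M. norm (f x) powr p"
  \<comment> \<open>Bounds the mass of \<open>f\<close> and of every \<open>g n\<close> at distance
    below 1 from it, so that one \<tau> serves both directions of the comparison.\<close>
  define S where "S = 2 powr p * (?I f + 1)"
  have If: "0 \<le> ?I f" by (rule integral_Lp_nonneg)
  have "1 \<le> (2::real) powr p" using p_gt_1 by (intro ge_one_powr_ge_zero) auto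
  then have S: "?I f \<le> S" "0 < S"
    using If mult_right_mono[of 1 "2 powr p" "?I f + 1"] unfolding S_def
    by (smt (verit))+
  define \<tau> where "\<tau> = (e / (2 * p * S)) powr (1 / p)"
  have \<tau>: "0 < \<tau>" "\<tau> powr p = e / (2 * p * S)"
    using e S p_gt_1 by (simp_all add: \<tau>_def powr_powr)
  have small: "(p - 1) * \<tau> powr p * s < e / 2" if "s \<le> S" for s
  proof -
    have "(p - 1) * \<tau> powr p * s \<le> (p - 1) * \<tau> powr p * S"
      using that p_gt_1 by (intro mult_left_mono) auto
    also have "\<dots> < p * \<tau> powr p * S"
      using \<tau>(1) S(2) by (intro mult_strict_right_mono) auto
    also have "\<dots> = e / 2" unfolding \<tau>(2) using p_gt_1 S(2) by simp
    finally show ?thesis .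
  qed
  have "(\<lambda>n. \<tau> powr ((1 - p) * p) * ?I (\<lambda>x. f x - g n x)) \<longlonglongrightarrow> 0"
    by (rule tendsto_mult_right_zero[OF l])
  then have "\<forall>\<^sub>F n in sequentially. \<tau> powr ((1 - p) * p) * ?I (\<lambda>x. f x - g n x) < e / 2"
    using e by (intro order_tendstoD) auto
  moreover have "\<forall>\<^sub>F n in sequentially. ?I (\<lambda>x. f x - g n x) < 1"
    by (rule order_tendstoD(2)[OF l]) simp
  ultimately have "\<forall>\<^sub>F n in sequentially. norm (?I (g n) - ?I f) < e"
  proof eventually_elim
    case (elim n)
    have sym: "?I (\<lambda>x. g n x - f x) = ?I (\<lambda>x. f x - g n x)" by (simp add: norm_minus_commute)
    have "?I (g n) \<le> 2 powr p * (?I (\<lambda>x. g n x - f x) + ?I f)"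
      using Lp_diff_triangle[OF g f in_Lp_const[of 0], of n] by simp
    also have "\<dots> \<le> S" unfolding S_def sym using elim(2) by (intro mult_left_mono) auto
    finally have "?I (g n) \<le> S" .
    with Lp_compare[OF f g[of n] \<tau>(1)] Lp_compare[OF g[of n] f \<tau>(1)] small[OF S(1)] small[of "?I (g n)"] elim(1)
    have "?I f < ?I (g n) + e" "?I (g n) < ?I f + e"
      unfolding sym by linarith+
    then show ?case by (simp add: abs_less_iff)
  qed
  then show "\<exists>N. \<forall>n\<ge>N. norm (?I (g n) - ?I f) < e" by (simp add: eventually_sequentially)
qed

text \<open>Real integrals over \<Omega> are the form in which limits along approximating test
  functions can be taken.\<close>

lemma small_set_estimate_real:
  assumes \<phi>: "test_function \<Omega> \<phi>" and A: "A \<in> sets borel" "emeasure lborel A = ennreal a"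
    and a: "0 \<le> a" and r: "0 < r"
  shows "r ^ DIM('a) * (LINT x|M. norm (indicator A x * \<phi> x) powr p)
    \<le> 2 powr p * (r ^ DIM('a) * ((real DIM('a) * r) powr p * (LINT x|M. norm (gradient \<phi> x) powr p))
        + a * (LINT x|M. norm (\<phi> x) powr p))"
proof -
  obtain C where C: "compact C" "C \<subseteq> \<Omega>" "\<And>x. x \<notin> C \<Longrightarrow> \<phi> x = 0" "\<And>x. x \<notin> C \<Longrightarrow> gradient \<phi> x = 0"
    using test_functionE[OF \<phi>] by blast
  note sm = test_function_smooth[OF \<phi>]
  note cont = smooth_on_continuous[OF sm] continuous_on_gradient[OF sm]
  have [measurable]: "\<phi> \<in> borel_measurable borel" "A \<in> sets borel"
    using cont A by (auto intro: borel_measurable_continuous_onI)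
  have c: "continuous_on UNIV (\<lambda>x. norm (\<phi> x) powr p)" "continuous_on UNIV (\<lambda>x. norm (gradient \<phi> x) powr p)"
    using p_gt_1 by (auto intro!: continuous_intros continuous_on_powr' cont)
  have z: "norm (\<phi> x) powr p = 0" "norm (gradient \<phi> x) powr p = 0" if "x \<notin> C" for x
    using C(3,4) that p_gt_1 by auto
  note I1 = test_function_lborel[OF c(1) C(1,2) z(1)] and I2 = test_function_lborel[OF c(2) C(1,2) z(2)]
  have e1: "(\<integral>\<^sup>+x. ennreal (\<bar>\<phi> x\<bar> powr p) \<partial>lborel) = ennreal (LINT x|M. norm (\<phi> x) powr p)"
    using nn_integral_eq_integral[OF I1(1)] I1(2) by simp
  have e2: "(\<integral>\<^sup>+x. ennreal (norm (gradient \<phi> x) powr p) \<partial>lborel) = ennreal (LINT x|M. norm (gradient \<phi> x) powr p)"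
    using nn_integral_eq_integral[OF I2(1)] I2(2) by simp
  have i: "integrable lborel (\<lambda>x. indicator A x * norm (\<phi> x) powr p)"
    using integrable_mult_indicator[OF _ I1(1), of A] by simp
  have "(LINT x|M. norm (indicator A x * \<phi> x) powr p) = (LINT x|lebesgue. indicator \<Omega> x *\<^sub>R norm (indicator A x * \<phi> x) powr p)"
    using \<Omega>_sets by (simp add: integral_restrict_space)
  also have "(\<lambda>x. indicator \<Omega> x *\<^sub>R norm (indicator A x * \<phi> x) powr p) = (\<lambda>x. indicator A x * norm (\<phi> x) powr p)"
    using z(1) C(2) by (fastforce simp: indicator_def)
  also have "(LINT x|lebesgue. indicator A x * norm (\<phi> x) powr p) = (LINT x|lborel. indicator A x * norm (\<phi> x) powr p)"
    by (rule integral_completion) measurable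
  finally have e3: "(\<integral>\<^sup>+x. indicator A x * ennreal (\<bar>\<phi> x\<bar> powr p) \<partial>lborel) = ennreal (LINT x|M. norm (indicator A x * \<phi> x) powr p)"
    using nn_integral_eq_integral[OF i] by (simp add: ennreal_mult ennreal_indicator)
  show ?thesis
    using small_set_estimate[OF p_gt_1 sm A(1) r] r a unfolding e1 e2 e3 A(2)
    by (simp add: integral_Lp_nonneg add_nonneg_nonneg flip: ennreal_mult ennreal_plus)
qed

text \<open>The factor \<open>2 powr (p + 1)\<close> remains after half of the mass is absorbed,
  \<open>real DIM('a) powr p\<close> comes from the length bound for vectors of the cube, and the
  last factor from the p-th power of its side r, where r^N is \<open>2 powr (p + 1)\<close> times
  the measure of the support.\<close>

definition Poincare_const :: real where
  "Poincare_const = 2 powr (p + 1) * (real DIM('a) powr p * 2 powr ((p + 1) * p / DIM('a)))"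

lemma Poincare_const_pos: "0 < Poincare_const"
  by (simp add: Poincare_const_def)

text \<open>The proof compares \<open>w\<close> on its support \<open>A\<close> with its translates by the vectors of a cube
  whose volume is a multiple of \<open>|A|\<close>: the average over the cube of the mass of the translates on
  \<open>A\<close> is a small fraction of the total mass.\<close>

lemma Poincare_small_support:
  assumes W: "W1p0 \<Omega> p w Dw"
  defines "a \<equiv> measure M {x \<in> \<Omega>. w x \<noteq> 0}"
  shows "(LINT x|M. norm (w x) powr p) \<le> Poincare_const * a powr (p / DIM('a)) * (LINT x|M. norm (Dw x) powr p)"
proof -
  let ?I = "\<lambda>f. LINT x|M. norm (f x) powr p"
  note w = W1p0_in_Lp[OF W]
  have [measurable]: "w \<in> borel_measurable M" using w by (simp add: in_Lp_def)
  have A0: "{x \<in> \<Omega>. w x \<noteq> 0} \<in> sets M"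
  proof -
    have "{x \<in> space M. w x \<noteq> 0} \<in> sets M" by measurable
    then show ?thesis by simp
  qed
  then have A0': "{x \<in> \<Omega>. w x \<noteq> 0} \<in> sets lebesgue"
    using \<Omega>_sets by (auto simp: sets_restrict_space_iff)
  \<comment> \<open>A Borel hull of the same measure, since the translation estimate is stated for
    Borel sets.\<close>
  obtain A where A: "A \<in> sets lborel" "{x \<in> \<Omega>. w x \<noteq> 0} \<subseteq> A"
    "emeasure lebesgue {x \<in> \<Omega>. w x \<noteq> 0} = emeasure lborel A"
    by (rule completion_upper[OF A0'])
  have "emeasure lborel A = emeasure M {x \<in> \<Omega>. w x \<noteq> 0}"
    unfolding A(3)[symmetric] using \<Omega>_sets by (subst emeasure_restrict_space) auto
  then have eA: "emeasure lborel A = ennreal a"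
    unfolding a_def by (simp add: emeasure_eq_measure)
  have a0: "0 \<le> a" by (simp add: a_def)
  show ?thesis
  proof (cases "a = 0")
    \<comment> \<open>The cube used in the other case would degenerate here, but then
      \<open>w\<close> vanishes almost everywhere.\<close>
    case True
    have "emeasure M {x \<in> \<Omega>. w x \<noteq> 0} = 0"
      using True by (simp add: a_def emeasure_eq_measure)
    then have "AE x in M. w x = 0"
      using A0 by (intro AE_I[of _ _ "{x \<in> \<Omega>. w x \<noteq> 0}"]) auto
    then have "AE x in M. norm (w x) powr p = 0" by eventually_elim (use p_gt_1 in simp)
    then have "?I w = 0" by (rule integral_eq_zero_AE)
    then show ?thesis using True p_gt_1 by simp
  next
    case False
    with a0 have a: "0 < a" by simp
    obtain \<phi> where \<phi>: "\<And>n. test_function \<Omega> (\<phi> n)"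
      and l1: "(\<lambda>n. ?I (\<lambda>x. w x - \<phi> n x)) \<longlonglongrightarrow> 0"
      and l2: "(\<lambda>n. ?I (\<lambda>x. Dw x - gradient (\<phi> n) x)) \<longlonglongrightarrow> 0"
      using W1p0_approx_seq[OF W] by blast
    note \<phi>p = in_Lp_test[OF \<phi>]
    have Am: "A \<in> sets borel" "(\<lambda>x. indicator A x :: real) \<in> borel_measurable M"
    proof -
      show "A \<in> sets borel" using A(1) by simp
      then have "(\<lambda>x. indicator A x :: real) \<in> borel_measurable lebesgue" by (intro measurable_completion) simp
      then show "(\<lambda>x. indicator A x :: real) \<in> borel_measurable M" by (rule measurable_restrict_space1)
    qed
    have iA: "in_Lp \<Omega> p (\<lambda>x. indicator A x * f x)" if "in_Lp \<Omega> p f" for f :: "'a \<Rightarrow> real"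
      by (rule in_Lp_bound_by[OF that _ zero_le_one]) (use that Am(2) in \<open>auto simp: in_Lp_def indicator_def\<close>)
    \<comment> \<open>Test functions approximating \<open>w\<close> may be nonzero outside
      \<open>A\<close>, so they are cut off by the indicator on the left side of the estimate; for
      \<open>w\<close> the cut-off changes nothing.\<close>
    have wA: "?I (\<lambda>x. indicator A x * w x) = ?I w"
      using A(2) by (intro Bochner_Integration.integral_cong) (auto simp: indicator_def)
    have nl: "Lp_null (\<lambda>n x. indicator A x * w x - indicator A x * \<phi> n x)"
    proof (rule Lp_null_bound)
      show "Lp_null (\<lambda>n x. w x - \<phi> n x)" unfolding Lp_null_def using l1 w \<phi>p by (auto intro: in_Lp_diff)
      show "norm (indicator A x * w x - indicator A x * \<phi> n x) \<le> 1 * norm (w x - \<phi> n x)" for n x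
        by (auto simp: indicator_def)
      show "(\<lambda>x. indicator A x * w x - indicator A x * \<phi> n x) \<in> borel_measurable M" for n
        using in_Lp_measurable[OF in_Lp_diff[OF iA[OF w(1)] iA[OF \<phi>p(1)]]] .
    qed simp
    have t1: "(\<lambda>n. ?I (\<phi> n)) \<longlonglongrightarrow> ?I w" by (rule Lp_tendsto[OF w(1) \<phi>p(1) l1])
    have t2: "(\<lambda>n. ?I (gradient (\<phi> n))) \<longlonglongrightarrow> ?I Dw" by (rule Lp_tendsto[OF w(2) \<phi>p(2) l2])
    have t3: "(\<lambda>n. ?I (\<lambda>x. indicator A x * \<phi> n x)) \<longlonglongrightarrow> ?I w"
      using Lp_tendsto[OF iA[OF w(1)] iA[OF \<phi>p(1)]] nl unfolding wA by (simp add: Lp_null_def)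
    define N where "N = DIM('a)"
    have N: "0 < N" by (simp add: N_def)
    \<comment> \<open>With this side \<open>2 powr p * a\<close> is half of \<open>r ^ N\<close>, so
      the mass term on the right is absorbed by the left side.\<close>
    define r where "r = (2 powr (p + 1) * a) powr (1 / N)"
    have r: "0 < r" "r ^ N = 2 powr (p + 1) * a"
      using a N by (simp_all add: r_def powr_powr flip: powr_realpow)
    have rp: "r powr p = 2 powr ((p + 1) * p / N) * a powr (p / N)"
      using a by (simp add: r_def powr_powr powr_mult)
    have "r ^ N * ?I w \<le> 2 powr p * (r ^ N * ((real N * r) powr p * ?I Dw) + a * ?I w)"
    proof (rule LIMSEQ_le)
      show "(\<lambda>n. r ^ N * ?I (\<lambda>x. indicator A x * \<phi> n x)) \<longlonglongrightarrow> r ^ N * ?I w"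
        by (intro tendsto_intros t3)
      show "(\<lambda>n. 2 powr p * (r ^ N * ((real N * r) powr p * ?I (gradient (\<phi> n))) + a * ?I (\<phi> n)))
          \<longlonglongrightarrow> 2 powr p * (r ^ N * ((real N * r) powr p * ?I Dw) + a * ?I w)"
        by (intro tendsto_intros t1 t2)
      show "\<exists>m. \<forall>n\<ge>m. r ^ N * ?I (\<lambda>x. indicator A x * \<phi> n x)
          \<le> 2 powr p * (r ^ N * ((real N * r) powr p * ?I (gradient (\<phi> n))) + a * ?I (\<phi> n))"
        using small_set_estimate_real[OF \<phi> Am(1) eA a0 r(1)] unfolding N_def by blast
    qed
    then have "2 * (2 powr p * a) * ?I w \<le> (2 powr p * a) * (2 powr (p + 1) * ((real N * r) powr p * ?I Dw) + ?I w)"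
      unfolding r(2) by (simp add: powr_add algebra_simps)
    then have "?I w \<le> 2 powr (p + 1) * ((real N * r) powr p * ?I Dw)"
      using a by (simp add: mult.assoc mult.left_commute[of 2])
    also have "\<dots> = Poincare_const * a powr (p / N) * ?I Dw"
      using r(1) by (simp add: powr_mult rp Poincare_const_def N_def)
    finally show ?thesis by (simp add: N_def)
  qed
qed

end

section \<open>Supremum bounds by level set iteration\<close>

text \<open>The bound y n <= \<delta> \<rho>^n reproduces itself: \<rho> solves b \<rho>^\<alpha> =
  1 and compensates the growth of b^n, while \<delta> solves C \<delta>^\<alpha> = \<rho> and pays
  for the step from n to n + 1.\<close>

lemma fast_geometric_convergence:
  fixes C b \<alpha> :: real
  assumes C: "0 < C" and b: "1 < b" and \<alpha>: "0 < \<alpha>"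
  obtains \<delta> where "0 < \<delta>"
    and "\<And>y. \<lbrakk>\<And>n. 0 \<le> y n; \<And>n. y (Suc n) \<le> C * b ^ n * y n powr (1 + \<alpha>); y 0 \<le> \<delta>\<rbrakk> \<Longrightarrow> y \<longlonglongrightarrow> 0"
proof
  define \<rho> where "\<rho> = b powr (- 1 / \<alpha>)"
  define \<delta> where "\<delta> = (\<rho> / C) powr (1 / \<alpha>)"
  have \<rho>: "0 < \<rho>" "\<rho> < 1"
  proof -
    show "0 < \<rho>" using b by (simp add: \<rho>_def)
    have "b powr (- 1 / \<alpha>) < b powr 0" using b \<alpha> by (intro powr_less_mono) auto
    then show "\<rho> < 1" using b by (simp add: \<rho>_def)
  qed
  show \<delta>: "0 < \<delta>" using \<rho> C by (simp add: \<delta>_def)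
  fix y :: "nat \<Rightarrow> real"
  assume y: "\<And>n. 0 \<le> y n" "\<And>n. y (Suc n) \<le> C * b ^ n * y n powr (1 + \<alpha>)" "y 0 \<le> \<delta>"
  have \<delta>\<alpha>: "C * \<delta> powr \<alpha> = \<rho>" using \<rho> C \<alpha> by (simp add: \<delta>_def powr_powr)
  have "\<rho> powr \<alpha> = b powr (- 1)" using \<alpha> by (simp add: \<rho>_def powr_powr)
  then have \<rho>\<alpha>: "b * \<rho> powr \<alpha> = 1" using b by (simp add: powr_minus)
  have "y n \<le> \<delta> * \<rho> ^ n" for n
  proof (induction n)
    case (Suc n)
    have "(\<rho> ^ n) powr \<alpha> = (\<rho> powr \<alpha>) ^ n"
      using \<rho>(1) by (simp add: powr_powr mult.commute flip: powr_realpow)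
    then have p1: "b ^ n * (\<rho> ^ n) powr \<alpha> = 1"
      using \<rho>\<alpha> by (simp flip: power_mult_distrib)
    have "y n powr (1 + \<alpha>) \<le> (\<delta> * \<rho> ^ n) powr (1 + \<alpha>)"
      using Suc y(1) \<alpha> by (intro powr_mono2) auto
    then have "y (Suc n) \<le> C * b ^ n * (\<delta> * \<rho> ^ n) powr (1 + \<alpha>)"
      using y(2)[of n] C b by (smt (verit, best) mult_left_mono mult_nonneg_nonneg zero_le_power)
    also have "\<dots> = (C * \<delta> powr \<alpha>) * (b ^ n * (\<rho> ^ n) powr \<alpha>) * (\<delta> * \<rho> ^ n)"
      using \<delta> \<rho>(1) by (simp add: powr_add powr_mult mult_ac)
    also have "\<dots> = \<delta> * \<rho> ^ Suc n" unfolding \<delta>\<alpha> p1 by simp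
    finally show ?case .
  qed (use y(3) in simp)
  moreover have "(\<lambda>n. \<delta> * \<rho> ^ n) \<longlonglongrightarrow> 0"
    using \<rho> by (intro tendsto_mult_right_zero LIMSEQ_power_zero) simp
  ultimately show "y \<longlonglongrightarrow> 0" by (rule LIMSEQ_0_upper[OF y(1)])
qed

context bounded_domain
begin

text \<open>The levels are \<open>k n = K * (2 - (1/2) ^ n)\<close>. On \<open>{v > k (n + 1)}\<close> the right-hand side of the energy
  inequality is controlled by \<open>(v - k n) ^ p\<close>, and \<open>Poincare_small_support\<close> makes the
  resulting recursion for the masses above the levels superlinear.\<close>

lemma level_iteration:
  assumes B: "0 < B"
  obtains \<delta> where "0 < \<delta>"
    and "\<And>v Dv K. \<lbrakk>W1p0 \<Omega> p v Dv; AE x in M. 0 < v x; 0 < K;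
      \<And>k. K \<le> k \<Longrightarrow> (LINT x|M. norm (above k (v x) *\<^sub>R Dv x) powr p)
        \<le> B * (LINT x|M. v x powr (p - 1) * max 0 (v x - k));
      (LINT x|M. norm (v x) powr p) \<le> \<delta> * K powr p\<rbrakk> \<Longrightarrow> AE x in M. v x \<le> 2 * K"
proof -
  define N where "N = DIM('a)"
  have N: "0 < N" by (simp add: N_def)
  define \<alpha> where "\<alpha> = p / N"
  \<comment> \<open>\<open>C\<close> collects the Poincare and energy constants with the n = 0
    values of the factors 2^((n+1) p \<alpha>) and 2^((n+2)(p-1)) from the level gaps;
    \<open>b\<close> is their growth per step.\<close>
  define C where "C = Poincare_const * B * 2 powr (p * \<alpha>) * 4 powr (p - 1)"
  define b where "b = (2::real) powr (p * \<alpha> + (p - 1))"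
  have \<alpha>: "0 < \<alpha>" using p_gt_1 N by (simp add: \<alpha>_def)
  have C: "0 < C" using Poincare_const_pos B by (simp add: C_def)
  have b: "1 < b"
  proof -
    have "(2::real) powr 0 < b" unfolding b_def using p_gt_1 \<alpha>
      by (intro powr_less_mono add_pos_pos) auto
    then show ?thesis by simp
  qed
  obtain \<delta> where \<delta>: "0 < \<delta>" and conv:
    "\<And>y. \<lbrakk>\<And>n. 0 \<le> y n; \<And>n. y (Suc n) \<le> C * b ^ n * y n powr (1 + \<alpha>); y 0 \<le> \<delta>\<rbrakk> \<Longrightarrow> y \<longlonglongrightarrow> 0"
    using fast_geometric_convergence[OF C b \<alpha>] by blast
  show ?thesis
  proof (rule that[OF \<delta>])
    fix v Dv K
    assume W: "W1p0 \<Omega> p v Dv" and pos: "AE x in M. 0 < v x" and K: "0 < K"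
      and E: "\<And>k. K \<le> k \<Longrightarrow> (LINT x|M. norm (above k (v x) *\<^sub>R Dv x) powr p)
        \<le> B * (LINT x|M. v x powr (p - 1) * max 0 (v x - k))"
      and small: "(LINT x|M. norm (v x) powr p) \<le> \<delta> * K powr p"
    note v = W1p0_in_Lp[OF W]
    have [measurable]: "v \<in> borel_measurable M" using v by (simp add: in_Lp_def)
    define k where "k n = K * (2 - (1 / 2) ^ n)" for n :: nat
    define Y where "Y n = (LINT x|M. norm (max 0 (v x - k n)) powr p)" for n
    have k: "K \<le> k n" "k n \<le> 2 * K" for n
      using K power_le_one[of "1/2::real" n] by (auto simp: k_def algebra_simps)
    have k0: "0 < k n" for n using k(1)[of n] K by simp
    have kn: "0 \<le> k n" for n using k0[of n] by simp
    have kd: "k (Suc n) - k n = K * (1 / 2) ^ Suc n" for n by (simp add: k_def algebra_simps)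
    have kp: "0 < k (Suc n) - k n" for n unfolding kd using K by simp
    have trunc: "W1p0 \<Omega> p (\<lambda>x. max 0 (v x - j)) (\<lambda>x. above j (v x) *\<^sub>R Dv x)" if "0 \<le> j" for j
      by (rule W1p0_truncate[OF W that])
    have iY: "integrable M (\<lambda>x. norm (max 0 (v x - j)) powr p)" if "0 \<le> j" for j
      using in_Lp_integrable[OF W1p0_in_Lp(1)[OF trunc[OF that]]] .
    have Y0: "0 \<le> Y n" for n unfolding Y_def by (rule integral_Lp_nonneg)
    have step: "Y (Suc n) \<le> Poincare_const * (Y n / (k (Suc n) - k n) powr p) powr \<alpha> * (B * (2 ^ (n + 2)) powr (p - 1) * Y n)" for n
    proof -
      let ?k = "k (Suc n)" and ?j = "k n"
      let ?A = "{x \<in> \<Omega>. max 0 (v x - ?k) \<noteq> 0}"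
      have A: "?A \<in> sets M"
      proof -
        have "{x \<in> space M. max 0 (v x - ?k) \<noteq> 0} \<in> sets M" by measurable
        then show ?thesis by simp
      qed
      \<comment> \<open>Chebyshev: on \<open>?A\<close> the function \<open>v\<close> exceeds
        \<open>?k\<close>, so \<open>v - ?j\<close> exceeds the gap between the levels.\<close>
      have "measure M ?A * (?k - ?j) powr p = (LINT x|M. indicator ?A x * (?k - ?j) powr p)"
      proof -
        have "?A \<inter> space M = ?A" by auto
        then show ?thesis using A by (simp del: space_lebesgue_on)
      qed
      also have "\<dots> \<le> Y n"
        unfolding Y_def
      proof (rule integral_mono[OF _ iY])
        show "integrable M (\<lambda>x. indicator ?A x * (?k - ?j) powr p)" using A by (simp add: emeasure_eq_measure)
        show "indicator ?A x * (?k - ?j) powr p \<le> norm (max 0 (v x - ?j)) powr p" for x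
          using kp[of n] p_gt_1 by (auto simp: indicator_def max_def split: if_splits intro!: powr_mono2)
      qed (rule kn)
      finally have cheb: "measure M ?A \<le> Y n / (?k - ?j) powr p"
        using kp[of n] by (simp add: field_simps)
      have "(LINT x|M. v x powr (p - 1) * max 0 (v x - ?k)) \<le> (LINT x|M. (2 ^ (n + 2)) powr (p - 1) * norm (max 0 (v x - ?j)) powr p)"
      proof (rule integral_mono_AE')
        show "integrable M (\<lambda>x. (2 ^ (n + 2)) powr (p - 1) * norm (max 0 (v x - ?j)) powr p)"
          by (intro integrable_mult_right iY kn)
        show "AE x in M. v x powr (p - 1) * max 0 (v x - ?k) \<le> (2 ^ (n + 2)) powr (p - 1) * norm (max 0 (v x - ?j)) powr p"
          using pos
        proof eventually_elim
          case (elim x)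
          show ?case
          proof (cases "v x \<le> ?k")
            case False
            have vj: "0 < v x - ?j" using False kp[of n] by linarith
            \<comment> \<open>The ratio v / (v - \<open>?j\<close>) decreases in v, so above
              \<open>?k\<close> it is at most \<open>?k / (?k - ?j)\<close>, which is bounded by 2 K
              / (K / 2^(n+1)) = 2^(n+2).\<close>
            have "0 \<le> ?j * (v x - ?k)" using False k0[of n] by (intro mult_nonneg_nonneg) auto
            then have "v x * (?k - ?j) \<le> ?k * (v x - ?j)" by (simp add: algebra_simps)
            also have "\<dots> \<le> (2 * K) * (v x - ?j)" using k(2) vj by (intro mult_right_mono) auto
            finally have "v x * (K * (1 / 2) ^ Suc n) \<le> (2 * K) * (v x - ?j)" unfolding kd .
            then have "v x \<le> 2 ^ (n + 2) * (v x - ?j)"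
            proof -
              have "K * v x \<le> K * (2 ^ (n + 2) * (v x - ?j))"
                using \<open>v x * (K * (1 / 2) ^ Suc n) \<le> (2 * K) * (v x - ?j)\<close> by (simp add: field_simps power_add)
              then show ?thesis using K by simp
            qed
            then have "v x powr (p - 1) \<le> (2 ^ (n + 2) * (v x - ?j)) powr (p - 1)"
              using elim p_gt_1 by (intro powr_mono2) auto
            then have "v x powr (p - 1) * (v x - ?k) \<le> (2 ^ (n + 2) * (v x - ?j)) powr (p - 1) * (v x - ?j)"
              using kp[of n] False by (intro mult_mono) auto
            also have "\<dots> = (2 ^ (n + 2)) powr (p - 1) * (v x - ?j) powr p"
              using vj powr_mult_base[of "v x - ?j" "p - 1"] by (simp add: powr_mult mult_ac)
            finally show ?thesis using False vj by simp
          qed simp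
        qed
        show "AE x in M. 0 \<le> (2 ^ (n + 2)) powr (p - 1) * norm (max 0 (v x - ?j)) powr p" by simp
      qed
      also have "\<dots> = (2 ^ (n + 2)) powr (p - 1) * Y n" by (simp add: Y_def)
      finally have en: "(LINT x|M. norm (above ?k (v x) *\<^sub>R Dv x) powr p) \<le> B * ((2 ^ (n + 2)) powr (p - 1) * Y n)"
        using E[OF k(1)[of "Suc n"]] B by (smt (verit, best) mult_left_mono)
      have "Y (Suc n) \<le> Poincare_const * measure M ?A powr \<alpha> * (LINT x|M. norm (above ?k (v x) *\<^sub>R Dv x) powr p)"
        unfolding Y_def \<alpha>_def N_def by (rule Poincare_small_support[OF trunc]) (rule kn)
      also have "\<dots> \<le> Poincare_const * (Y n / (?k - ?j) powr p) powr \<alpha> * (B * ((2 ^ (n + 2)) powr (p - 1) * Y n))"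
        using cheb en \<alpha> Poincare_const_pos by (intro mult_mono powr_mono2 integral_Lp_nonneg) auto
      finally show ?thesis by (simp add: mult.assoc)
    qed
    \<comment> \<open>Dividing by \<open>K powr p\<close> removes K from the recursion, so \<delta>
      does not depend on K.\<close>
    define y where "y n = Y n / K powr p" for n
    have y0: "0 \<le> y n" for n using Y0[of n] by (simp add: y_def)
    have Yy: "Y n = K powr p * y n" for n using K by (simp add: y_def)
    have "y \<longlonglongrightarrow> 0"
    proof (rule conv[OF y0])
      show "y (Suc n) \<le> C * b ^ n * y n powr (1 + \<alpha>)" for n
      proof -
        have "Y n / (k (Suc n) - k n) powr p = (2 ^ Suc n) powr p * y n"
          unfolding kd Yy using K by (simp add: powr_mult powr_divide power_divide divide_simps)
        then have "K powr p * y (Suc n) \<le> Poincare_const * ((2 ^ Suc n) powr p * y n) powr \<alpha> * (B * (2 ^ (n + 2)) powr (p - 1) * (K powr p * y n))"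
          using step[of n] unfolding Yy by simp
        also have "\<dots> = K powr p * (Poincare_const * B * ((2 ^ Suc n) powr p) powr \<alpha> * (2 ^ (n + 2)) powr (p - 1) * y n powr (1 + \<alpha>))"
          using y0[of n] \<alpha> by (simp add: powr_mult powr_mult_base[of "y n" \<alpha>, symmetric] mult_ac)
        also have "((2 ^ Suc n) powr p) powr \<alpha> = (2::real) powr (p * \<alpha>) * (2 powr (p * \<alpha>)) ^ n"
          by (simp add: powr_powr powr_mult algebra_simps flip: powr_realpow powr_add)
        also have "((2::real) ^ (n + 2)) powr (p - 1) = 4 powr (p - 1) * (2 powr (p - 1)) ^ n"
        proof -
          have "((2::real) ^ (n + 2)) powr (p - 1) = (4 * 2 ^ n) powr (p - 1)" by (simp add: power_add)
          also have "\<dots> = 4 powr (p - 1) * (2 ^ n) powr (p - 1)" by (simp add: powr_mult)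
          also have "(2 ^ n) powr (p - 1) = ((2::real) powr (p - 1)) ^ n"
            by (simp add: powr_powr mult.commute flip: powr_realpow)
          finally show ?thesis .
        qed
        finally have "K powr p * y (Suc n) \<le> K powr p * (C * b ^ n * y n powr (1 + \<alpha>))"
          by (simp add: C_def b_def powr_add power_mult_distrib mult_ac)
        then show ?thesis using K by simp
      qed
      have "Y 0 \<le> (LINT x|M. norm (v x) powr p)"
        unfolding Y_def
      proof (rule integral_mono_AE[OF iY in_Lp_integrable[OF v(1)]])
        show "AE x in M. norm (max 0 (v x - k 0)) powr p \<le> norm (v x) powr p"
          using pos by eventually_elim (use k0[of 0] p_gt_1 in \<open>auto intro!: powr_mono2\<close>)
      qed (rule kn)
      then show "y 0 \<le> \<delta>" using small K by (simp add: y_def field_simps)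
    qed
    then have "(\<lambda>n. K powr p * y n) \<longlonglongrightarrow> 0" by (rule tendsto_mult_right_zero)
    then have lim: "Y \<longlonglongrightarrow> 0" unfolding Yy[symmetric] .
    have "(LINT x|M. norm (max 0 (v x - 2 * K)) powr p) \<le> Y n" for n
      unfolding Y_def using K k(2)[of n] k0[of n] p_gt_1
      by (intro integral_mono iY) (auto intro!: powr_mono2)
    then have "(LINT x|M. norm (max 0 (v x - 2 * K)) powr p) \<le> 0"
      by (intro LIMSEQ_le_const[OF lim]) auto
    then have "(LINT x|M. norm (max 0 (v x - 2 * K)) powr p) = 0"
      using integral_Lp_nonneg by (intro antisym)
    then have "AE x in M. norm (max 0 (v x - 2 * K)) powr p = 0"
      using iY[of "2 * K"] K by (subst (asm) integral_nonneg_eq_0_iff_AE) auto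
    then show "AE x in M. v x \<le> 2 * K"
      by eventually_elim (auto simp: max_def split: if_splits)
  qed
qed

end

section \<open>Positive weak solutions of the sublinear equation, with a fixed representative of the
  weak gradient\<close>

locale sublinear_solution = bounded_domain \<Omega> p for \<Omega> :: "'a::euclidean_space set" and p :: real +
  fixes \<mu> q :: real and v :: "'a \<Rightarrow> real" and Dv :: "'a \<Rightarrow> 'a"
  assumes \<mu>_pos: "0 < \<mu>" and q_gt_1: "1 < q" and q_less: "q < p"
    and W: "W1p0 \<Omega> p v Dv" and pos: "AE x in M. 0 < v x"
    and weak: "\<And>\<phi> D\<phi>. W1p0 \<Omega> p \<phi> D\<phi> \<Longrightarrow>
      (LINT x|M. norm (Dv x) powr (p - 2) * (Dv x \<bullet> D\<phi> x)) = \<mu> * (LINT x|M. \<bar>v x\<bar> powr (q - 2) * v x * \<phi> x)"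
begin

lemmas v_in_Lp = W1p0_in_Lp[OF W]

lemma v_measurable [measurable]: "v \<in> borel_measurable M" "Dv \<in> borel_measurable M"
  using v_in_Lp by (simp_all add: in_Lp_def)

lemma weak_pos:
  assumes "W1p0 \<Omega> p \<phi> D\<phi>"
  shows "(LINT x|M. norm (Dv x) powr (p - 2) * (Dv x \<bullet> D\<phi> x)) = \<mu> * (LINT x|M. v x powr (q - 1) * \<phi> x)"
proof -
  have [measurable]: "\<phi> \<in> borel_measurable M" using W1p0_in_Lp(1)[OF assms] by (simp add: in_Lp_def)
  have "(LINT x|M. \<bar>v x\<bar> powr (q - 2) * v x * \<phi> x) = (LINT x|M. v x powr (q - 1) * \<phi> x)"
  proof (rule integral_cong_AE)
    show "AE x in M. \<bar>v x\<bar> powr (q - 2) * v x * \<phi> x = v x powr (q - 1) * \<phi> x"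
      using pos
    proof eventually_elim
      case (elim x)
      then show ?case using powr_mult_base[of "v x" "q - 2"] by (simp add: mult.commute)
    qed
  qed measurable
  then show ?thesis using weak[OF assms] by simp
qed

lemma norm_powr_square: "norm z powr (p - 2) * (z \<bullet> z) = norm z powr p" for z :: 'a
proof (cases "z = 0")
  case False
  have "norm z powr (p - 2) * norm z powr 2 = norm z powr p" unfolding powr_add[symmetric] by simp
  then show ?thesis using False by (simp add: power2_norm_eq_inner)
qed (use p_gt_1 in simp)

lemma energy: "(LINT x|M. norm (Dv x) powr p) = \<mu> * (LINT x|M. norm (v x) powr q)"
proof -
  have "(LINT x|M. v x powr (q - 1) * v x) = (LINT x|M. norm (v x) powr q)"
  proof (rule integral_cong_AE)
    show "AE x in M. v x powr (q - 1) * v x = norm (v x) powr q"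
      using pos
    proof eventually_elim
      case (elim x)
      then show ?case using powr_mult_base[of "v x" "q - 1"] by (simp add: mult.commute)
    qed
  qed measurable
  then show ?thesis using weak_pos[OF W] by (simp add: norm_powr_square)
qed

text \<open>The equation is tested with max 0 (v - k). Where v > k >= K, the assumption q < p gives
  v^(q-p) <= K^(q-p), so the right-hand side is dominated by B v^(p-1) and the dependence on \<mu>
  and q is hidden in B.\<close>

lemma truncated_energy:
  assumes K: "0 < K" "\<mu> * K powr (q - p) \<le> B" and k: "K \<le> k"
  shows "(LINT x|M. norm (above k (v x) *\<^sub>R Dv x) powr p) \<le> B * (LINT x|M. v x powr (p - 1) * max 0 (v x - k))"
proof -
  have k0: "0 \<le> k" using K k by simp
  note T = W1p0_truncate[OF W k0]
  have [measurable]: "above k \<in> borel_measurable borel" unfolding above_def[abs_def] sgn_if by measurable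
  have iD: "integrable M (\<lambda>x. norm (Dv x) powr p)" by (rule in_Lp_integrable[OF v_in_Lp(2)])
  have "(LINT x|M. norm (above k (v x) *\<^sub>R Dv x) powr p) \<le> (LINT x|M. norm (Dv x) powr (p - 2) * (Dv x \<bullet> (above k (v x) *\<^sub>R Dv x)))"
  proof (rule integral_mono)
    show "integrable M (\<lambda>x. norm (above k (v x) *\<^sub>R Dv x) powr p)" by (rule in_Lp_integrable[OF W1p0_in_Lp(2)[OF T]])
    have "norm (Dv x) powr (p - 2) * (Dv x \<bullet> (above k (v x) *\<^sub>R Dv x)) = above k (v x) * norm (Dv x) powr p" for x
      by (simp add: mult.left_commute norm_powr_square)
    note * = this
    show "integrable M (\<lambda>x. norm (Dv x) powr (p - 2) * (Dv x \<bullet> (above k (v x) *\<^sub>R Dv x)))"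
      unfolding * by (rule Bochner_Integration.integrable_bound[OF iD])
        (auto simp: abs_mult above_bounds abs_of_nonneg intro!: AE_I2 mult_left_le_one_le)
    show "norm (above k (v x) *\<^sub>R Dv x) powr p \<le> norm (Dv x) powr (p - 2) * (Dv x \<bullet> (above k (v x) *\<^sub>R Dv x))" for x
    proof -
      \<comment> \<open>The weight lies in [0, 1] and p > 1, so raising it to the power p can only
        lower it, also on the level set where it is 1/2.\<close>
      have "above k (v x) powr p \<le> above k (v x)"
        using powr_mono'[of 1 p "above k (v x)"] above_bounds[of k "v x"] p_gt_1 by simp
      then show ?thesis
        unfolding * by (simp add: powr_mult above_bounds abs_of_nonneg mult_right_mono)
    qed
  qed
  also have "\<dots> = \<mu> * (LINT x|M. v x powr (q - 1) * max 0 (v x - k))" by (rule weak_pos[OF T])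
  also have "\<dots> = (LINT x|M. \<mu> * (v x powr (q - 1) * max 0 (v x - k)))" by simp
  also have "\<dots> \<le> (LINT x|M. B * (v x powr (p - 1) * max 0 (v x - k)))"
  proof (rule integral_mono_AE')
    show "integrable M (\<lambda>x. B * (v x powr (p - 1) * max 0 (v x - k)))"
    proof (intro integrable_mult_right Bochner_Integration.integrable_bound[OF in_Lp_integrable[OF v_in_Lp(1)]])
      show "AE x in M. norm (v x powr (p - 1) * max 0 (v x - k)) \<le> norm (norm (v x) powr p)"
        using pos
      proof eventually_elim
        case (elim x)
        have "v x powr (p - 1) * max 0 (v x - k) \<le> v x powr (p - 1) * v x"
          using elim k0 by (intro mult_left_mono) auto
        then show ?case using elim powr_mult_base[of "v x" "p - 1"] by (simp add: abs_mult mult.commute)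
      qed
    qed measurable
    show "AE x in M. \<mu> * (v x powr (q - 1) * max 0 (v x - k)) \<le> B * (v x powr (p - 1) * max 0 (v x - k))"
      using pos
    proof eventually_elim
      case (elim x)
      show ?case
      proof (cases "v x \<le> k")
        case False
        have "v x powr (q - 1) = v x powr (q - p) * v x powr (p - 1)" by (simp flip: powr_add)
        also have "\<dots> \<le> K powr (q - p) * v x powr (p - 1)"
          using False k K q_less by (intro mult_right_mono powr_mono2') auto
        finally have "\<mu> * v x powr (q - 1) \<le> \<mu> * (K powr (q - p) * v x powr (p - 1))"
          using \<mu>_pos by (intro mult_left_mono) auto
        also have "\<dots> \<le> B * v x powr (p - 1)"
          using mult_right_mono[OF K(2), of "v x powr (p - 1)"] by (simp add: mult.assoc)
        finally show ?thesis using mult_right_mono[of _ _ "max 0 (v x - k)"] by (simp add: mult.assoc[symmetric])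
      qed simp
    qed
    have "0 \<le> \<mu> * K powr (q - p)" using \<mu>_pos by simp
    then have "0 \<le> B" using K(2) by linarith
    then show "AE x in M. 0 \<le> B * (v x powr (p - 1) * max 0 (v x - k))" by simp
  qed
  also have "\<dots> = B * (LINT x|M. v x powr (p - 1) * max 0 (v x - k))" by simp
  finally show ?thesis .
qed

end

context bounded_domain
begin

text \<open>The order of quantifiers matters: \<delta> depends on \<open>B\<close> alone and is
  fixed before \<mu>, q, v and K.\<close>

lemma solution_sup_bound:
  assumes "0 < B"
  obtains \<delta> where "0 < \<delta>"
    and "\<And>\<mu> q v Dv K. \<lbrakk>sublinear_solution \<Omega> p \<mu> q v Dv; 0 < K; \<mu> * K powr (q - p) \<le> B;
      (LINT x|M. norm (v x) powr p) \<le> \<delta> * K powr p\<rbrakk> \<Longrightarrow> AE x in M. v x \<le> 2 * K"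
proof -
  obtain \<delta> where \<delta>: "0 < \<delta>" and it: "\<And>v Dv K. \<lbrakk>W1p0 \<Omega> p v Dv; AE x in M. 0 < v x; 0 < K;
      \<And>k. K \<le> k \<Longrightarrow> (LINT x|M. norm (above k (v x) *\<^sub>R Dv x) powr p)
        \<le> B * (LINT x|M. v x powr (p - 1) * max 0 (v x - k));
      (LINT x|M. norm (v x) powr p) \<le> \<delta> * K powr p\<rbrakk> \<Longrightarrow> AE x in M. v x \<le> 2 * K"
    using level_iteration[OF assms] by blast
  show ?thesis
  proof (rule that[OF \<delta>])
    fix \<mu> q v Dv K
    assume s: "sublinear_solution \<Omega> p \<mu> q v Dv" and K: "0 < K" "\<mu> * K powr (q - p) \<le> B"
      and "(LINT x|M. norm (v x) powr p) \<le> \<delta> * K powr p"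
    then show "AE x in M. v x \<le> 2 * K"
      using sublinear_solution.W[OF s] sublinear_solution.pos[OF s]
      by (intro it[of v Dv K] sublinear_solution.truncated_energy[OF s])
  qed
qed

end

section \<open>Picone's inequality\<close>

text \<open>In the application A and B are the gradients of v and \<phi>, m is the smoothed |\<phi>|
  and s = \<phi>, g is the smoothed v and \<gamma> the derivative of that smoothing; the vector
  paired with A is the gradient of (m^p - d) g^(1-p). With \<theta> = \<gamma> = 1 and d = 0 this is
  Picone's inequality. In general the cross term is absorbed by the negative term because \<theta>
  <= \<gamma>, and d leaves a linear error.\<close>

lemma Picone_pointwise:
  fixes A B :: "'a::real_inner" and p m s g \<gamma> \<theta> d :: real
  assumes p: "1 < p" and m: "0 < m" "\<bar>s\<bar> \<le> m" and g: "0 < g" and \<theta>: "0 < \<theta>" "\<theta> \<le> \<gamma>"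
  shows "norm A powr (p - 2) * (A \<bullet> (g powr (1 - p) *\<^sub>R ((p * m powr (p - 2) * s) *\<^sub>R B)
      + ((m powr p - d) * (- (p - 1) * \<gamma> * g powr (- p))) *\<^sub>R A))
    \<le> \<theta> powr (1 - p) * norm B powr p + d * ((p - 1) * \<gamma> * g powr (- p)) * norm A powr p"
proof (cases "A = 0")
  case True
  then show ?thesis using p by simp
next
  case False
  define a where "a = norm A"
  have a: "0 < a" using False by (simp add: a_def)
  \<comment> \<open>The scale-free quantity |\<phi>| |Dv| / v: the cross term is at most p X^(p-1)
    |B|, and apart from d the negative term is -(p-1) \<gamma> X^p.\<close>
  define X where "X = m * a / g"
  have X: "0 < X" using m a g by (simp add: X_def)
  have AA: "A \<bullet> A = a powr 2" using a by (simp add: a_def power2_norm_eq_inner[symmetric])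
  have Xp: "X powr p = m powr p * a powr p * g powr (- p)"
    using m a g by (simp add: X_def powr_mult powr_divide powr_minus field_simps)
  have Xp1: "X powr (p - 1) = m powr (p - 1) * a powr (p - 1) * g powr (1 - p)"
  proof -
    have "g powr (1 - p) = inverse (g powr (p - 1))" using powr_minus[of g "p - 1"] by simp
    then show ?thesis using m a g by (simp add: X_def powr_mult powr_divide field_simps)
  qed
  have "a powr (p - 2) * (g powr (1 - p) * (p * m powr (p - 2) * s) * (A \<bullet> B))
      \<le> a powr (p - 2) * (g powr (1 - p) * (p * m powr (p - 2) * m) * (a * norm B))"
  proof -
    have "s * (A \<bullet> B) \<le> \<bar>s\<bar> * \<bar>A \<bullet> B\<bar>" using abs_ge_self[of "s * (A \<bullet> B)"] by (simp add: abs_mult)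
    also have "\<dots> \<le> m * (a * norm B)"
      using m Cauchy_Schwarz_ineq2[of A B] unfolding a_def by (intro mult_mono) auto
    finally have "(a powr (p - 2) * g powr (1 - p) * p * m powr (p - 2)) * (s * (A \<bullet> B))
        \<le> (a powr (p - 2) * g powr (1 - p) * p * m powr (p - 2)) * (m * (a * norm B))"
      using p by (intro mult_left_mono) auto
    then show ?thesis by (simp add: mult_ac)
  qed
  also have "\<dots> = p * X powr (p - 1) * norm B"
  proof -
    have "m powr (p - 1) = m powr (p - 2) * m" "a powr (p - 1) = a powr (p - 2) * a"
      using m a powr_mult_base[of m "p - 2"] powr_mult_base[of a "p - 2"] by (simp_all add: mult.commute)
    then show ?thesis unfolding Xp1 by (simp only: mult_ac)
  qed
  also have "\<dots> \<le> (p - 1) * \<theta> * X powr p + \<theta> powr (1 - p) * norm B powr p"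
  proof -
    have t1: "\<theta> powr (1 - p) * \<theta> powr (p - 1) = 1" "\<theta> powr (1 - p) * \<theta> powr p = \<theta>"
      using \<theta> unfolding powr_add[symmetric] by simp_all
    have "p * (\<theta> * X) powr (p - 1) * norm B \<le> (p - 1) * (\<theta> * X) powr p + norm B powr p"
      using \<theta> X by (intro Young_powr[OF p]) auto
    then have "\<theta> powr (1 - p) * (p * (\<theta> * X) powr (p - 1) * norm B)
        \<le> \<theta> powr (1 - p) * ((p - 1) * (\<theta> * X) powr p + norm B powr p)"
      by (intro mult_left_mono) auto
    moreover have "\<theta> powr (1 - p) * (p * (\<theta> * X) powr (p - 1) * norm B) = p * X powr (p - 1) * norm B"
    proof -
      have "\<theta> powr (1 - p) * (p * (\<theta> * X) powr (p - 1) * norm B)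
          = (\<theta> powr (1 - p) * \<theta> powr (p - 1)) * (p * X powr (p - 1) * norm B)"
        using \<theta> X by (simp add: powr_mult mult_ac)
      then show ?thesis unfolding t1 by simp
    qed
    moreover have "\<theta> powr (1 - p) * ((p - 1) * (\<theta> * X) powr p + norm B powr p)
        = (\<theta> powr (1 - p) * \<theta> powr p) * ((p - 1) * X powr p) + \<theta> powr (1 - p) * norm B powr p"
      using \<theta> X by (simp add: powr_mult algebra_simps)
    ultimately show ?thesis unfolding t1 by (simp only: mult_ac)
  qed
  also have "(p - 1) * \<theta> * X powr p \<le> (p - 1) * \<gamma> * X powr p"
    using p \<theta> by (intro mult_right_mono mult_left_mono) auto
  finally have "a powr (p - 2) * (g powr (1 - p) * (p * m powr (p - 2) * s) * (A \<bullet> B))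
      \<le> (p - 1) * \<gamma> * (m powr p * a powr p * g powr (- p)) + \<theta> powr (1 - p) * norm B powr p"
    unfolding Xp by simp
  moreover have "a powr (p - 2) * a powr 2 = a powr p" unfolding powr_add[symmetric] by simp
  then have "a powr (p - 2) * (((m powr p - d) * (- (p - 1) * \<gamma> * g powr (- p))) * (A \<bullet> A))
      = - ((p - 1) * \<gamma> * (m powr p * a powr p * g powr (- p))) + d * ((p - 1) * \<gamma> * g powr (- p)) * a powr p"
  proof -
    have "a powr (p - 2) * (((m powr p - d) * (- (p - 1) * \<gamma> * g powr (- p))) * (A \<bullet> A))
        = ((m powr p - d) * (- (p - 1) * \<gamma> * g powr (- p))) * (a powr (p - 2) * a powr 2)"
      unfolding AA by (simp only: mult_ac)
    also have "\<dots> = ((m powr p - d) * (- (p - 1) * \<gamma> * g powr (- p))) * a powr p"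
      by (simp only: \<open>a powr (p - 2) * a powr 2 = a powr p\<close>)
    finally show ?thesis by (simp add: algebra_simps)
  qed
  ultimately show ?thesis
    unfolding a_def[symmetric] by (simp add: inner_add_right distrib_left)
qed

lemma real_le_if_le_add_pos_mult:
  fixes x y z :: real
  assumes "\<And>d. 0 < d \<Longrightarrow> x \<le> y + d * z"
  shows "x \<le> y"
proof (rule field_le_epsilon)
  fix e :: real assume "0 < e"
  define d where "d = e / (\<bar>z\<bar> + 1)"
  have d: "0 < d" using \<open>0 < e\<close> by (simp add: d_def add_nonneg_pos)
  have "d * z \<le> d * (\<bar>z\<bar> + 1)" using d by (intro mult_left_mono) auto
  also have "\<dots> = e" by (simp add: d_def)
  finally show "x \<le> y + e" using assms[OF d] by linarith
qed

section \<open>Picone's inequality integrated: from regularised test functions to all of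
  \<open>W1p0\<close>\<close>

context sublinear_solution
begin

lemma v_powr_integrable:
  assumes "0 \<le> s" "s \<le> p"
  shows "integrable M (\<lambda>x. v x powr s)"
proof (rule Bochner_Integration.integrable_bound)
  show "integrable M (\<lambda>x. 1 + norm (v x) powr p)" using in_Lp_integrable[OF v_in_Lp(1)] by auto
  show "AE x in M. norm (v x powr s) \<le> norm (1 + norm (v x) powr p)"
    using pos
  proof eventually_elim
    case (elim x)
    have "v x powr s \<le> 1 + v x powr p"
    proof (cases "v x \<le> 1")
      case True
      then have "v x powr s \<le> 1" using elim assms by (intro powr_le1) auto
      then show ?thesis by (simp add: add_increasing2)
    next
      case False
      then have "v x powr s \<le> v x powr p" using assms by (intro powr_mono) auto
      then show ?thesis by simp
    qed
    then show ?case using elim by simp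
  qed
qed measurable

text \<open>The test function is \<open>(m powr p - \<delta> powr p) * g(v) powr (1 - p)\<close> where \<open>m\<close> is a smooth
  substitute for \<open>|\<phi>|\<close> and \<open>g\<close> one for the identity on positive reals, bounded below by \<open>b\<^sup>2\<close> on all reals.\<close>

lemma Picone_regularised:
  assumes \<phi>: "test_function \<Omega> \<phi>" and b: "0 < b"
  shows "\<mu> * (LINT x|M. v x powr (q - 1) * (\<bar>\<phi> x\<bar> powr p * smooth_abs (b\<^sup>2) (v x + b) powr (1 - p)))
    \<le> (b / smooth_abs (b\<^sup>2) b) powr (1 - p) * (LINT x|M. norm (gradient \<phi> x) powr p)"
proof -
  define g where "g t = smooth_abs (b\<^sup>2) (t + b)" for t
  \<comment> \<open>The derivative \<gamma> of g increases on the positive reals, so its lower bound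
    there is its value at 0, namely \<theta> = 1 / sqrt (1 + b^2). The smoothing parameter b^2 is of
    smaller order than the shift b, hence \<theta> tends to 1 with b tending to 0.\<close>
  define \<theta> where "\<theta> = b / smooth_abs (b\<^sup>2) b"
  define F where "F t = g t powr (1 - p)" for t
  define \<gamma> where "\<gamma> t = (t + b) / g t" for t
  define F' where "F' t = - (p - 1) * \<gamma> t * g t powr (- p)" for t
  \<comment> \<open>A bound for \<open>F'\<close> on all reals, as the chain rule demands for
    arbitrary approximating functions; it exists because g stays above b^2.\<close>
  define \<kappa> where "\<kappa> = (p - 1) * (b\<^sup>2) powr (- p)"
  have b2: "0 < b\<^sup>2" using b by simp
  have g: "0 < g t" "b\<^sup>2 \<le> g t" "\<bar>t + b\<bar> \<le> g t" for t
    unfolding g_def using smooth_abs_bounds[OF b2] by auto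
  have \<theta>: "0 < \<theta>" unfolding \<theta>_def using b smooth_abs_bounds(1)[OF b2] by simp
  have \<gamma>1: "\<bar>\<gamma> t\<bar> \<le> 1" for t unfolding \<gamma>_def using g(1)[of t] g(3)[of t] by simp
  have \<gamma>\<theta>: "\<theta> \<le> \<gamma> t" if "0 < t" for t
  proof -
    have "(b * g t)\<^sup>2 \<le> ((t + b) * smooth_abs (b\<^sup>2) b)\<^sup>2"
    proof -
      have "b\<^sup>2 \<le> (t + b)\<^sup>2" using that b by (intro power_mono) auto
      then have "b\<^sup>2 * (b\<^sup>2)\<^sup>2 \<le> (t + b)\<^sup>2 * (b\<^sup>2)\<^sup>2" by (intro mult_right_mono) auto
      then show ?thesis
        unfolding g_def smooth_abs_def power_mult_distrib
        by (simp add: add_nonneg_nonneg) (simp add: algebra_simps)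
    qed
    then have "b * g t \<le> (t + b) * smooth_abs (b\<^sup>2) b"
      by (rule power2_le_imp_le) (use that b smooth_abs_bounds(1)[OF b2, of b] in auto)
    then show ?thesis
      unfolding \<theta>_def \<gamma>_def using g(1)[of t] smooth_abs_bounds(1)[OF b2, of b] by (simp add: divide_simps)
  qed
  have gp: "g t powr (- p) \<le> (b\<^sup>2) powr (- p)" for t
    using g(2)[of t] b2 p_gt_1 by (intro powr_mono2') auto
  have gc: "continuous_on UNIV g" unfolding g_def by (intro continuous_intros)
  have gne: "g t \<noteq> 0" for t using g(1)[of t] by simp
  have dg: "(g has_real_derivative \<gamma> t) (at t)" for t
    unfolding g_def \<gamma>_def by (rule DERIV_smooth_abs[OF b2])
  have dF: "(F has_real_derivative F' t) (at t)" for t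
  proof -
    have "((\<lambda>t. g t powr (1 - p)) has_real_derivative ((1 - p) * g t powr (1 - p - 1) * \<gamma> t)) (at t)"
      by (rule DERIV_chain2[OF has_real_derivative_powr[OF g(1)] dg])
    then show ?thesis unfolding F_def F'_def by (simp add: mult_ac)
  qed
  have F'c: "continuous_on UNIV F'"
    unfolding F'_def \<gamma>_def using gne by (intro continuous_intros gc) auto
  have F'b: "\<bar>F' t\<bar> \<le> \<kappa>" for t
  proof -
    have "\<bar>F' t\<bar> = (p - 1) * (\<bar>\<gamma> t\<bar> * g t powr (- p))" using p_gt_1 by (simp add: F'_def abs_mult)
    also have "\<dots> \<le> (p - 1) * (1 * (b\<^sup>2) powr (- p))"
      using p_gt_1 by (intro mult_left_mono mult_mono gp \<gamma>1) auto
    finally show ?thesis by (simp add: \<kappa>_def)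
  qed
  have Fb: "0 < F t" "F t \<le> (b\<^sup>2) powr (1 - p)" for t
    using g[of t] b2 p_gt_1 by (auto simp: F_def intro: powr_mono2')
  have [measurable]: "F \<in> borel_measurable borel"
    unfolding F_def using gne by (intro borel_measurable_continuous_onI continuous_intros gc) auto
  note sm = test_function_smooth[OF \<phi>]
  have [measurable]: "\<phi> \<in> borel_measurable M" "gradient \<phi> \<in> borel_measurable M"
    using in_Lp_test[OF \<phi>] by (simp_all add: in_Lp_def)
  obtain B where B: "0 < B" "\<And>x. \<bar>\<phi> x\<bar> \<le> B" using test_function_bounded[OF \<phi>] by metis
  have vq: "integrable M (\<lambda>x. v x powr (q - 1))" using q_gt_1 q_less by (intro v_powr_integrable) auto
  have iF: "integrable M (\<lambda>x. v x powr (q - 1) * (w x * F (v x)))"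
    if [measurable]: "w \<in> borel_measurable M" and w: "\<And>x. \<bar>w x\<bar> \<le> D" for w :: "'a \<Rightarrow> real" and D
  proof (rule Bochner_Integration.integrable_bound)
    show "integrable M (\<lambda>x. v x powr (q - 1) * (D * (b\<^sup>2) powr (1 - p)))" using vq by simp
    show "AE x in M. norm (v x powr (q - 1) * (w x * F (v x))) \<le> norm (v x powr (q - 1) * (D * (b\<^sup>2) powr (1 - p)))"
    proof (rule AE_I2)
      fix x
      have "\<bar>w x\<bar> * F (v x) \<le> D * (b\<^sup>2) powr (1 - p)"
        using w[of x] Fb[of "v x"] by (intro mult_mono) auto
      then show "norm (v x powr (q - 1) * (w x * F (v x))) \<le> norm (v x powr (q - 1) * (D * (b\<^sup>2) powr (1 - p)))"
        using Fb(1)[of "v x"] w[of x] by (simp add: abs_mult mult_left_mono)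
    qed
  qed measurable
  have phip: "\<bar>\<bar>\<phi> x\<bar> powr p\<bar> \<le> B powr p" for x
    using B(2)[of x] p_gt_1 by (simp add: powr_mono2)
  have ip: "integrable M (\<lambda>x. v x powr (q - 1) * (\<bar>\<phi> x\<bar> powr p * F (v x)))"
    by (rule iF[OF _ phip]) measurable
  have i1: "integrable M (\<lambda>x. v x powr (q - 1) * (1 * F (v x)))"
    by (rule iF[of "\<lambda>_. 1" 1]) auto
  have main: "\<mu> * (LINT x|M. v x powr (q - 1) * (\<bar>\<phi> x\<bar> powr p * F (v x)))
      \<le> \<theta> powr (1 - p) * (LINT x|M. norm (gradient \<phi> x) powr p)
        + d * (\<kappa> * (LINT x|M. norm (Dv x) powr p) + \<mu> * (LINT x|M. v x powr (q - 1) * F (v x)))"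
    if d: "0 < d" for d
  proof -
    \<comment> \<open>The smoothed modulus equals \<delta> at 0, so subtracting d = \<delta>^p makes
      \<psi> vanish wherever \<phi> does and keeps the support compact. The resulting errors are
      linear in d with coefficients free of d, and disappear as d tends to 0.\<close>
    define \<delta> where "\<delta> = d powr (1 / p)"
    have \<delta>: "0 < \<delta>" "\<delta> powr p = d" using d p_gt_1 by (simp_all add: \<delta>_def powr_powr)
    define m where "m t = smooth_abs \<delta> (t + 0)" for t
    have m: "0 < m t" "\<bar>t\<bar> \<le> m t" for t using smooth_abs_bounds[OF \<delta>(1), of t] by (simp_all add: m_def)
    define \<psi> where "\<psi> x = m (\<phi> x) powr p - d" for x
    have \<psi>t: "test_function \<Omega> \<psi>"
      unfolding \<psi>_def
    proof (rule test_function_compose[OF \<phi>])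
      show "smooth_on UNIV (\<lambda>x. m (\<phi> x) powr p - d)"
        unfolding m_def using m(1) unfolding m_def by (intro smooth_intros sm \<delta>) auto
      show "m 0 powr p - d = 0" using \<delta> by (simp add: m_def smooth_abs_def)
    qed
    have grad: "gradient \<psi> x = (p * m (\<phi> x) powr (p - 2) * \<phi> x) *\<^sub>R gradient \<phi> x" for x
      unfolding \<psi>_def
    proof (rule gradient_compose[OF sm])
      have "(m has_real_derivative \<phi> x / m (\<phi> x)) (at (\<phi> x))"
        using DERIV_smooth_abs[OF \<delta>(1), of 0 "\<phi> x"] by (simp add: m_def[abs_def])
      from DERIV_chain2[OF has_real_derivative_powr[OF m(1), of p "\<phi> x"] this]
      have "((\<lambda>t. m t powr p) has_real_derivative p * m (\<phi> x) powr (p - 1) * (\<phi> x / m (\<phi> x))) (at (\<phi> x))" .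
      moreover have "p * m (\<phi> x) powr (p - 1) * (\<phi> x / m (\<phi> x)) = p * m (\<phi> x) powr (p - 2) * \<phi> x"
        using m(1)[of "\<phi> x"] powr_mult_base[of "m (\<phi> x)" "p - 2"] by (simp add: divide_simps mult.commute)
      ultimately have "((\<lambda>t. m t powr p) has_real_derivative p * m (\<phi> x) powr (p - 2) * \<phi> x) (at (\<phi> x))"
        by simp
      from DERIV_diff[OF this DERIV_const[of d]]
      show "((\<lambda>t. m t powr p - d) has_real_derivative p * m (\<phi> x) powr (p - 2) * \<phi> x) (at (\<phi> x))" by simp
    qed
    obtain D where D: "0 < D" "\<And>x. \<bar>\<psi> x\<bar> \<le> D" "\<And>x. norm (gradient \<psi> x) \<le> D"
      using test_function_bounded[OF \<psi>t] by metis
    have T: "test_function \<Omega> (\<lambda>x. \<psi> x * F (\<eta> x))" if "test_function \<Omega> \<eta>" for \<eta>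
    proof -
      have "smooth_on UNIV (\<lambda>x. F (\<eta> x))"
        unfolding F_def g_def using g(1) unfolding g_def
        by (intro smooth_intros test_function_smooth[OF that] b2) auto
      from test_function_mult[OF \<psi>t this] show ?thesis by (simp add: mult.commute)
    qed
    note Tw = W1p0_compose[OF W test_function_smooth[OF \<psi>t] D(2,3) dF F'c F'b T]
    have \<psi>m [measurable]: "\<psi> \<in> borel_measurable M" using in_Lp_test(1)[OF \<psi>t] by (simp add: in_Lp_def)
    have "\<mu> * (LINT x|M. v x powr (q - 1) * (\<bar>\<phi> x\<bar> powr p * F (v x))) - d * (\<mu> * (LINT x|M. v x powr (q - 1) * F (v x)))
        = \<mu> * (LINT x|M. v x powr (q - 1) * (\<bar>\<phi> x\<bar> powr p * F (v x)) - d * (v x powr (q - 1) * (1 * F (v x))))"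
      using ip i1 by (simp add: algebra_simps)
    also have "\<dots> \<le> \<mu> * (LINT x|M. v x powr (q - 1) * (\<psi> x * F (v x)))"
    proof (intro mult_left_mono integral_mono Bochner_Integration.integrable_diff ip integrable_mult_right i1)
      show "integrable M (\<lambda>x. v x powr (q - 1) * (\<psi> x * F (v x)))" by (rule iF[OF \<psi>m D(2)])
      fix x
      have "\<bar>\<phi> x\<bar> powr p \<le> m (\<phi> x) powr p" using m(2) p_gt_1 by (intro powr_mono2) auto
      then have "v x powr (q - 1) * ((\<bar>\<phi> x\<bar> powr p - d) * F (v x)) \<le> v x powr (q - 1) * (\<psi> x * F (v x))"
        using Fb(1)[of "v x"] by (intro mult_left_mono mult_right_mono) (auto simp: \<psi>_def)
      then show "v x powr (q - 1) * (\<bar>\<phi> x\<bar> powr p * F (v x)) - d * (v x powr (q - 1) * (1 * F (v x)))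
          \<le> v x powr (q - 1) * (\<psi> x * F (v x))" by (simp add: algebra_simps)
    qed (use \<mu>_pos in auto)
    also have "\<dots> = (LINT x|M. norm (Dv x) powr (p - 2) * (Dv x \<bullet> (F (v x) *\<^sub>R gradient \<psi> x + (\<psi> x * F' (v x)) *\<^sub>R Dv x)))"
      by (rule weak_pos[OF Tw, symmetric])
    also have "\<dots> \<le> (LINT x|M. \<theta> powr (1 - p) * norm (gradient \<phi> x) powr p + d * \<kappa> * norm (Dv x) powr p)"
    proof (rule integral_mono_AE')
      show "integrable M (\<lambda>x. \<theta> powr (1 - p) * norm (gradient \<phi> x) powr p + d * \<kappa> * norm (Dv x) powr p)"
        by (intro Bochner_Integration.integrable_add integrable_mult_right in_Lp_integrable in_Lp_test(2)[OF \<phi>] v_in_Lp(2))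
      show "AE x in M. norm (Dv x) powr (p - 2) * (Dv x \<bullet> (F (v x) *\<^sub>R gradient \<psi> x + (\<psi> x * F' (v x)) *\<^sub>R Dv x))
          \<le> \<theta> powr (1 - p) * norm (gradient \<phi> x) powr p + d * \<kappa> * norm (Dv x) powr p"
        using pos
      proof eventually_elim
        case (elim x)
        have "(p - 1) * \<gamma> (v x) * g (v x) powr (- p) \<le> \<kappa>"
          using abs_le_D2[OF F'b[of "v x"]] unfolding F'_def by (simp only: minus_mult_left minus_minus)
        then have "d * ((p - 1) * \<gamma> (v x) * g (v x) powr (- p)) * norm (Dv x) powr p \<le> d * \<kappa> * norm (Dv x) powr p"
          using d by (intro mult_right_mono mult_left_mono) auto
        with Picone_pointwise[OF p_gt_1 m(1) m(2)[of "\<phi> x"] g(1)[of "v x"] \<theta> \<gamma>\<theta>[OF elim], of "Dv x" "gradient \<phi> x" d]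
        show ?case unfolding grad F_def F'_def \<psi>_def by linarith
      qed
      have "0 \<le> \<kappa>" using p_gt_1 by (simp add: \<kappa>_def)
      then show "AE x in M. 0 \<le> \<theta> powr (1 - p) * norm (gradient \<phi> x) powr p + d * \<kappa> * norm (Dv x) powr p"
        using d by simp
    qed
    also have "\<dots> = \<theta> powr (1 - p) * (LINT x|M. norm (gradient \<phi> x) powr p) + d * \<kappa> * (LINT x|M. norm (Dv x) powr p)"
      using in_Lp_integrable[OF in_Lp_test(2)[OF \<phi>]] in_Lp_integrable[OF v_in_Lp(2)] by simp
    finally show ?thesis by (simp add: algebra_simps)
  qed
  from real_le_if_le_add_pos_mult[OF main] show ?thesis
    unfolding F_def g_def \<theta>_def .
qed

text \<open>The regularisation is removed by letting b tend to 0. The left integrand is v^(q-p)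
  (v/g)^(p-1) |\<phi>|^p, where v/g lies in [0, 1] and tends to 1, so |\<phi>|^p dominates once
  v^(q-p) has been replaced by its lower bound.\<close>

lemma Picone_test:
  assumes L: "0 < L" "AE x in M. v x \<le> L" and \<phi>: "test_function \<Omega> \<phi>"
  shows "\<mu> * L powr (q - p) * (LINT x|M. norm (\<phi> x) powr p) \<le> (LINT x|M. norm (gradient \<phi> x) powr p)"
proof -
  have [measurable]: "\<phi> \<in> borel_measurable M"
    using in_Lp_test[OF \<phi>] by (simp_all add: in_Lp_def)
  note i\<phi> = in_Lp_integrable[OF in_Lp_test(1)[OF \<phi>]]
  define b where "b n = 1 / real (Suc n)" for n
  have b: "0 < b n" for n by (simp add: b_def)
  have blim: "b \<longlonglongrightarrow> 0" unfolding b_def by (rule LIMSEQ_Suc[OF lim_1_over_n])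
  define R where "R n x = v x / smooth_abs ((b n)\<^sup>2) (v x + b n)" for n x
  have sa: "0 < smooth_abs ((b n)\<^sup>2) t" "\<bar>t\<bar> \<le> smooth_abs ((b n)\<^sup>2) t" for n t
    using smooth_abs_bounds[of "(b n)\<^sup>2" t] b[of n] by auto
  have [measurable]: "R n \<in> borel_measurable M" for n
    unfolding R_def[abs_def] smooth_abs_def by measurable
  have R: "0 \<le> R n x" "R n x \<le> 1" if "0 < v x" for n x
    using that sa(1)[of n "v x + b n"] sa(2)[of "v x + b n" n] b[of n] by (simp_all add: R_def)
  have dom: "AE x in M. norm (R n x powr (p - 1) * norm (\<phi> x) powr p) \<le> norm (\<phi> x) powr p" for n
    using pos by eventually_elim (use R p_gt_1 in \<open>auto simp: abs_mult intro!: mult_left_le_one_le powr_le1\<close>)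
  have iR: "integrable M (\<lambda>x. R n x powr (p - 1) * norm (\<phi> x) powr p)" for n
    by (rule Bochner_Integration.integrable_bound[OF i\<phi>]) (use dom[of n] in auto)
  have le: "\<mu> * L powr (q - p) * (LINT x|M. R n x powr (p - 1) * norm (\<phi> x) powr p)
      \<le> (b n / smooth_abs ((b n)\<^sup>2) (b n)) powr (1 - p) * (LINT x|M. norm (gradient \<phi> x) powr p)" for n
  proof -
    have "L powr (q - p) * (LINT x|M. R n x powr (p - 1) * norm (\<phi> x) powr p)
        = (LINT x|M. L powr (q - p) * (R n x powr (p - 1) * norm (\<phi> x) powr p))" by simp
    also have "\<dots> \<le> (LINT x|M. v x powr (q - 1) * (\<bar>\<phi> x\<bar> powr p * smooth_abs ((b n)\<^sup>2) (v x + b n) powr (1 - p)))"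
    proof (rule integral_mono_AE)
      show "integrable M (\<lambda>x. L powr (q - p) * (R n x powr (p - 1) * norm (\<phi> x) powr p))"
        using iR by simp
      show "AE x in M. L powr (q - p) * (R n x powr (p - 1) * norm (\<phi> x) powr p)
          \<le> v x powr (q - 1) * (\<bar>\<phi> x\<bar> powr p * smooth_abs ((b n)\<^sup>2) (v x + b n) powr (1 - p))"
        using pos L(2)
      proof eventually_elim
        case (elim x)
        let ?g = "smooth_abs ((b n)\<^sup>2) (v x + b n)"
        have "L powr (q - p) * v x powr (p - 1) \<le> v x powr (q - p) * v x powr (p - 1)"
          using elim q_less by (intro mult_right_mono powr_mono2') auto
        also have "\<dots> = v x powr (q - 1)" by (simp flip: powr_add)
        finally have "L powr (q - p) * v x powr (p - 1) * (\<bar>\<phi> x\<bar> powr p * ?g powr (1 - p))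
            \<le> v x powr (q - 1) * (\<bar>\<phi> x\<bar> powr p * ?g powr (1 - p))"
          by (intro mult_right_mono) auto
        moreover have "R n x powr (p - 1) = v x powr (p - 1) * ?g powr (1 - p)"
          unfolding R_def using elim sa(1)[of n "v x + b n"] powr_minus[of ?g "p - 1"]
          by (simp add: powr_divide field_simps)
        ultimately show ?case by (simp add: mult_ac)
      qed
      have vq: "integrable M (\<lambda>x. v x powr (q - 1))" using q_gt_1 q_less by (intro v_powr_integrable) auto
      obtain B where B: "0 < B" "\<And>x. \<bar>\<phi> x\<bar> \<le> B" using test_function_bounded[OF \<phi>] by metis
      show "integrable M (\<lambda>x. v x powr (q - 1) * (\<bar>\<phi> x\<bar> powr p * smooth_abs ((b n)\<^sup>2) (v x + b n) powr (1 - p)))"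
      proof (rule Bochner_Integration.integrable_bound)
        show "integrable M (\<lambda>x. v x powr (q - 1) * (B powr p * ((b n)\<^sup>2) powr (1 - p)))" using vq by simp
        show "(\<lambda>x. v x powr (q - 1) * (\<bar>\<phi> x\<bar> powr p * smooth_abs ((b n)\<^sup>2) (v x + b n) powr (1 - p))) \<in> borel_measurable M"
          unfolding smooth_abs_def by measurable
        have "\<bar>\<phi> x\<bar> powr p * smooth_abs ((b n)\<^sup>2) (v x + b n) powr (1 - p) \<le> B powr p * ((b n)\<^sup>2) powr (1 - p)" for x
          using B(2)[of x] p_gt_1 b[of n] smooth_abs_bounds(3)[of "(b n)\<^sup>2" "v x + b n"]
          by (intro mult_mono powr_mono2 powr_mono2') auto
        then show "AE x in M. norm (v x powr (q - 1) * (\<bar>\<phi> x\<bar> powr p * smooth_abs ((b n)\<^sup>2) (v x + b n) powr (1 - p)))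
            \<le> norm (v x powr (q - 1) * (B powr p * ((b n)\<^sup>2) powr (1 - p)))"
          by (intro AE_I2) (simp add: abs_mult mult_left_mono)
      qed
    qed
    finally have "\<mu> * (L powr (q - p) * (LINT x|M. R n x powr (p - 1) * norm (\<phi> x) powr p))
      \<le> \<mu> * (LINT x|M. v x powr (q - 1) * (\<bar>\<phi> x\<bar> powr p * smooth_abs ((b n)\<^sup>2) (v x + b n) powr (1 - p)))"
      using \<mu>_pos by (intro mult_left_mono) auto
    also note Picone_regularised[OF \<phi> b[of n]]
    finally show ?thesis by (simp add: mult.assoc)
  qed
  have lim1: "(\<lambda>n. LINT x|M. R n x powr (p - 1) * norm (\<phi> x) powr p) \<longlonglongrightarrow> (LINT x|M. norm (\<phi> x) powr p)"
  proof (rule integral_dominated_convergence[OF _ _ i\<phi> _ dom])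
    show "AE x in M. (\<lambda>n. R n x powr (p - 1) * norm (\<phi> x) powr p) \<longlonglongrightarrow> norm (\<phi> x) powr p"
      using pos
    proof eventually_elim
      case (elim x)
      have "(\<lambda>n. R n x) \<longlonglongrightarrow> v x / sqrt ((v x + 0)\<^sup>2 + (0\<^sup>2)\<^sup>2)"
        unfolding R_def smooth_abs_def using elim by (intro tendsto_intros blim) auto
      then have "(\<lambda>n. R n x) \<longlonglongrightarrow> 1" using elim by simp
      then have "(\<lambda>n. R n x powr (p - 1) * norm (\<phi> x) powr p) \<longlonglongrightarrow> 1 powr (p - 1) * norm (\<phi> x) powr p"
        by (intro tendsto_intros) auto
      then show ?case by simp
    qed
  qed measurable
  have "(\<lambda>n. (b n / smooth_abs ((b n)\<^sup>2) (b n)) powr (1 - p)) \<longlonglongrightarrow> 1"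
  proof -
    have "b n / smooth_abs ((b n)\<^sup>2) (b n) = 1 / sqrt (1 + (b n)\<^sup>2)" for n
    proof -
      have "(b n)\<^sup>2 + ((b n)\<^sup>2)\<^sup>2 = (b n)\<^sup>2 * (1 + (b n)\<^sup>2)" by (simp add: algebra_simps power2_eq_square)
      then have "smooth_abs ((b n)\<^sup>2) (b n) = b n * sqrt (1 + (b n)\<^sup>2)"
        unfolding smooth_abs_def using b[of n] by (simp add: real_sqrt_mult)
      then show ?thesis using b[of n] by simp
    qed
    moreover have "(\<lambda>n. (1 / sqrt (1 + (b n)\<^sup>2)) powr (1 - p)) \<longlonglongrightarrow> (1 / sqrt (1 + 0\<^sup>2)) powr (1 - p)"
      by (intro tendsto_intros blim) auto
    ultimately show ?thesis by simp
  qed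
  from tendsto_mult[OF this tendsto_const[of "LINT x|M. norm (gradient \<phi> x) powr p"]]
  have lim2: "(\<lambda>n. (b n / smooth_abs ((b n)\<^sup>2) (b n)) powr (1 - p) * (LINT x|M. norm (gradient \<phi> x) powr p))
      \<longlonglongrightarrow> (LINT x|M. norm (gradient \<phi> x) powr p)" by simp
  show ?thesis
    by (rule LIMSEQ_le[OF tendsto_mult[OF tendsto_const lim1] lim2]) (use le in blast)
qed

text \<open>Both sides are continuous under L^p convergence of the function and its
  gradient.\<close>

lemma Picone:
  assumes L: "0 < L" "AE x in M. v x \<le> L" and u: "W1p0 \<Omega> p u Du"
  shows "\<mu> * L powr (q - p) * (LINT x|M. norm (u x) powr p) \<le> (LINT x|M. norm (Du x) powr p)"
proof -
  obtain \<phi> where \<phi>: "\<And>n. test_function \<Omega> (\<phi> n)"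
    and l1: "(\<lambda>n. LINT x|M. norm (u x - \<phi> n x) powr p) \<longlonglongrightarrow> 0"
    and l2: "(\<lambda>n. LINT x|M. norm (Du x - gradient (\<phi> n) x) powr p) \<longlonglongrightarrow> 0"
    using W1p0_approx_seq[OF u] by blast
  note Lp = W1p0_in_Lp[OF u] in_Lp_test[OF \<phi>]
  show ?thesis
    by (rule LIMSEQ_le[OF tendsto_mult[OF tendsto_const Lp_tendsto[OF Lp(1,3) l1]] Lp_tendsto[OF Lp(2,4) l2]])
      (use Picone_test[OF L \<phi>] in blast)
qed

end

section \<open>Comparison of the eigenvalue with its approximations\<close>

text \<open>With s = -ln t >= 0 one has 1 - t^(p-q) <= (p-q) s, and ln x <= x - 1 at x = t^(-q)
  gives t^q q s <= 1 - t^q. Since q > 1, s <= q s, and the constant becomes 1 for every q.\<close>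

lemma powr_diff_le:
  fixes t p q :: real
  assumes "0 < t" "t \<le> 1" "1 < q" "q < p"
  shows "t powr q - t powr p \<le> p - q"
proof -
  have tq: "0 < t powr q" "t powr q \<le> 1" using assms by (auto intro: powr_le1)
  have e1: "1 - t powr (p - q) \<le> (p - q) * (- ln t)"
  proof -
    have "t powr (p - q) = exp ((p - q) * ln t)" using assms by (simp add: powr_def)
    then show ?thesis using exp_ge_add_one_self[of "(p - q) * ln t"] unfolding mult_minus_right by linarith
  qed
  have e2: "q * (- ln t) \<le> 1 / t powr q - 1"
    using ln_le_minus_one[of "1 / t powr q"] tq assms by (simp add: ln_div ln_powr)
  have ln: "0 \<le> - ln t" using assms by simp
  have "t powr q - t powr p = t powr q * (1 - t powr (p - q))"
    by (simp add: algebra_simps flip: powr_add)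
  also have "\<dots> \<le> t powr q * ((p - q) * (- ln t))"
    using e1 tq by (intro mult_left_mono) auto
  also have "\<dots> \<le> t powr q * ((p - q) * (q * (- ln t)))"
    using tq assms mult_right_mono[OF less_imp_le[OF assms(3)] ln] by (intro mult_left_mono) auto
  also have "\<dots> \<le> t powr q * ((p - q) * (1 / t powr q - 1))"
    using e2 tq assms by (intro mult_left_mono) auto
  also have "\<dots> = (p - q) * (1 - t powr q)"
    using tq by (simp add: field_simps)
  also have "\<dots> \<le> (p - q) * 1"
    using tq assms by (intro mult_left_mono) auto
  finally show ?thesis by simp
qed

section \<open>Estimates for a single solution\<close>

context sublinear_solution
begin

text \<open>An infinite essential supremum would be turned into 0 by \<open>real_of_ereal\<close>,
  so finiteness must be known before \<open>Linf_norm\<close> is used. The sup bound is applied with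
  \<mu> itself as the constant.\<close>

lemma bounded_solution: "\<exists>c. AE x in M. v x \<le> c"
proof -
  obtain \<delta> where \<delta>: "0 < \<delta>" and bd: "\<And>\<mu>' q v Dv K. \<lbrakk>sublinear_solution \<Omega> p \<mu>' q v Dv; 0 < K; \<mu>' * K powr (q - p) \<le> \<mu>;
      (LINT x|M. norm (v x) powr p) \<le> \<delta> * K powr p\<rbrakk> \<Longrightarrow> AE x in M. v x \<le> 2 * K"
    using solution_sup_bound[OF \<mu>_pos] by blast
  define I where "I = (LINT x|M. norm (v x) powr p)"
  \<comment> \<open>The entry 1 gives \<mu> K^(q-p) <= \<mu> because q < p; the other entry makes
    \<delta> K^p at least the mass \<open>I\<close>.\<close>
  define K where "K = max 1 ((I / \<delta>) powr (1 / p))"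
  have I: "0 \<le> I" unfolding I_def by (rule integral_Lp_nonneg)
  have K: "1 \<le> K" by (simp add: K_def)
  have "\<mu> * K powr (q - p) \<le> \<mu> * 1"
    using \<mu>_pos K q_less powr_mono2'[of "q - p" 1 K] by (intro mult_left_mono) auto
  moreover have "I \<le> \<delta> * K powr p"
  proof -
    have "I / \<delta> = ((I / \<delta>) powr (1 / p)) powr p" using I \<delta> p_gt_1 by (simp add: powr_powr)
    also have "\<dots> \<le> K powr p" using p_gt_1 by (intro powr_mono2) (auto simp: K_def)
    finally show ?thesis using \<delta> by (simp add: field_simps)
  qed
  ultimately have "AE x in M. v x \<le> 2 * K"
    using K unfolding I_def by (intro bd[of \<mu> q v Dv] sublinear_solution_axioms) auto
  then show ?thesis by blast
qed

lemma not_AE_False: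
  assumes "\<Omega> \<noteq> {}"
  shows "\<not> (AE x in M. False)"
proof
  assume "AE x in M. False"
  then have "emeasure M \<Omega> = 0" using emeasure_eq_0_AE[of "\<lambda>_. True" M] by simp
  then have "emeasure lebesgue \<Omega> = 0" using \<Omega>_sets by (simp add: emeasure_restrict_space)
  then have "negligible \<Omega>" using \<Omega>_sets by (simp add: negligible_iff_null_sets null_setsI)
  then show False using open_not_negligible[OF open_\<Omega> assms] by simp
qed

text \<open>The last part, minimality among essential upper bounds, is what later contradicts a
  bound by half of the norm.\<close>

lemma Linf_norm_solution:
  assumes "\<Omega> \<noteq> {}"
  shows "AE x in M. v x \<le> Linf_norm \<Omega> v" "0 < Linf_norm \<Omega> v"
    and "AE x in M. v x \<le> c \<Longrightarrow> Linf_norm \<Omega> v \<le> c"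
proof -
  define E where "E = esssup M (\<lambda>x. ereal \<bar>v x\<bar>)"
  have meas: "(\<lambda>x. ereal \<bar>v x\<bar>) \<in> borel_measurable M" by measurable
  have le: "E \<le> ereal c" if "AE x in M. v x \<le> c" for c
    unfolding E_def
  proof (rule esssup_I[OF meas])
    show "AE x in M. ereal \<bar>v x\<bar> \<le> ereal c" using that pos by eventually_elim simp
  qed
  have AE: "AE x in M. ereal \<bar>v x\<bar> \<le> E" unfolding E_def by (rule esssup_AE)
  have "E \<noteq> \<infinity>" using bounded_solution le by fastforce
  have "0 < E"
  proof (rule ccontr)
    assume "\<not> 0 < E"
    have "AE x in M. False"
      using AE pos
    proof eventually_elim
      case (elim x)
      then have "ereal \<bar>v x\<bar> \<le> ereal 0"
        using order_trans[OF elim(1), of "ereal 0"] \<open>\<not> 0 < E\<close> by (simp add: not_less zero_ereal_def)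
      then show ?case using elim by simp
    qed
    then show False using not_AE_False[OF assms] by simp
  qed
  with \<open>E \<noteq> \<infinity>\<close> obtain L where L: "E = ereal L" by (cases E) auto
  have Linf: "Linf_norm \<Omega> v = L" unfolding Linf_norm_def E_def[symmetric] L by simp
  show "AE x in M. v x \<le> Linf_norm \<Omega> v" using AE unfolding Linf L by eventually_elim simp
  show "0 < Linf_norm \<Omega> v" using \<open>0 < E\<close> unfolding Linf L by simp
  show "Linf_norm \<Omega> v \<le> c" if "AE x in M. v x \<le> c" using le[OF that] unfolding Linf L by simp
qed

lemma Lambda_q_eq:
  "Lambda_q \<Omega> p \<mu> q v = \<mu> * (LINT x|M. norm (v x) powr q) / (LINT x|M. norm (v x) powr p)"
proof -
  have "0 \<le> (LINT x|M. norm (v x) powr r)" for r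
    by (rule Bochner_Integration.integral_nonneg) simp
  then show ?thesis
    using p_gt_1 q_gt_1 by (simp add: Lambda_q_def Lp_norm_def powr_powr)
qed

lemma solution_not_AE_zero:
  assumes "\<Omega> \<noteq> {}"
  shows "\<not> (AE x in M. v x = 0)"
proof
  assume "AE x in M. v x = 0"
  with pos have "AE x in M. False" by eventually_elim simp
  then show False using not_AE_False[OF assms] by simp
qed

lemma first_eigenvalue_le_Lambda_q:
  assumes "\<Omega> \<noteq> {}"
  shows "first_eigenvalue \<Omega> p \<le> Lambda_q \<Omega> p \<mu> q v"
  unfolding first_eigenvalue_def Lambda_q_eq
proof (rule cInf_lower)
  show "bdd_below {(LINT x|M. norm (Du x) powr p) / (LINT x|M. \<bar>u x\<bar> powr p)
          | u Du. W1p0 \<Omega> p u Du \<and> \<not> (AE x in M. u x = 0)}"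
    by (rule bdd_belowI[of _ 0]) (auto intro!: divide_nonneg_nonneg Bochner_Integration.integral_nonneg)
  show "\<mu> * (LINT x|M. norm (v x) powr q) / (LINT x|M. norm (v x) powr p) \<in>
      {(LINT x|M. norm (Du x) powr p) / (LINT x|M. \<bar>u x\<bar> powr p)
          | u Du. W1p0 \<Omega> p u Du \<and> \<not> (AE x in M. u x = 0)}"
    using W solution_not_AE_zero[OF assms] energy by force
qed

lemma mu_q_eq: "mu_q \<Omega> p \<mu> q v = \<mu> * Linf_norm \<Omega> v powr (q - p)"
  using powr_minus_divide[of "Linf_norm \<Omega> v" "p - q"] by (simp add: mu_q_def)

lemma mu_q_le_first_eigenvalue:
  assumes "\<Omega> \<noteq> {}"
  shows "mu_q \<Omega> p \<mu> q v \<le> first_eigenvalue \<Omega> p"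
  unfolding first_eigenvalue_def mu_q_eq
proof (rule cInf_greatest)
  show "{(LINT x|M. norm (Du x) powr p) / (LINT x|M. \<bar>u x\<bar> powr p)
          | u Du. W1p0 \<Omega> p u Du \<and> \<not> (AE x in M. u x = 0)} \<noteq> {}"
    using W solution_not_AE_zero[OF assms] by blast
  fix r
  assume "r \<in> {(LINT x|M. norm (Du x) powr p) / (LINT x|M. \<bar>u x\<bar> powr p)
          | u Du. W1p0 \<Omega> p u Du \<and> \<not> (AE x in M. u x = 0)}"
  then obtain u Du where r: "r = (LINT x|M. norm (Du x) powr p) / (LINT x|M. \<bar>u x\<bar> powr p)"
    and u: "W1p0 \<Omega> p u Du" "\<not> (AE x in M. u x = 0)" by blast
  have "(LINT x|M. norm (u x) powr p) \<noteq> 0"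
  proof
    assume "(LINT x|M. norm (u x) powr p) = 0"
    then have "AE x in M. norm (u x) powr p = 0"
      using in_Lp_integrable[OF W1p0_in_Lp(1)[OF u(1)]] by (subst (asm) integral_nonneg_eq_0_iff_AE) auto
    then show False using u(2) by simp
  qed
  then have "0 < (LINT x|M. \<bar>u x\<bar> powr p)" using integral_Lp_nonneg[of u] by (simp add: less_le)
  then show "\<mu> * Linf_norm \<Omega> v powr (q - p) \<le> r"
    unfolding r using Picone[OF Linf_norm_solution(2,1)[OF assms] u(1)] by (simp add: field_simps)
qed

text \<open>In the proof \<open>c\<close> bounds \<open>D\<close>, the p-mass of v / L, from below,
  so the relative error \<open>(A - D) / D\<close> is at most |\<Omega>| (p-q) / c. It is a
  parameter because a choice uniform in q can only be made outside the context of one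
  solution.\<close>

lemma Lambda_q_le:
  assumes ne: "\<Omega> \<noteq> {}" and c: "0 < c" "c * Linf_norm \<Omega> v powr p \<le> (LINT x|M. norm (v x) powr p)"
  shows "Lambda_q \<Omega> p \<mu> q v \<le> mu_q \<Omega> p \<mu> q v + mu_q \<Omega> p \<mu> q v * (measure M \<Omega> / c * (p - q))"
proof -
  define L where "L = Linf_norm \<Omega> v"
  note Linf = Linf_norm_solution[OF ne, folded L_def]
  define A where "A = L powr (- q) * (LINT x|M. norm (v x) powr q)"
  define D where "D = L powr (- p) * (LINT x|M. norm (v x) powr p)"
  have iq: "integrable M (\<lambda>x. norm (v x) powr q)"
  proof (subst integrable_cong_AE[of _ _ "\<lambda>x. v x powr q"])
    show "AE x in M. norm (v x) powr q = v x powr q" using pos by eventually_elim simp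
    show "integrable M (\<lambda>x. v x powr q)" using q_gt_1 q_less by (intro v_powr_integrable) auto
  qed measurable
  note ip = in_Lp_integrable[OF v_in_Lp(1)]
  have D: "c \<le> D"
  proof -
    have "L powr (- p) * (c * L powr p) \<le> D"
      unfolding D_def using c(2) by (intro mult_left_mono) (simp_all add: L_def)
    moreover have "L powr (- p) * (c * L powr p) = c" using Linf(2) by (simp add: powr_minus field_simps)
    ultimately show ?thesis by simp
  qed
  have "A - D = (LINT x|M. L powr (- q) * norm (v x) powr q - L powr (- p) * norm (v x) powr p)"
    unfolding A_def D_def using ip iq by simp
  also have "\<dots> \<le> (LINT x|M. p - q)"
  proof (rule integral_mono_AE)
    show "AE x in M. L powr (- q) * norm (v x) powr q - L powr (- p) * norm (v x) powr p \<le> p - q"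
      using pos Linf(1)
    proof eventually_elim
      case (elim x)
      have "L powr (- r) * norm (v x) powr r = (v x / L) powr r" for r
        using elim Linf(2) by (simp add: powr_divide powr_minus field_simps)
      then show ?case
        using powr_diff_le[of "v x / L" q p] elim Linf(2) q_gt_1 q_less by simp
    qed
  qed (use ip iq in auto)
  also have "\<dots> = (p - q) * measure M \<Omega>" by simp
  finally have AD: "A - D \<le> (p - q) * measure M \<Omega>" .
  have m: "0 \<le> mu_q \<Omega> p \<mu> q v" unfolding mu_q_eq using \<mu>_pos by simp
  have D0: "0 < D" using D c by simp
  have "Lambda_q \<Omega> p \<mu> q v = mu_q \<Omega> p \<mu> q v * (A / D)"
  proof -
    have "L powr (q - p) * (L powr (- q) / L powr (- p)) = 1"
      using Linf(2) unfolding powr_diff[symmetric] powr_add[symmetric] by simp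
    then have "\<mu> * (LINT x|M. norm (v x) powr q) / (LINT x|M. norm (v x) powr p)
        = \<mu> * (L powr (q - p) * (L powr (- q) / L powr (- p))) * ((LINT x|M. norm (v x) powr q) / (LINT x|M. norm (v x) powr p))"
      by simp
    then show ?thesis unfolding Lambda_q_eq mu_q_eq L_def[symmetric] A_def D_def
      by (simp add: mult_ac)
  qed
  also have "A / D = 1 + (A - D) / D" using D0 by (simp add: field_simps)
  also have "(A - D) / D \<le> measure M \<Omega> / c * (p - q)"
  proof -
    have "(A - D) / D \<le> (p - q) * measure M \<Omega> / D" using AD D0 by (intro divide_right_mono) auto
    also have "\<dots> \<le> (p - q) * measure M \<Omega> / c" using D c q_less by (intro divide_left_mono) auto
    finally show ?thesis by (simp add: mult.commute)
  qed
  finally show ?thesis using m by (simp add: mult_left_mono distrib_left)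
qed

end

section \<open>A lower bound for the mass uniform in q, and the final estimate\<close>

context bounded_domain
begin

text \<open>By Picone \<open>\<mu> * L powr (q - p)\<close> is at most the first eigenvalue for the supremum \<open>L\<close> of \<open>v\<close>,
  so the sup bound can be used at the level \<open>L / 4\<close> with a constant independent of \<open>q\<close>.\<close>

lemma uniform_mass_lower_bound:
  assumes ne: "\<Omega> \<noteq> {}"
  obtains c where "0 < c"
    and "\<And>\<mu> q v Dv. sublinear_solution \<Omega> p \<mu> q v Dv \<Longrightarrow>
      c * Linf_norm \<Omega> v powr p \<le> (LINT x|M. norm (v x) powr p)"
proof -
  \<comment> \<open>Has to dominate \<open>4 powr (p - q) * mu_q\<close> for all q at once:
    \<open>4 powr p\<close> covers the powers, the eigenvalue bounds \<open>mu_q\<close>, and the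
    absolute value together with the summand 1 makes \<open>B\<close> positive.\<close>
  define B where "B = 4 powr p * \<bar>first_eigenvalue \<Omega> p\<bar> + 1"
  have "0 < B" by (simp add: B_def add_nonneg_pos)
  then obtain \<delta> where \<delta>: "0 < \<delta>" and bd: "\<And>\<mu> q v Dv K. \<lbrakk>sublinear_solution \<Omega> p \<mu> q v Dv; 0 < K; \<mu> * K powr (q - p) \<le> B;
      (LINT x|M. norm (v x) powr p) \<le> \<delta> * K powr p\<rbrakk> \<Longrightarrow> AE x in M. v x \<le> 2 * K"
    using solution_sup_bound[of B] by blast
  show ?thesis
  proof (rule that[of "\<delta> * (1 / 4) powr p"])
    show "0 < \<delta> * (1 / 4) powr p" using \<delta> by simp
    fix \<mu> q v Dv assume s: "sublinear_solution \<Omega> p \<mu> q v Dv"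
    then interpret sublinear_solution \<Omega> p \<mu> q v Dv .
    define L where "L = Linf_norm \<Omega> v"
    note Linf = Linf_norm_solution[OF ne, folded L_def]
    have "\<mu> * (L / 4) powr (q - p) = 4 powr (p - q) * mu_q \<Omega> p \<mu> q v"
      unfolding mu_q_eq L_def[symmetric] using Linf(2) powr_minus[of 4 "p - q"]
      by (simp add: powr_divide field_simps)
    also have "\<dots> \<le> 4 powr (p - q) * \<bar>first_eigenvalue \<Omega> p\<bar>"
      using mu_q_le_first_eigenvalue[OF ne] by (intro mult_left_mono) auto
    also have "\<dots> \<le> 4 powr p * \<bar>first_eigenvalue \<Omega> p\<bar>"
      using q_gt_1 by (intro mult_right_mono powr_mono) auto
    finally have B: "\<mu> * (L / 4) powr (q - p) \<le> B" by (simp add: B_def)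
    have "\<not> (LINT x|M. norm (v x) powr p) \<le> \<delta> * (L / 4) powr p"
    proof
      assume "(LINT x|M. norm (v x) powr p) \<le> \<delta> * (L / 4) powr p"
      \<comment> \<open>The sup bound at level L/4 would give v <= L/2 almost everywhere, below the
        least essential bound L.\<close>
      then have "AE x in M. v x \<le> 2 * (L / 4)" using Linf(2) B by (intro bd[OF s]) auto
      then show False using Linf(3)[of "2 * (L / 4)"] Linf(2) by simp
    qed
    then show "\<delta> * (1 / 4) powr p * Linf_norm \<Omega> v powr p \<le> (LINT x|M. norm (v x) powr p)"
      unfolding L_def[symmetric] using Linf(2) by (simp add: powr_divide)
  qed
qed

end

theorem theorem10:
  fixes \<Omega> :: "(real ^ 'n) set" and p \<mu> :: real and v :: "real \<Rightarrow> real ^ 'n \<Rightarrow> real"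
  assumes "CARD('n) \<ge> 2" and "smooth_bounded_domain \<Omega>" and "1 < p" and "0 < \<mu>"
    and "\<And>q. 1 < q \<Longrightarrow> q < p \<Longrightarrow> positive_solution \<Omega> p \<mu> q (v q)"
  shows "(\<forall>q. 1 < q \<and> q < p \<longrightarrow> first_eigenvalue \<Omega> p \<le> Lambda_q \<Omega> p \<mu> q (v q)) \<and>
    ((\<lambda>q. Lambda_q \<Omega> p \<mu> q (v q)) \<longlongrightarrow> first_eigenvalue \<Omega> p) (at_left p) \<and>
    (\<exists>K>0. \<forall>\<^sub>F q in at_left p.
        0 \<le> max (first_eigenvalue \<Omega> p - mu_q \<Omega> p \<mu> q (v q))
                (Lambda_q \<Omega> p \<mu> q (v q) - first_eigenvalue \<Omega> p) \<and>
        max (first_eigenvalue \<Omega> p - mu_q \<Omega> p \<mu> q (v q))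
            (Lambda_q \<Omega> p \<mu> q (v q) - first_eigenvalue \<Omega> p) \<le> K * (p - q))"
proof -
  let ?l = "first_eigenvalue \<Omega> p" and ?m = "\<lambda>q. mu_q \<Omega> p \<mu> q (v q)" and ?L = "\<lambda>q. Lambda_q \<Omega> p \<mu> q (v q)"
  have dom: "open \<Omega>" "bounded \<Omega>" and ne: "\<Omega> \<noteq> {}"
    using assms(2) by (auto simp: smooth_bounded_domain_def)
  interpret bounded_domain \<Omega> p by unfold_locales (use dom assms(3) in auto)
  have sol: "\<exists>Dv. sublinear_solution \<Omega> p \<mu> q (v q) Dv" if q: "1 < q" "q < p" for q
  proof -
    obtain Dv where "W1p0 \<Omega> p (v q) Dv" and "\<And>\<phi> D\<phi>. W1p0 \<Omega> p \<phi> D\<phi> \<Longrightarrow>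
        (LINT x|M. norm (Dv x) powr (p - 2) * (Dv x \<bullet> D\<phi> x)) =
        \<mu> * (LINT x|M. \<bar>v q x\<bar> powr (q - 2) * v q x * \<phi> x)"
      and "AE x in M. 0 < v q x"
      using assms(5)[OF q] unfolding positive_solution_def weak_solution_def by blast
    then have "sublinear_solution \<Omega> p \<mu> q (v q) Dv"
      using q assms(4) by unfold_locales auto
    then show ?thesis by blast
  qed
  obtain c where c: "0 < c" and mass: "\<And>\<mu> q v Dv. sublinear_solution \<Omega> p \<mu> q v Dv \<Longrightarrow>
      c * Linf_norm \<Omega> v powr p \<le> (LINT x|M. norm (v x) powr p)"
    using uniform_mass_lower_bound[OF ne] by blast
  \<comment> \<open>The absolute value of the eigenvalue bounds every \<open>mu_q\<close>,
    \<open>measure M \<Omega> / c\<close> is the relative error per unit of p - q, and the summand 1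
    keeps \<open>K\<close> positive.\<close>
  define K where "K = \<bar>?l\<bar> * (measure M \<Omega> / c) + 1"
  have K: "0 < K" using c by (simp add: K_def add_nonneg_pos)
  have main: "?l \<le> ?L q" "?m q \<le> ?l" "?L q - ?m q \<le> K * (p - q)" if q: "1 < q" "q < p" for q
  proof -
    obtain Dv where s: "sublinear_solution \<Omega> p \<mu> q (v q) Dv" using sol[OF q] by blast
    interpret s: sublinear_solution \<Omega> p \<mu> q "v q" Dv by (rule s)
    show "?l \<le> ?L q" by (rule s.first_eigenvalue_le_Lambda_q[OF ne])
    show ml: "?m q \<le> ?l" by (rule s.mu_q_le_first_eigenvalue[OF ne])
    have "?L q - ?m q \<le> ?m q * (measure M \<Omega> / c * (p - q))"
      using s.Lambda_q_le[OF ne c mass[OF s]] by simp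
    also have "\<dots> \<le> \<bar>?l\<bar> * (measure M \<Omega> / c * (p - q))"
      using ml c q by (intro mult_right_mono) auto
    also have "\<dots> \<le> K * (p - q)" using q by (simp add: K_def algebra_simps)
    finally show "?L q - ?m q \<le> K * (p - q)" .
  qed
  have ev: "\<forall>\<^sub>F q in at_left p. 1 < q \<and> q < p"
    using assms(3) by (auto simp: eventually_at_left[of 1 p] intro: exI[of _ 1])
  show ?thesis
  proof (intro conjI)
    show "\<forall>q. 1 < q \<and> q < p \<longrightarrow> ?l \<le> ?L q" using main(1) by blast
    show "(?L \<longlongrightarrow> ?l) (at_left p)"
    proof (rule tendsto_sandwich)
      show "\<forall>\<^sub>F q in at_left p. ?l \<le> ?L q" using ev by eventually_elim (use main(1) in blast)
      show "\<forall>\<^sub>F q in at_left p. ?L q \<le> ?l + K * (p - q)"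
        using ev by eventually_elim (use main(2,3) in fastforce)
      have "((\<lambda>q. ?l + K * (p - q)) \<longlongrightarrow> ?l + K * (p - p)) (at_left p)" by (intro tendsto_intros)
      then show "((\<lambda>q. ?l + K * (p - q)) \<longlongrightarrow> ?l) (at_left p)" by simp
    qed simp
    show "\<exists>K>0. \<forall>\<^sub>F q in at_left p. 0 \<le> max (?l - ?m q) (?L q - ?l) \<and> max (?l - ?m q) (?L q - ?l) \<le> K * (p - q)"
    proof (intro exI[of _ K] conjI K)
      show "\<forall>\<^sub>F q in at_left p. 0 \<le> max (?l - ?m q) (?L q - ?l) \<and> max (?l - ?m q) (?L q - ?l) \<le> K * (p - q)"
        using ev
      proof eventually_elim
        case (elim q)
        \<comment> \<open>The eigenvalue lies between \<open>mu_q\<close> and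
          \<open>Lambda_q\<close>, so each difference is nonnegative and at most
          \<open>Lambda_q - mu_q\<close>.\<close>
        then show ?case using main[of q] by auto
      qed
    qed
  qed
qed

end
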